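(* Suppose $\mathcal{X}=(x_n)_{n=1}^\infty$ is a quasi-greedy basis of a superreflexive Banach space $\mathbb{X}$. Let $w_u$ be the weight whose primitive sequence is $\varphi_u[\mathcal{X},\mathbb{X}]$. Then there is $q>1$ such that $d_{1,q}(w_u)$ embeds in $\mathbb{X}$ via $\mathcal{X}$, that is, $\sum_{n=1}^\infty a_nx_n$ converges in $\mathbb{X}$ for every $(a_n)_{n=1}^\infty\in d_{1,q}(w_u)$.
   Context: $\mathbb{X}$ is an infinite-dimensional separable Banach space over $\mathbb{F}\in\{\mathbb{R},\mathbb{C}\}$. A Banach space is superreflexive if every Banach space finitely representable in it is reflexive (equivalently, it admits an equivalent uniformly convex norm). Basis: a sequence $\mathcal{X}=(x_n)_{n=1}^\infty$ in $\mathbb{X}$ with dense linear span, for which there is a (unique) sequence $(x_n^* )_{n=1}^\infty$ in $\mathbb{X}^*$ such that $(x_n,x_n^* )_n$ is a biorthogonal system, and with $\inf_n\|x_n\|>0$, $\sup_n\|x_n\|<\infty$. Thresholding greedy algorithm: $\mathcal{G}_m(f)$ is the sum of the $m$ terms $x_n^*(f)x_n$ whose coefficients are largest in modulus, ties being resolved by taking the terms in the basis order. (It is part of the notions defined through $\mathcal{G}_m$ that it is well defined on $\mathbb{X}$, i.e. $(x_n^*(f))_n\in c_0$ for all $f\in\mathbb{X}$, equivalently $\sup_n\|x_n^*\|<\infty$.) The basis is quasi-greedy if there is a constant $C$ such that $\max\{\|f-\mathcal{G}_m(f)\|,\|\mathcal{G}_m(f)\|\}\le C\|f\|$ for all $f\in\mathbb{X}$,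 $m\in\mathbb{N}$. Fundamental function: $\varphi_u[\mathcal{X},\mathbb{X}](m)=\sup\{\|\sum_{n\in A}\varepsilon_n x_n\|: |A|\le m,\ |\varepsilon_n|=1\}$. A weight is a sequence $w=(w_n)_{n=1}^\infty$ of non-negative scalars with $w_1>0$; its primitive sequence is $s_m=\sum_{n=1}^m w_n$. For $0<q<\infty$ and $f\in c_0$ with non-increasing rearrangement $f^*=(a_n)_{n=1}^\infty$ of $|f|$, put $\|f\|_{1,q,w}=\left(\sum_{n=1}^\infty (a_ns_n)^q\frac{w_n}{s_n}\right)^{1/q}$ and $d_{1,q}(w)=\{f\in c_0:\|f\|_{1,q,w}<\infty\}$. *)

theory Defs
  imports "HOL-Analysis.Analysis"
begin

section \<open>The scalar field\<close>

text \<open>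
  The scalars are the reals or the complex numbers, with the usual absolute value; the class lets
  one statement cover both cases.
\<close>

class real_or_complex = real_normed_field +
  assumes real_or_complex:
    "\<exists>\<phi> :: 'a \<Rightarrow> complex. (\<forall>a b. \<phi> (a + b) = \<phi> a + \<phi> b) \<and> (\<forall>a b. \<phi> (a * b) = \<phi> a * \<phi> b) \<and>
       (\<forall>a. norm (\<phi> a) = norm a) \<and> (range \<phi> = \<real> \<or> range \<phi> = UNIV)"

instance real :: real_or_complex
proof
  have "range complex_of_real = \<real>"
    by (simp add: Reals_def)
  then show "\<exists>\<phi> :: real \<Rightarrow> complex. (\<forall>a b. \<phi> (a + b) = \<phi> a + \<phi> b) \<and> (\<forall>a b. \<phi> (a * b) = \<phi> a * \<phi> b) \<and>
      (\<forall>a. norm (\<phi> a) = norm a) \<and> (range \<phi> = \<real> \<or> range \<phi> = UNIV)"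
    by (intro exI[of _ complex_of_real]) auto
qed

instance complex :: real_or_complex
proof
  show "\<exists>\<phi> :: complex \<Rightarrow> complex. (\<forall>a b. \<phi> (a + b) = \<phi> a + \<phi> b) \<and> (\<forall>a b. \<phi> (a * b) = \<phi> a * \<phi> b) \<and>
      (\<forall>a. norm (\<phi> a) = norm a) \<and> (range \<phi> = \<real> \<or> range \<phi> = UNIV)"
    by (intro exI[of _ id]) auto
qed

section \<open>Banach spaces\<close>

text \<open>
  The ambient space of the theory is a type of class \<open>banach\<close> together with a multiplication
  by scalars in \<open>'k\<close> that extends \<open>scaleR\<close>.
\<close>

locale scalar_banach = vector_space smul
  for smul :: "'k::real_or_complex \<Rightarrow> 'a::banach \<Rightarrow> 'a" +
  assumes scale_of_real: "smul (of_real r) v = r *\<^sub>R v"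
    and norm_scale: "norm (smul c v) = norm c * norm v"

text \<open>
  Superreflexivity quantifies over Banach spaces, so these are also needed as values.
  Only the behaviour of the operations on \<open>points\<close> matters.
\<close>

record ('k, 'v) nspace =
  points :: "'v set"
  vadd :: "'v \<Rightarrow> 'v \<Rightarrow> 'v"
  vzero :: 'v
  vscale :: "'k \<Rightarrow> 'v \<Rightarrow> 'v"
  vnorm :: "'v \<Rightarrow> real"

definition space_of :: "('k \<Rightarrow> 'a \<Rightarrow> 'a) \<Rightarrow> ('k, 'a::real_normed_vector) nspace" where
  "space_of smul = \<lparr>points = UNIV, vadd = (+), vzero = 0, vscale = smul, vnorm = norm\<rparr>"

locale banach_space =
  fixes Y :: "('k::real_or_complex, 'v) nspace"
  assumes zero_closed: "vzero Y \<in> points Y"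
    and add_closed: "u \<in> points Y \<Longrightarrow> v \<in> points Y \<Longrightarrow> vadd Y u v \<in> points Y"
    and scale_closed: "u \<in> points Y \<Longrightarrow> vscale Y c u \<in> points Y"
    and add_assoc: "u \<in> points Y \<Longrightarrow> v \<in> points Y \<Longrightarrow> w \<in> points Y \<Longrightarrow>
          vadd Y (vadd Y u v) w = vadd Y u (vadd Y v w)"
    and add_commute: "u \<in> points Y \<Longrightarrow> v \<in> points Y \<Longrightarrow> vadd Y u v = vadd Y v u"
    and add_zero: "u \<in> points Y \<Longrightarrow> vadd Y u (vzero Y) = u"
    and add_inverse: "u \<in> points Y \<Longrightarrow> vadd Y u (vscale Y (-1) u) = vzero Y"
    and scale_add_right: "u \<in> points Y \<Longrightarrow> v \<in> points Y \<Longrightarrow>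
          vscale Y c (vadd Y u v) = vadd Y (vscale Y c u) (vscale Y c v)"
    and scale_add_left: "u \<in> points Y \<Longrightarrow>
          vscale Y (c + d) u = vadd Y (vscale Y c u) (vscale Y d u)"
    and scale_scale: "u \<in> points Y \<Longrightarrow> vscale Y c (vscale Y d u) = vscale Y (c * d) u"
    and scale_one: "u \<in> points Y \<Longrightarrow> vscale Y 1 u = u"
    and norm_eq_zero: "u \<in> points Y \<Longrightarrow> vnorm Y u = 0 \<longleftrightarrow> u = vzero Y"
    and norm_triangle: "u \<in> points Y \<Longrightarrow> v \<in> points Y \<Longrightarrow>
          vnorm Y (vadd Y u v) \<le> vnorm Y u + vnorm Y v"
    and norm_scale: "u \<in> points Y \<Longrightarrow> vnorm Y (vscale Y c u) = norm c * vnorm Y u"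
    and complete: "Metric_space.mcomplete (points Y) (\<lambda>u v. vnorm Y (vadd Y u (vscale Y (-1) v)))"

definition linear_map_on ::
    "'v set \<Rightarrow> ('k, 'v) nspace \<Rightarrow> ('k, 'w) nspace \<Rightarrow> ('v \<Rightarrow> 'w) \<Rightarrow> bool" where
  "linear_map_on E Y Z T \<longleftrightarrow>
     (\<forall>u\<in>E. T u \<in> points Z) \<and>
     (\<forall>u\<in>E. \<forall>v\<in>E. T (vadd Y u v) = vadd Z (T u) (T v)) \<and>
     (\<forall>c. \<forall>u\<in>E. T (vscale Y c u) = vscale Z c (T u))"

definition subspace_of :: "'v set \<Rightarrow> ('k, 'v) nspace \<Rightarrow> bool" where
  "subspace_of E Y \<longleftrightarrow> E \<subseteq> points Y \<and> vzero Y \<in> E \<and>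
     (\<forall>u\<in>E. \<forall>v\<in>E. vadd Y u v \<in> E) \<and> (\<forall>c. \<forall>u\<in>E. vscale Y c u \<in> E)"

definition finite_dimensional_subspace_of :: "'v set \<Rightarrow> ('k, 'v) nspace \<Rightarrow> bool" where
  "finite_dimensional_subspace_of E Y \<longleftrightarrow> subspace_of E Y \<and>
     (\<exists>B. finite B \<and> B \<subseteq> E \<and> (\<forall>F. subspace_of F Y \<and> B \<subseteq> F \<longrightarrow> E \<subseteq> F))"

section \<open>Reflexivity and superreflexivity\<close>

definition scalar_space :: "('k::real_or_complex, 'k) nspace" where
  "scalar_space = \<lparr>points = UNIV, vadd = (+), vzero = 0, vscale = (*), vnorm = norm\<rparr>"

text \<open>
  The value \<open>0\<close> off \<open>points Y\<close> makes a functional on \<open>Y\<close> the same thing as one HOL function.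
\<close>

definition dual :: "('k::real_or_complex, 'v) nspace \<Rightarrow> ('k, 'v \<Rightarrow> 'k) nspace" where
  "dual Y =
     \<lparr>points = {f. linear_map_on (points Y) Y scalar_space f \<and>
                   (\<exists>K. \<forall>u\<in>points Y. norm (f u) \<le> K * vnorm Y u) \<and>
                   (\<forall>u. u \<notin> points Y \<longrightarrow> f u = 0)},
      vadd = (\<lambda>f g u. f u + g u),
      vzero = (\<lambda>u. 0),
      vscale = (\<lambda>c f u. c * f u),
      vnorm = (\<lambda>f. SUP u\<in>{u \<in> points Y. vnorm Y u \<le> 1}. norm (f u))\<rparr>"

definition reflexive :: "('k::real_or_complex, 'v) nspace \<Rightarrow> bool" where
  "reflexive Y \<longleftrightarrow>
     (\<forall>\<Phi> \<in> points (dual (dual Y)). \<exists>u\<in>points Y. \<forall>f\<in>points (dual Y). \<Phi> f = f u)"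

definition finitely_representable ::
    "('k::real_or_complex, 'v) nspace \<Rightarrow> ('k, 'w) nspace \<Rightarrow> bool" where
  "finitely_representable Y X \<longleftrightarrow>
     (\<forall>E \<epsilon>. finite_dimensional_subspace_of E Y \<and> \<epsilon> > 0 \<longrightarrow>
        (\<exists>T. linear_map_on E Y X T \<and>
             (\<forall>u\<in>E. vnorm Y u \<le> vnorm X (T u) \<and> vnorm X (T u) \<le> (1 + \<epsilon>) * vnorm Y u)))"

text \<open>
  HOL cannot quantify over the types that carry the test spaces \<open>Y\<close>. Here \<open>Y\<close> ranges over all
  Banach spaces whose set of points lies in \<open>nat \<Rightarrow> 'k\<close>, a type with the cardinality of the
  continuum; up to isometry these include all separable Banach spaces. Nothing is lost: every
  non-reflexive Banach space has a separable closed non-reflexive subspace, and finite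
  representability passes to subspaces.
\<close>

definition superreflexive :: "('k::real_or_complex, 'v) nspace \<Rightarrow> bool" where
  "superreflexive X \<longleftrightarrow>
     (\<forall>Y :: ('k, nat \<Rightarrow> 'k) nspace.
        banach_space Y \<and> finitely_representable Y X \<longrightarrow> reflexive Y)"

section \<open>Bases and the thresholding greedy algorithm\<close>

text \<open>
  All sequences are indexed from \<open>0\<close>. The coordinate functionals \<open>x\<^sub>n\<^sup>*\<close>, called \<open>xs n\<close>, are
  an explicit argument; density of the span makes them unique.
\<close>

definition basis :: "('k::real_or_complex \<Rightarrow> 'a::banach \<Rightarrow> 'a) \<Rightarrow> (nat \<Rightarrow> 'a) \<Rightarrow> (nat \<Rightarrow> 'a \<Rightarrow> 'k) \<Rightarrow> bool"
  where
  "basis smul x xs \<longleftrightarrow>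
     closure (module.span smul (range x)) = UNIV \<and>
     (\<forall>n. xs n \<in> points (dual (space_of smul))) \<and>
     (\<forall>n k. xs n (x k) = (if n = k then 1 else 0)) \<and>
     (\<exists>c>0. \<forall>n. c \<le> norm (x n)) \<and>
     (\<exists>C. \<forall>n. norm (x n) \<le> C)"

definition greedy_set_of :: "(nat \<Rightarrow> 'k::real_normed_vector) \<Rightarrow> nat \<Rightarrow> nat set \<Rightarrow> bool" where
  "greedy_set_of a m A \<longleftrightarrow> finite A \<and> card A = m \<and>
     (\<forall>n\<in>A. \<forall>k. k \<notin> A \<longrightarrow> norm (a k) < norm (a n) \<or> (norm (a k) = norm (a n) \<and> n < k))"

definition greedy_set :: "(nat \<Rightarrow> 'k::real_normed_vector) \<Rightarrow> nat \<Rightarrow> nat set" where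
  "greedy_set a m = (THE A. greedy_set_of a m A)"

lemma greedy_set_of_unique:
  assumes "greedy_set_of a m A" "greedy_set_of a m B"
  shows "A = B"
proof (rule ccontr)
  assume "A \<noteq> B"
  have fin: "finite A" "finite B" and card: "card A = card B"
    using assms by (auto simp: greedy_set_of_def)
  have "\<not> A \<subseteq> B" "\<not> B \<subseteq> A"
    using card_subset_eq[of B A] card_subset_eq[of A B] fin card \<open>A \<noteq> B\<close> by auto
  then obtain n k where "n \<in> A" "n \<notin> B" "k \<in> B" "k \<notin> A"
    by blast
  then show False
    using assms unfolding greedy_set_of_def by (metis order_less_asym order_less_irrefl)
qed

lemma greedy_set_of_exists:
  fixes a :: "nat \<Rightarrow> 'k::real_normed_vector"
  assumes lim: "a \<longlonglongrightarrow> 0"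
  shows "\<exists>A. greedy_set_of a m A"
proof (induction m)
  case 0
  show ?case
    by (intro exI[of _ "{}"]) (simp add: greedy_set_of_def)
next
  case (Suc m)
  then obtain A where A: "greedy_set_of a m A"
    by blast
  then have "finite A"
    by (simp add: greedy_set_of_def)
  have "\<exists>n. n \<notin> A \<and> (\<forall>k. k \<notin> A \<longrightarrow> norm (a k) \<le> norm (a n))"
  proof (cases "\<exists>j. j \<notin> A \<and> a j \<noteq> 0")
    case True
    then obtain j where j: "j \<notin> A" "a j \<noteq> 0"
      by blast
    define S where "S = {k. k \<notin> A \<and> norm (a j) \<le> norm (a k)}"
    obtain N where "\<forall>k\<ge>N. norm (a k) < norm (a j)"
      using LIMSEQ_D[OF lim, of "norm (a j)"] j by auto
    then have "S \<subseteq> {..<N}"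
      by (auto simp: S_def) (meson linorder_not_le)
    then have "finite S"
      using finite_subset by blast
    moreover have "j \<in> S"
      using j by (simp add: S_def)
    ultimately have "Max ((\<lambda>k. norm (a k)) ` S) \<in> (\<lambda>k. norm (a k)) ` S"
      by (intro Max_in) auto
    then obtain n where n: "n \<in> S" "norm (a n) = Max ((\<lambda>k. norm (a k)) ` S)"
      by fastforce
    have "norm (a k) \<le> norm (a n)" if "k \<in> S" for k
      unfolding n(2) using that \<open>finite S\<close> by (intro Max_ge) auto
    then have *: "\<forall>k\<in>S. norm (a k) \<le> norm (a n)"
      by blast
    have "norm (a j) \<le> norm (a n)"
      using * \<open>j \<in> S\<close> by blast
    then have "norm (a k) \<le> norm (a n)" if "k \<notin> A" for k
      using that * \<open>norm (a j) \<le> norm (a n)\<close> by (cases "k \<in> S") (simp_all add: S_def)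
    then show ?thesis
      using n by (auto simp: S_def)
  next
    case False
    obtain n where "n \<notin> A"
      using ex_new_if_finite[OF infinite_UNIV_nat \<open>finite A\<close>] by blast
    with False show ?thesis
      by (intro exI[of _ n]) auto
  qed
  then obtain n where n: "n \<notin> A" "\<forall>k. k \<notin> A \<longrightarrow> norm (a k) \<le> norm (a n)"
    by blast
  define i where "i = (LEAST i. i \<notin> A \<and> norm (a i) = norm (a n))"
  have i: "i \<notin> A" "norm (a i) = norm (a n)"
    using LeastI[of "\<lambda>i. i \<notin> A \<and> norm (a i) = norm (a n)" n] n by (auto simp: i_def)
  have least: "i \<le> k" if "k \<notin> A" "norm (a k) = norm (a n)" for k
    using that by (auto simp: i_def intro: Least_le)
  have "norm (a k) < norm (a i) \<or> (norm (a k) = norm (a i) \<and> i < k)"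
    if "k \<notin> A" "k \<noteq> i" for k
    using that n(2) i(2) least[of k] by (cases "norm (a k) = norm (a n)") (auto simp: less_le)
  then have "greedy_set_of a (Suc m) (insert i A)"
    using A i(1) by (simp add: greedy_set_of_def)
  then show ?case
    by blast
qed

lemma greedy_set_of_greedy_set:
  assumes "a \<longlonglongrightarrow> 0"
  shows "greedy_set_of a m (greedy_set a m)"
  unfolding greedy_set_def
  by (rule theI') (use greedy_set_of_exists[OF assms] greedy_set_of_unique in blast)

definition greedy_sum ::
    "('k::real_or_complex \<Rightarrow> 'a::banach \<Rightarrow> 'a) \<Rightarrow> (nat \<Rightarrow> 'a) \<Rightarrow> (nat \<Rightarrow> 'a \<Rightarrow> 'k) \<Rightarrow> nat \<Rightarrow> 'a \<Rightarrow> 'a" where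
  "greedy_sum smul x xs m f = (\<Sum>n\<in>greedy_set (\<lambda>n. xs n f) m. smul (xs n f) (x n))"

definition quasi_greedy ::
    "('k::real_or_complex \<Rightarrow> 'a::banach \<Rightarrow> 'a) \<Rightarrow> (nat \<Rightarrow> 'a) \<Rightarrow> (nat \<Rightarrow> 'a \<Rightarrow> 'k) \<Rightarrow> bool" where
  "quasi_greedy smul x xs \<longleftrightarrow>
     (\<forall>f. (\<lambda>n. xs n f) \<longlonglongrightarrow> 0) \<and>
     (\<exists>C. \<forall>f m. max (norm (f - greedy_sum smul x xs m f)) (norm (greedy_sum smul x xs m f))
                  \<le> C * norm f)"

section \<open>Fundamental function, weights and Lorentz spaces\<close>

definition fundamental_function ::
    "('k::real_or_complex \<Rightarrow> 'a::banach \<Rightarrow> 'a) \<Rightarrow> (nat \<Rightarrow> 'a) \<Rightarrow> nat \<Rightarrow> real" where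
  "fundamental_function smul x m =
     Sup {norm (\<Sum>n\<in>A. smul (\<epsilon> n) (x n)) | A \<epsilon>.
            finite A \<and> card A \<le> m \<and> (\<forall>n\<in>A. norm (\<epsilon> n) = 1)}"

definition weight :: "(nat \<Rightarrow> real) \<Rightarrow> bool" where
  "weight w \<longleftrightarrow> (\<forall>n. 0 \<le> w n) \<and> 0 < w 0"

text \<open>In terms of the weight \<open>w\<^sub>1, w\<^sub>2, \<dots>\<close>, stored as \<open>w 0, w 1, \<dots>\<close>, this is \<open>s\<^sub>m\<close>.\<close>

definition primitive :: "(nat \<Rightarrow> real) \<Rightarrow> nat \<Rightarrow> real" where
  "primitive w m = (\<Sum>n<m. w n)"

definition upper_weight ::
    "('k::real_or_complex \<Rightarrow> 'a::banach \<Rightarrow> 'a) \<Rightarrow> (nat \<Rightarrow> 'a) \<Rightarrow> nat \<Rightarrow> real" where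
  "upper_weight smul x n = fundamental_function smul x (Suc n) - fundamental_function smul x n"

lemma primitive_upper_weight:
  "primitive (upper_weight smul x) m = fundamental_function smul x m"
proof -
  have "{norm (\<Sum>n\<in>A. smul (\<epsilon> n) (x n)) | A \<epsilon>.
            finite A \<and> card A \<le> 0 \<and> (\<forall>n\<in>A. norm (\<epsilon> n) = 1)} = {0}"
    by (auto intro!: exI[of _ "{}"])
  then have "fundamental_function smul x 0 = 0"
    by (simp only: fundamental_function_def cSup_singleton)
  then show ?thesis
    by (simp add: primitive_def upper_weight_def sum_lessThan_telescope)
qed

lemma weight_upper_weight:
  assumes "scalar_banach smul" "basis smul x xs"
  shows "weight (upper_weight smul x)"
proof -
  interpret scalar_banach smul by fact
  define S where "S m = {norm (\<Sum>n\<in>A. smul (\<epsilon> n) (x n)) | A \<epsilon>.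
      finite A \<and> card A \<le> m \<and> (\<forall>n\<in>A. norm (\<epsilon> n) = 1)}" for m
  obtain c where c: "c > 0" "\<And>n. c \<le> norm (x n)"
    using assms(2) by (auto simp: basis_def)
  obtain C where C: "\<And>n. norm (x n) \<le> C"
    using assms(2) by (auto simp: basis_def)
  have "0 \<le> C"
    using C[of 0] norm_ge_zero[of "x 0"] by linarith
  have "bdd_above (S m)" for m
  proof (rule bdd_aboveI)
    fix y assume "y \<in> S m"
    then obtain A \<epsilon> where A: "finite A" "card A \<le> m" "\<forall>n\<in>A. norm (\<epsilon> n) = 1"
      and y: "y = norm (\<Sum>n\<in>A. smul (\<epsilon> n) (x n))"
      by (auto simp: S_def)
    have "y \<le> (\<Sum>n\<in>A. norm (smul (\<epsilon> n) (x n)))"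
      unfolding y by (rule norm_sum)
    also have "\<dots> \<le> (\<Sum>n\<in>A. C)"
      using A C by (intro sum_mono) (simp add: norm_scale)
    also have "\<dots> \<le> real m * C"
      using A \<open>0 \<le> C\<close> by (simp add: mult_right_mono)
    finally show "y \<le> real m * C" .
  qed
  moreover have "S m \<noteq> {}" for m
    unfolding S_def by (rule ex_in_conv[THEN iffD1], intro exI CollectI exI[of _ "{}"]) auto
  moreover have "S m \<subseteq> S (Suc m)" for m
  proof
    fix y assume "y \<in> S m"
    then obtain A \<epsilon> where "finite A" "card A \<le> m" "\<forall>n\<in>A. norm (\<epsilon> n) = 1"
      and "y = norm (\<Sum>n\<in>A. smul (\<epsilon> n) (x n))"
      unfolding S_def by blast
    then show "y \<in> S (Suc m)"
      unfolding S_def by (intro CollectI exI[of _ A] exI[of _ \<epsilon>]) simp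
  qed
  ultimately have mono: "Sup (S m) \<le> Sup (S (Suc m))" for m
    by (intro cSup_subset_mono) auto
  have "norm (x 0) \<in> S 1"
    unfolding S_def by (intro CollectI exI[of _ "{0}"] exI[of _ "\<lambda>_. 1"]) simp
  then have "norm (x 0) \<le> Sup (S 1)"
    using \<open>bdd_above (S 1)\<close> by (rule cSup_upper)
  then have "0 < Sup (S 1)"
    using c(1) c(2)[of 0] by linarith
  moreover have "fundamental_function smul x m = Sup (S m)" for m
    by (simp add: fundamental_function_def S_def)
  moreover have "fundamental_function smul x 0 = 0"
    using primitive_upper_weight[of smul x 0] by (simp add: primitive_def)
  ultimately show ?thesis
    using mono by (simp add: weight_def upper_weight_def)
qed

text \<open>\<open>rearrangement f n\<close> is the \<open>(n + 1)\<close>-st largest of the values \<open>norm (f k)\<close>.\<close>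

definition rearrangement :: "(nat \<Rightarrow> 'k::real_normed_vector) \<Rightarrow> nat \<Rightarrow> real" where
  "rearrangement f n = Inf {t. 0 \<le> t \<and> finite {k. t < norm (f k)} \<and> card {k. t < norm (f k)} \<le> n}"

text \<open>
  The terms below are non-negative when \<open>w\<close> is a weight, so that summability says that the
  Lorentz quasi-norm of \<open>f\<close> is finite.
\<close>

definition lorentz :: "real \<Rightarrow> (nat \<Rightarrow> real) \<Rightarrow> (nat \<Rightarrow> 'k::real_normed_vector) set" where
  "lorentz q w = {f. f \<longlonglongrightarrow> 0 \<and>
     summable (\<lambda>n. (rearrangement f n * primitive w (Suc n)) powr q *
                   (w n / primitive w (Suc n)))}"

definition embeds_via ::
    "(nat \<Rightarrow> 'k) set \<Rightarrow> ('k::real_or_complex \<Rightarrow> 'a::banach \<Rightarrow> 'a) \<Rightarrow> (nat \<Rightarrow> 'a) \<Rightarrow> bool" where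
  "embeds_via D smul x \<longleftrightarrow> (\<forall>a\<in>D. summable (\<lambda>n. smul (a n) (x n)))"

end

theory Submission
  imports Defs
begin

text \<open>
  Quasi-greediness controls sums of blocks whose coefficients decrease in modulus from one block
  to the next: an initial part of such a sum is bounded by a multiple of the whole. Suppose that
  for every \<open>N\<close> there were \<open>N\<close> such blocks of norm at most 1 whose sum has norm almost \<open>N\<close>.
  Averages of these blocks over consecutive groups of rapidly increasing size have uniformly
  bounded partial sum projections, because in any linear combination of them the coefficients
  of the blocks can be made to decrease at a small cost; moreover the sum of the coefficients is
  bounded by the norm. In the limit along an ultrafilter one obtains a Banach space, finitely
  representable in the given one, spanned by a basic sequence with a bounded sum functional. The
  limit of the evaluations at the vectors of this sequence vanishes at all coordinate functionals
  but not at the sum functional, so the space is not reflexive.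

  Hence, in a superreflexive space, there are \<open>N\<close> and \<open>\<rho> < 1\<close> such that the sum of \<open>N\<close>
  decreasing blocks of norm at most \<open>t\<close> has norm at most \<open>\<rho> N t\<close>. Cutting a longer sum into \<open>N\<close>
  pieces repeatedly, one obtains an upper \<open>q\<close>-estimate with \<open>q > 1\<close> for decreasing blocks.
  It is applied to the blocks of the decreasing rearrangement on which the fundamental function
  stays between consecutive powers of 4.
\<close>

text \<open>Without unconditionality, only coefficients that decrease in modulus are under control,
  while a basic sequence must admit arbitrary ones. In an average of M_i blocks the scalar a_i acts
  on each block as a_i / M_i. If M_j is at least R M_i for all j > i, raising |a_i| / M_i to the
  maximum of the later quotients changes the sum by at most max |a| / R for each i. With R of order
  C m the total error over m averages is absorbed, at the price of needing about R^m blocks.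
  Directions of the scalars do no harm: a sum of N blocks that is within 1/(2N) of the extreme
  length N is almost additive on every subfamily. A gain at one fixed N suffices for an exponent
  above 1, because \<rho> N^(1 - 1/q) stays below 1 for q close to 1. The ratio 4 of the levels
  reflects that the fundamental function grows by at most its value at 1 in each step: between two
  levels its increments add up to at least the lower threshold, so the Lorentz terms of one level
  pay for the next one.\<close>

lemma real_or_complex_embedding:
  obtains \<phi> :: "'k::real_or_complex \<Rightarrow> complex"
  where "\<And>a b. \<phi> (a + b) = \<phi> a + \<phi> b" "\<And>a b. \<phi> (a * b) = \<phi> a * \<phi> b" "\<And>a. norm (\<phi> a) = norm a"
    "\<And>r. \<phi> (of_real r) = of_real r" "closed (range \<phi>)"
proof -
  obtain \<phi> :: "'k \<Rightarrow> complex"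
    where add: "\<And>a b. \<phi> (a + b) = \<phi> a + \<phi> b" and mult: "\<And>a b. \<phi> (a * b) = \<phi> a * \<phi> b"
      and norm: "\<And>a. norm (\<phi> a) = norm a" and range: "range \<phi> = \<real> \<or> range \<phi> = UNIV"
    using real_or_complex by metis
  have "\<phi> 1 * \<phi> 1 = \<phi> 1" "\<phi> 1 \<noteq> 0"
    using mult[of 1 1] norm[of 1] by auto
  then have one: "\<phi> 1 = 1"
    by simp
  have diff: "\<phi> (a - b) = \<phi> a - \<phi> b" for a b
    using add[of "a - b" b] by simp
  \<comment> \<open>A complex number is real once its distances to 0 and to 1 are those of a real number.\<close>
  have "\<phi> (of_real r) = of_real r" for r
  proof -
    define w where "w = \<phi> (of_real r)"
    have "norm w = \<bar>r\<bar>" "norm (w - 1) = \<bar>r - 1\<bar>"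
      using norm[of "of_real r"] norm[of "of_real r - 1"] one norm_of_real[of "r - 1", where 'a = 'k]
      by (simp_all add: w_def diff)
    then have "(Re w)\<^sup>2 + (Im w)\<^sup>2 = r\<^sup>2" "(Re w - 1)\<^sup>2 + (Im w)\<^sup>2 = (r - 1)\<^sup>2"
      using cmod_power2[of w] cmod_power2[of "w - 1"] by simp_all
    then have "Re w = r" "Im w = 0"
      by (simp_all add: power2_eq_square algebra_simps)
    then show ?thesis
      by (simp add: w_def complex_eq_iff)
  qed
  \<comment> \<open>Closedness lets limits of bounded scalars be found by compactness among the
    complex numbers and then pulled back to \<open>'k\<close>.\<close>
  moreover have "closed (range \<phi>)"
    using range closed_complex_Reals by auto
  ultimately show ?thesis
    using that add mult norm by blast
qed

section \<open>Limits along an ultrafilter\<close>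

text \<open>Zorn's lemma is applied to proper filters written as families of sets, where the union
  of a chain is again a filter. A larger family is a smaller element in the order of the type
  \<open>filter\<close>, so a maximal family gives an ultrafilter below \<open>F\<close>.\<close>

lemma ultrafilter_exists:
  assumes "F \<noteq> bot"
  shows "\<exists>U. U \<le> F \<and> U \<noteq> bot \<and> (\<forall>P. eventually P U \<or> eventually (\<lambda>x. \<not> P x) U)"
proof -
  define \<A> where "\<A> = {S. {A. eventually (\<lambda>x. x \<in> A) F} \<subseteq> S \<and> {} \<notin> S \<and>
    (\<forall>A\<in>S. \<forall>B\<in>S. A \<inter> B \<in> S) \<and> (\<forall>A\<in>S. \<forall>B. A \<subseteq> B \<longrightarrow> B \<in> S)}"
  have "\<exists>M\<in>\<A>. \<forall>S\<in>\<A>. M \<subseteq> S \<longrightarrow> S = M"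
  proof (rule subset_Zorn_nonempty)
    define T where "T = {A. eventually (\<lambda>x. x \<in> A) F}"
    have "{} \<notin> T"
      using assms by (simp add: T_def trivial_limit_def)
    moreover have "A \<inter> B \<in> T" if "A \<in> T" "B \<in> T" for A B
      using that by (simp add: T_def eventually_conj)
    moreover have "B \<in> T" if "A \<in> T" "A \<subseteq> B" for A B
      using that by (auto simp: T_def elim: eventually_mono)
    ultimately have "T \<in> \<A>"
      unfolding \<A>_def T_def[symmetric] by blast
    then show "\<A> \<noteq> {}"
      by blast
    fix \<C> assume "\<C> \<noteq> {}" and chain: "subset.chain \<A> \<C>"
    have sub: "S \<in> \<A>" if "S \<in> \<C>" for S
      using chain that by (auto simp: subset.chain_def)
    have "A \<inter> B \<in> \<Union>\<C>" if AB: "A \<in> \<Union>\<C>" "B \<in> \<Union>\<C>" for A B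
    proof -
      obtain S T where ST: "S \<in> \<C>" "T \<in> \<C>" "A \<in> S" "B \<in> T"
        using AB by blast
      then have "S \<subseteq> T \<or> T \<subseteq> S"
        using chain by (auto simp: subset.chain_def)
      then obtain R where R: "R \<in> \<C>" "A \<in> R" "B \<in> R"
        using ST by blast
      then have "A \<inter> B \<in> R"
        using sub[of R] by (simp add: \<A>_def)
      then show ?thesis
        using R by blast
    qed
    moreover have "{A. eventually (\<lambda>x. x \<in> A) F} \<subseteq> \<Union>\<C>"
    proof -
      obtain S where "S \<in> \<C>"
        using \<open>\<C> \<noteq> {}\<close> by blast
      then show ?thesis
        using sub[of S] by (auto simp: \<A>_def)
    qed
    moreover have "{} \<notin> \<Union>\<C>"
      using sub unfolding \<A>_def by blast
    moreover have "\<forall>A\<in>\<Union>\<C>. \<forall>B. A \<subseteq> B \<longrightarrow> B \<in> \<Union>\<C>"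
      using sub unfolding \<A>_def by blast
    ultimately show "\<Union>\<C> \<in> \<A>"
      unfolding \<A>_def by blast
  qed
  then obtain M where M: "M \<in> \<A>" and max: "\<And>S. S \<in> \<A> \<Longrightarrow> M \<subseteq> S \<Longrightarrow> S = M"
    by blast
  have inter: "A \<inter> B \<in> M" if "A \<in> M" "B \<in> M" for A B
    using M that by (simp add: \<A>_def)
  have up: "B \<in> M" if "A \<in> M" "A \<subseteq> B" for A B
    using M that unfolding \<A>_def by blast
  have F: "A \<in> M" if "eventually (\<lambda>x. x \<in> A) F" for A
    using M that by (auto simp: \<A>_def)
  have ne: "{} \<notin> M"
    using M by (simp add: \<A>_def)
  have dich: "A \<in> M \<or> - A \<in> M" for A
  proof (rule disjCI)
    assume nA: "- A \<notin> M"
    \<comment> \<open>The filter generated by \<open>M\<close> and \<open>A\<close>. It is proper,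
      because \<open>C \<inter> A = {}\<close> with \<open>C \<in> M\<close> would put
      \<open>- A\<close> into \<open>M\<close>; maximality then forces
      \<open>A \<in> M\<close>.\<close>
    define S where "S = {B. \<exists>C\<in>M. C \<inter> A \<subseteq> B}"
    have "M \<subseteq> S"
      by (auto simp: S_def)
    moreover have "A \<in> S"
      using F[of UNIV] by (auto simp: S_def)
    moreover have "S \<in> \<A>"
    proof -
      have "{A. eventually (\<lambda>x. x \<in> A) F} \<subseteq> S"
        using F \<open>M \<subseteq> S\<close> by blast
      moreover have "{} \<notin> S"
        using nA up[of _ "- A"] by (auto simp: S_def)
      moreover have "B \<inter> C \<in> S" if BC: "B \<in> S" "C \<in> S" for B C
      proof -
        obtain B' C' where "B' \<in> M" "B' \<inter> A \<subseteq> B" "C' \<in> M" "C' \<inter> A \<subseteq> C"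
          using BC by (auto simp: S_def)
        then show ?thesis
          unfolding S_def using inter[of B' C'] by blast
      qed
      moreover have "\<forall>B\<in>S. \<forall>C. B \<subseteq> C \<longrightarrow> C \<in> S"
        unfolding S_def by blast
      ultimately show ?thesis
        unfolding \<A>_def by blast
    qed
    ultimately show "A \<in> M"
      using max by blast
  qed
  define U where "U = Abs_filter (\<lambda>P. Collect P \<in> M)"
  have U: "eventually P U \<longleftrightarrow> Collect P \<in> M" for P
    unfolding U_def
  proof (rule eventually_Abs_filter, rule is_filter.intro)
    show "Collect (\<lambda>x. True) \<in> M"
      using F[of UNIV] by simp
    show "Collect (\<lambda>x. P x \<and> Q x) \<in> M" if "Collect P \<in> M" "Collect Q \<in> M" for P Q
      using inter[OF that] by (simp add: Collect_conj_eq)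
    show "Collect Q \<in> M" if "\<forall>x. P x \<longrightarrow> Q x" "Collect P \<in> M" for P Q
      using up[OF that(2)] that(1) by blast
  qed
  have "U \<le> F"
    by (rule filter_leI) (simp add: U F)
  moreover have "U \<noteq> bot"
    using ne by (simp add: trivial_limit_def U)
  moreover have "eventually P U \<or> eventually (\<lambda>x. \<not> P x) U" for P
    using dich[of "Collect P"] by (simp add: U Collect_neg_eq)
  ultimately show ?thesis
    by blast
qed

text \<open>Being below \<open>sequentially\<close> makes every tail of the natural numbers large,
  so finitely many indices never affect a limit along \<open>U\<close>.\<close>

locale free_ultrafilter =
  fixes U :: "nat filter"
  assumes le_sequentially: "U \<le> sequentially"
    and nontrivial: "U \<noteq> bot"
    and ultra: "eventually P U \<or> eventually (\<lambda>n. \<not> P n) U"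
begin

text \<open>Compactness supplies a cluster point of the image filter, and an ultrafilter converges
  to each of its cluster points: a neighbourhood that is not eventually entered is eventually
  avoided.\<close>

lemma compact_imp_tendsto:
  assumes "compact K" "\<And>n. f n \<in> K"
  shows "\<exists>l\<in>K. (f \<longlongrightarrow> l) U"
proof -
  have "filtermap f U \<noteq> bot"
    using nontrivial by (simp add: filtermap_bot_iff)
  then obtain l where l: "l \<in> K" "inf (nhds l) (filtermap f U) \<noteq> bot"
    using assms unfolding compact_filter by (force simp: eventually_filtermap)
  have "eventually (\<lambda>n. f n \<in> S) U" if "open S" "l \<in> S" for S
  proof (rule ccontr)
    assume "\<not> ?thesis"
    then have "eventually (\<lambda>n. f n \<notin> S) U"
      using ultra by blast
    moreover have "eventually (\<lambda>y. y \<in> S) (nhds l)"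
      using that by (rule eventually_nhds_in_open)
    ultimately have "eventually (\<lambda>y. False) (inf (nhds l) (filtermap f U))"
      unfolding eventually_inf eventually_filtermap
      by (intro exI[of _ "\<lambda>y. y \<in> S"] exI[of _ "\<lambda>y. y \<notin> S"]) simp
    with l(2) show False
      by (simp add: trivial_limit_def)
  qed
  then show ?thesis
    using l(1) by (auto simp: tendsto_def)
qed

lemma bounded_imp_tendsto:
  fixes f :: "nat \<Rightarrow> 'k::real_or_complex"
  assumes "\<And>n. norm (f n) \<le> c"
  shows "\<exists>l. (f \<longlongrightarrow> l) U"
proof -
  obtain \<phi> :: "'k \<Rightarrow> complex"
    where \<phi>: "\<And>a b. \<phi> (a + b) = \<phi> a + \<phi> b" "\<And>a. norm (\<phi> a) = norm a" "closed (range \<phi>)"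
    using real_or_complex_embedding by metis
  have "compact (cball 0 c \<inter> range \<phi>)"
    using \<phi>(3) by (intro compact_Int_closed) auto
  then obtain l where l: "((\<lambda>n. \<phi> (f n)) \<longlongrightarrow> \<phi> l) U"
    using compact_imp_tendsto[of "cball 0 c \<inter> range \<phi>" "\<lambda>n. \<phi> (f n)"] assms \<phi>(2) by auto
  have "dist (\<phi> a) (\<phi> b) = dist a b" for a b
    using \<phi>(1)[of "a - b" b] \<phi>(2)[of "a - b"] by (simp add: dist_norm)
  then show ?thesis
    using l by (auto simp: tendsto_iff)
qed

lemma tendsto_ulim:
  fixes f :: "nat \<Rightarrow> 'k::real_or_complex"
  assumes "\<And>n. norm (f n) \<le> c"
  shows "(f \<longlongrightarrow> Lim U f) U"
proof -
  obtain l where "(f \<longlongrightarrow> l) U"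
    using bounded_imp_tendsto assms by blast
  then show ?thesis
    using nontrivial tendsto_Lim by blast
qed

end

section \<open>A space spanned by limits of long finite sequences\<close>

locale limit_space = free_ultrafilter U + scalar_banach smul
  for U :: "nat filter" and smul :: "'k::real_or_complex \<Rightarrow> 'a::banach \<Rightarrow> 'a" +
  fixes z :: "nat \<Rightarrow> nat \<Rightarrow> 'a" and B :: real
  assumes B_ge_1: "1 \<le> B"
    and norm_z: "norm (z m i) \<le> 1"
    and partial_sum_bound: "k \<le> l \<Longrightarrow> l \<le> m \<Longrightarrow>
      norm (\<Sum>i<k. smul (a i) (z m i)) \<le> B * norm (\<Sum>i<l. smul (a i) (z m i))"
    and coefficient_sum_bound: "l \<le> m \<Longrightarrow>
      norm (\<Sum>i<l. a i) \<le> B * norm (\<Sum>i<l. smul (a i) (z m i))"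
begin

definition comb :: "nat \<Rightarrow> nat set \<Rightarrow> (nat \<Rightarrow> 'k) \<Rightarrow> 'a" where
  "comb m F a = (\<Sum>i\<in>F. smul (a i) (z m i))"

definition pnorm :: "nat set \<Rightarrow> (nat \<Rightarrow> 'k) \<Rightarrow> real" where
  "pnorm F a = Lim U (\<lambda>m. norm (comb m F a))"

text \<open>The completion of the finitely supported sequences under the limit norm, realized by
  coefficient sequences whose formal series is Cauchy. Such a concrete model is needed because the
  test spaces of \<open>superreflexive\<close> have their points in
  \<open>nat \<Rightarrow> 'k\<close>.\<close>

definition pts :: "(nat \<Rightarrow> 'k) set" where
  "pts = {a. \<forall>\<epsilon>>0. \<exists>K. \<forall>j k. K \<le> j \<longrightarrow> j \<le> k \<longrightarrow> pnorm {j..<k} a < \<epsilon>}"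

text \<open>The value 0 off \<open>pts\<close> makes nonnegativity and symmetry of the distance hold
  for all sequences, as \<open>Metric_space\<close> demands. The limit along \<open>U\<close> exists
  by mere boundedness of the partial norms.\<close>

definition lnorm :: "(nat \<Rightarrow> 'k) \<Rightarrow> real" where
  "lnorm a = (if a \<in> pts then Lim U (\<lambda>k. pnorm {..<k} a) else 0)"

definition Y :: "('k, nat \<Rightarrow> 'k) nspace" where
  "Y = \<lparr>points = pts, vadd = (\<lambda>u v i. u i + v i), vzero = (\<lambda>i. 0),
        vscale = (\<lambda>c u i. c * u i), vnorm = lnorm\<rparr>"

definition unit_seq :: "nat \<Rightarrow> nat \<Rightarrow> 'k" where
  "unit_seq i j = (if j = i then 1 else 0)"

lemma eventually_ge: "eventually (\<lambda>m. l \<le> m) U"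
  using le_sequentially eventually_ge_at_top filter_leD by blast

lemma B_pos: "0 < B" "0 \<le> B"
  using B_ge_1 by simp_all

section \<open>Limit norms of finite combinations\<close>

lemma comb_add: "comb m F (\<lambda>i. a i + b i) = comb m F a + comb m F b"
  by (simp add: comb_def scale_left_distrib sum.distrib)

lemma comb_diff: "comb m F (\<lambda>i. a i - b i) = comb m F a - comb m F b"
  by (simp add: comb_def scale_left_diff_distrib sum_subtractf)

lemma comb_scale: "comb m F (\<lambda>i. c * a i) = smul c (comb m F a)"
  by (simp add: comb_def scale_sum_right)

lemma norm_comb_le: "norm (comb m F a) \<le> (\<Sum>i\<in>F. norm (a i))"
  unfolding comb_def
  by (rule order_trans[OF norm_sum]) (intro sum_mono, simp add: norm_scale mult_left_le norm_z)

lemma pnorm_tendsto: "((\<lambda>m. norm (comb m F a)) \<longlongrightarrow> pnorm F a) U"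
  unfolding pnorm_def by (rule tendsto_ulim[of _ "\<Sum>i\<in>F. norm (a i)"]) (simp add: norm_comb_le)

lemma pnorm_nonneg: "0 \<le> pnorm F a"
  using pnorm_tendsto by (rule tendsto_lowerbound) (simp_all add: nontrivial)

lemma pnorm_le_sum: "pnorm F a \<le> (\<Sum>i\<in>F. norm (a i))"
  using pnorm_tendsto by (rule tendsto_upperbound) (simp_all add: nontrivial norm_comb_le)

lemma pnorm_add: "pnorm F (\<lambda>i. a i + b i) \<le> pnorm F a + pnorm F b"
  by (rule tendsto_le[OF nontrivial tendsto_add[OF pnorm_tendsto pnorm_tendsto] pnorm_tendsto])
    (simp add: comb_add norm_triangle_ineq)

lemma pnorm_scale: "pnorm F (\<lambda>i. c * a i) = norm c * pnorm F a"
  by (rule tendsto_unique[OF nontrivial pnorm_tendsto])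
    (simp add: comb_scale norm_scale tendsto_mult_left pnorm_tendsto)

lemma pnorm_diff_commute: "pnorm F (\<lambda>i. a i - b i) = pnorm F (\<lambda>i. b i - a i)"
  using pnorm_scale[of F "-1" "\<lambda>i. a i - b i"] by simp

lemma pnorm_diff: "\<bar>pnorm F a - pnorm F b\<bar> \<le> pnorm F (\<lambda>i. a i - b i)"
  using pnorm_add[of F "\<lambda>i. a i - b i" b] pnorm_add[of F "\<lambda>i. b i - a i" a]
    pnorm_diff_commute[of F a b] by simp

lemma pnorm_union:
  assumes "finite F" "finite G" "F \<inter> G = {}"
  shows "pnorm (F \<union> G) a \<le> pnorm F a + pnorm G a"
  by (rule tendsto_le[OF nontrivial tendsto_add[OF pnorm_tendsto pnorm_tendsto] pnorm_tendsto])
    (simp add: comb_def sum.union_disjoint[OF assms] norm_triangle_ineq)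

lemma pnorm_lessThan:
  assumes "j \<le> k"
  shows "pnorm {..<k} a \<le> pnorm {..<j} a + pnorm {j..<k} a"
  using pnorm_union[of "{..<j}" "{j..<k}" a] assms by (simp add: ivl_disj_un ivl_disj_int)

lemma pnorm_initial:
  assumes "k \<le> l"
  shows "pnorm {..<k} a \<le> B * pnorm {..<l} a"
proof (rule tendsto_le[OF nontrivial tendsto_mult_left[OF pnorm_tendsto] pnorm_tendsto])
  show "eventually (\<lambda>m. norm (comb m {..<k} a) \<le> B * norm (comb m {..<l} a)) U"
    using eventually_ge[of l]
    by eventually_elim (use partial_sum_bound[OF assms] in \<open>simp add: comb_def\<close>)
qed

lemma sum_le_pnorm: "norm (\<Sum>i<l. a i) \<le> B * pnorm {..<l} a"
proof (rule tendsto_lowerbound[OF tendsto_mult_left[OF pnorm_tendsto] _ nontrivial])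
  show "eventually (\<lambda>m. norm (\<Sum>i<l. a i) \<le> B * norm (comb m {..<l} a)) U"
    using eventually_ge[of l]
    by eventually_elim (use coefficient_sum_bound in \<open>simp add: comb_def\<close>)
qed

section \<open>The sequence space, its norm and its completeness\<close>

lemma ptsD:
  assumes "a \<in> pts" "0 < \<epsilon>"
  obtains K where "\<And>j k. K \<le> j \<Longrightarrow> j \<le> k \<Longrightarrow> pnorm {j..<k} a < \<epsilon>"
  using assms unfolding pts_def by blast

lemma finite_support_pts:
  assumes "\<And>i. K \<le> i \<Longrightarrow> a i = 0"
  shows "a \<in> pts"
  unfolding pts_def
proof (intro CollectI allI impI exI[of _ K])
  fix \<epsilon> :: real and j k assume "0 < \<epsilon>" "K \<le> j"
  then show "pnorm {j..<k} a < \<epsilon>"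
    using pnorm_le_sum[of "{j..<k}" a] assms by simp
qed

lemma pts_add:
  assumes "a \<in> pts" "b \<in> pts"
  shows "(\<lambda>i. a i + b i) \<in> pts"
  unfolding pts_def
proof (intro CollectI allI impI)
  fix \<epsilon> :: real assume "0 < \<epsilon>"
  then have e: "0 < \<epsilon> / 2" by simp
  obtain K where K: "\<And>j k. K \<le> j \<Longrightarrow> j \<le> k \<Longrightarrow> pnorm {j..<k} a < \<epsilon> / 2"
    using ptsD[OF assms(1) e] by blast
  obtain L where L: "\<And>j k. L \<le> j \<Longrightarrow> j \<le> k \<Longrightarrow> pnorm {j..<k} b < \<epsilon> / 2"
    using ptsD[OF assms(2) e] by blast
  have "pnorm {j..<k} (\<lambda>i. a i + b i) < \<epsilon>" if "max K L \<le> j" "j \<le> k" for j k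
    using K[of j k] L[of j k] that pnorm_add[of "{j..<k}" a b] by simp
  then show "\<exists>K. \<forall>j k. K \<le> j \<longrightarrow> j \<le> k \<longrightarrow> pnorm {j..<k} (\<lambda>i. a i + b i) < \<epsilon>"
    by blast
qed

lemma pts_scale:
  assumes "a \<in> pts"
  shows "(\<lambda>i. c * a i) \<in> pts"
  unfolding pts_def
proof (intro CollectI allI impI)
  fix \<epsilon> :: real assume "0 < \<epsilon>"
  then have e: "0 < \<epsilon> / (norm c + 1)"
    by (simp add: add_nonneg_pos)
  obtain K where K: "\<And>j k. K \<le> j \<Longrightarrow> j \<le> k \<Longrightarrow> pnorm {j..<k} a < \<epsilon> / (norm c + 1)"
    using ptsD[OF assms e] by blast
  have "pnorm {j..<k} (\<lambda>i. c * a i) < \<epsilon>" if "K \<le> j" "j \<le> k" for j k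
  proof -
    have "norm c * pnorm {j..<k} a \<le> norm c * (\<epsilon> / (norm c + 1))"
      using K[OF that] by (intro mult_left_mono) auto
    also have "\<dots> < \<epsilon>"
    proof -
      have "norm c / (norm c + 1) < 1"
        by (simp add: divide_less_eq_1 add_nonneg_pos)
      then show ?thesis
        using mult_strict_left_mono[OF _ \<open>0 < \<epsilon>\<close>, of "norm c / (norm c + 1)" 1]
        by (simp add: mult.commute)
    qed
    finally show ?thesis
      by (simp add: pnorm_scale)
  qed
  then show "\<exists>K. \<forall>j k. K \<le> j \<longrightarrow> j \<le> k \<longrightarrow> pnorm {j..<k} (\<lambda>i. c * a i) < \<epsilon>"
    by blast
qed

lemma pts_diff:
  assumes "a \<in> pts" "b \<in> pts"
  shows "(\<lambda>i. a i - b i) \<in> pts"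
  using pts_add[OF assms(1) pts_scale[OF assms(2), of "-1"]] by simp

lemma pnorm_bounded:
  assumes "a \<in> pts"
  shows "\<exists>c. \<forall>k. pnorm {..<k} a \<le> c"
proof -
  obtain K where K: "\<And>j k. K \<le> j \<Longrightarrow> j \<le> k \<Longrightarrow> pnorm {j..<k} a < 1"
    using ptsD[OF assms, of 1] by auto
  have "pnorm {..<k} a \<le> B * pnorm {..<K} a + 1" for k
  proof (cases "k \<le> K")
    case True
    then show ?thesis
      using pnorm_initial[of k K a] by simp
  next
    case False
    have "1 * pnorm {..<K} a \<le> B * pnorm {..<K} a"
      using B_ge_1 pnorm_nonneg by (intro mult_right_mono)
    then show ?thesis
      using False K[of K k] pnorm_lessThan[of K k a] by simp
  qed
  then show ?thesis
    by blast
qed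

lemma lnorm_tendsto:
  assumes "a \<in> pts"
  shows "((\<lambda>k. pnorm {..<k} a) \<longlongrightarrow> lnorm a) U"
proof -
  obtain c where "\<And>k. pnorm {..<k} a \<le> c"
    using pnorm_bounded[OF assms] by blast
  then show ?thesis
    using tendsto_ulim[of "\<lambda>k. pnorm {..<k} a" c] by (simp add: lnorm_def assms pnorm_nonneg)
qed

lemma lnorm_nonneg: "0 \<le> lnorm a"
proof (cases "a \<in> pts")
  case True
  show ?thesis
    by (rule tendsto_lowerbound[OF lnorm_tendsto[OF True]]) (simp_all add: nontrivial pnorm_nonneg)
qed (simp add: lnorm_def)

lemma lnorm_add:
  assumes "a \<in> pts" "b \<in> pts"
  shows "lnorm (\<lambda>i. a i + b i) \<le> lnorm a + lnorm b"
  by (rule tendsto_le[OF nontrivial tendsto_add[OF lnorm_tendsto lnorm_tendsto] lnorm_tendsto])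
    (simp_all add: assms pts_add pnorm_add)

lemma lnorm_scale:
  assumes "a \<in> pts"
  shows "lnorm (\<lambda>i. c * a i) = norm c * lnorm a"
  by (rule tendsto_unique[OF nontrivial lnorm_tendsto])
    (simp_all add: assms pts_scale pnorm_scale tendsto_mult_left lnorm_tendsto)

lemma lnorm_diff_commute: "lnorm (\<lambda>i. a i - b i) = lnorm (\<lambda>i. b i - a i)"
proof (cases "(\<lambda>i. a i - b i) \<in> pts")
  case True
  then show ?thesis
    using lnorm_scale[OF True, of "-1"] by simp
next
  case False
  then have "(\<lambda>i. b i - a i) \<notin> pts"
    using pts_scale[of "\<lambda>i. b i - a i" "-1"] by auto
  with False show ?thesis
    by (simp add: lnorm_def)
qed

lemma pnorm_le_lnorm:
  assumes "a \<in> pts"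
  shows "pnorm {..<k} a \<le> B * lnorm a"
proof (rule tendsto_lowerbound[OF tendsto_mult_left[OF lnorm_tendsto[OF assms]] _ nontrivial])
  show "eventually (\<lambda>l. pnorm {..<k} a \<le> B * pnorm {..<l} a) U"
    using eventually_ge[of k] by eventually_elim (rule pnorm_initial)
qed

lemma sum_le_lnorm:
  assumes "a \<in> pts"
  shows "norm (\<Sum>i<k. a i) \<le> B * B * lnorm a"
proof -
  have "norm (\<Sum>i<k. a i) \<le> B * pnorm {..<k} a"
    by (rule sum_le_pnorm)
  also have "\<dots> \<le> B * (B * lnorm a)"
    using pnorm_le_lnorm[OF assms] B_pos by (intro mult_left_mono)
  finally show ?thesis
    by (simp add: mult_ac)
qed

text \<open>A coordinate is the difference of two consecutive coefficient sums, so the bounded sum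
  functional controls it. This makes \<open>lnorm\<close> definite and provides coordinatewise
  limits of bounded sequences.\<close>

lemma coordinate_le_lnorm:
  assumes "a \<in> pts"
  shows "norm (a i) \<le> 2 * B * B * lnorm a"
proof -
  have "a i = (\<Sum>i<Suc i. a i) - (\<Sum>i<i. a i)"
    by simp
  then have "norm (a i) \<le> norm (\<Sum>i<Suc i. a i) + norm (\<Sum>i<i. a i)"
    by (metis norm_triangle_ineq4)
  then show ?thesis
    using sum_le_lnorm[OF assms, of i] sum_le_lnorm[OF assms, of "Suc i"] by linarith
qed

lemma lnorm_eq_0_iff:
  assumes "a \<in> pts"
  shows "lnorm a = 0 \<longleftrightarrow> a = (\<lambda>i. 0)"
proof
  assume "lnorm a = 0"
  then show "a = (\<lambda>i. 0)"
    using coordinate_le_lnorm[OF assms] by fastforce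
next
  assume "a = (\<lambda>i. 0)"
  then show "lnorm a = 0"
    using lnorm_scale[OF assms, of 0] by simp
qed

lemma unit_seq_pts: "unit_seq i \<in> pts"
  by (rule finite_support_pts[of "Suc i"]) (simp add: unit_seq_def)

lemma lnorm_unit_seq: "lnorm (unit_seq i) \<le> 1"
proof (rule tendsto_upperbound[OF lnorm_tendsto[OF unit_seq_pts] _ nontrivial])
  have "(\<Sum>j<k. norm (unit_seq i j)) \<le> 1" for k
  proof -
    have "(\<Sum>j<k. norm (unit_seq i j)) = (\<Sum>j<k. if j = i then 1 else 0)"
      by (intro sum.cong) (auto simp: unit_seq_def)
    then show ?thesis
      by simp
  qed
  then show "eventually (\<lambda>k. pnorm {..<k} (unit_seq i) \<le> 1) U"
    using pnorm_le_sum order_trans by (intro always_eventually allI) blast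
qed

lemma lnorm_triangle:
  assumes "u \<in> pts" "v \<in> pts" "w \<in> pts"
  shows "lnorm (\<lambda>i. u i - w i) \<le> lnorm (\<lambda>i. u i - v i) + lnorm (\<lambda>i. v i - w i)"
  using lnorm_add[OF pts_diff[OF assms(1,2)] pts_diff[OF assms(2,3)]] by simp

lemma pnorm_interval_le_lnorm:
  assumes "a \<in> pts" "j \<le> k"
  shows "pnorm {j..<k} a \<le> 2 * B * lnorm a"
proof -
  have "norm (comb m {j..<k} a) \<le> norm (comb m {..<k} a) + norm (comb m {..<j} a)" for m
  proof -
    have "comb m {..<k} a = comb m {..<j} a + comb m {j..<k} a"
      unfolding comb_def using assms(2) by (subst sum.union_disjoint[symmetric])
        (auto simp: ivl_disj_un ivl_disj_int)
    then show ?thesis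
      by (metis add_diff_cancel_left' norm_triangle_ineq4)
  qed
  then have "pnorm {j..<k} a \<le> pnorm {..<k} a + pnorm {..<j} a"
    by (intro tendsto_le[OF nontrivial tendsto_add[OF pnorm_tendsto pnorm_tendsto] pnorm_tendsto])
      simp
  then show ?thesis
    using pnorm_le_lnorm[OF assms(1), of j] pnorm_le_lnorm[OF assms(1), of k] by simp
qed

text \<open>
  A Cauchy sequence converges coordinatewise along \<open>U\<close>, and the uniform bound on the initial
  segments turns this into convergence in norm.
\<close>

lemma limit_of_Cauchy:
  fixes \<sigma> :: "nat \<Rightarrow> nat \<Rightarrow> 'k"
  assumes pts: "\<And>n. \<sigma> n \<in> pts"
    and Cauchy: "\<And>\<epsilon>. 0 < \<epsilon> \<Longrightarrow> \<exists>n0. \<forall>m\<ge>n0. \<forall>n\<ge>n0. lnorm (\<lambda>i. \<sigma> m i - \<sigma> n i) < \<epsilon>"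
  shows "\<exists>a\<in>pts. \<forall>\<epsilon>>0. \<exists>n0. \<forall>n\<ge>n0. lnorm (\<lambda>i. \<sigma> n i - a i) < \<epsilon>"
proof -
  define a where "a i = Lim U (\<lambda>n. \<sigma> n i)" for i
  have lim: "((\<lambda>n. \<sigma> n i) \<longlongrightarrow> a i) U" for i
  proof -
    obtain n0 where n0: "\<And>m n. n0 \<le> m \<Longrightarrow> n0 \<le> n \<Longrightarrow> lnorm (\<lambda>i. \<sigma> m i - \<sigma> n i) < 1"
      using Cauchy[of 1] by auto
    \<comment> \<open>Beyond \<open>n0\<close> the coordinate stays within \<open>2 * B * B\<close>
      of its value at \<open>n0\<close>; the finitely many earlier values enter through the
      maximum.\<close>
    define c where "c = Max ((\<lambda>n. norm (\<sigma> n i)) ` {..n0}) + 2 * B * B"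
    have "norm (\<sigma> n i) \<le> c" for n
    proof (cases "n \<le> n0")
      case True
      then have "norm (\<sigma> n i) \<le> Max ((\<lambda>n. norm (\<sigma> n i)) ` {..n0})"
        by (intro Max_ge) auto
      then show ?thesis
        using B_pos by (simp add: c_def add_increasing2)
    next
      case False
      have "norm (\<sigma> n i - \<sigma> n0 i) \<le> 2 * B * B * lnorm (\<lambda>i. \<sigma> n i - \<sigma> n0 i)"
        using coordinate_le_lnorm[OF pts_diff[OF pts pts]] .
      also have "\<dots> \<le> 2 * B * B * 1"
        using n0[of n n0] False B_pos by (intro mult_left_mono) auto
      finally have "norm (\<sigma> n i) \<le> norm (\<sigma> n0 i) + 2 * B * B"
        using norm_triangle_sub[of "\<sigma> n i" "\<sigma> n0 i"] by simp
      moreover have "norm (\<sigma> n0 i) \<le> Max ((\<lambda>n. norm (\<sigma> n i)) ` {..n0})"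
        by (intro Max_ge) auto
      ultimately show ?thesis
        unfolding c_def by linarith
    qed
    then show ?thesis
      unfolding a_def by (rule tendsto_ulim)
  qed
  \<comment> \<open>The bound is uniform in the interval. For each single interval only finitely
    many coordinates matter, so \<open>\<sigma> m\<close> can be replaced by \<open>a\<close> in the
    limit over \<open>m\<close>, while the Cauchy condition bounds the distance from
    \<open>\<sigma> n\<close> to \<open>\<sigma> m\<close>.\<close>
  have close: "\<exists>n0. \<forall>n\<ge>n0. \<forall>j k. j \<le> k \<longrightarrow> pnorm {j..<k} (\<lambda>i. \<sigma> n i - a i) \<le> \<epsilon>"
    if "0 < \<epsilon>" for \<epsilon>
  proof -
    have "0 < \<epsilon> / (2 * B)"
      using that B_pos by simp
    then obtain n0 where n0: "\<And>m n. n0 \<le> m \<Longrightarrow> n0 \<le> n \<Longrightarrow> lnorm (\<lambda>i. \<sigma> m i - \<sigma> n i) < \<epsilon> / (2 * B)"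
      using Cauchy by blast
    have "pnorm {j..<k} (\<lambda>i. \<sigma> n i - a i) \<le> \<epsilon>" if "n0 \<le> n" "j \<le> k" for n j k
    proof -
      have "((\<lambda>m. \<epsilon> + (\<Sum>i=j..<k. norm (\<sigma> m i - a i))) \<longlongrightarrow> \<epsilon> + (\<Sum>i=j..<k. norm (a i - a i))) U"
        by (intro tendsto_intros lim)
      moreover have "eventually (\<lambda>m. pnorm {j..<k} (\<lambda>i. \<sigma> n i - a i) \<le>
          \<epsilon> + (\<Sum>i=j..<k. norm (\<sigma> m i - a i))) U"
        using eventually_ge[of n0]
      proof eventually_elim
        case (elim m)
        have "pnorm {j..<k} (\<lambda>i. \<sigma> n i - a i)
            \<le> pnorm {j..<k} (\<lambda>i. \<sigma> n i - \<sigma> m i) + pnorm {j..<k} (\<lambda>i. \<sigma> m i - a i)"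
          using pnorm_add[of "{j..<k}" "\<lambda>i. \<sigma> n i - \<sigma> m i" "\<lambda>i. \<sigma> m i - a i"] by simp
        moreover have "pnorm {j..<k} (\<lambda>i. \<sigma> n i - \<sigma> m i) \<le> 2 * B * lnorm (\<lambda>i. \<sigma> n i - \<sigma> m i)"
          using that by (intro pnorm_interval_le_lnorm pts_diff pts)
        moreover have "2 * B * lnorm (\<lambda>i. \<sigma> n i - \<sigma> m i) \<le> 2 * B * (\<epsilon> / (2 * B))"
          using n0[of n m] that elim B_pos by (intro mult_left_mono) auto
        moreover have "2 * B * (\<epsilon> / (2 * B)) = \<epsilon>"
          using B_pos by simp
        moreover have "pnorm {j..<k} (\<lambda>i. \<sigma> m i - a i) \<le> (\<Sum>i=j..<k. norm (\<sigma> m i - a i))"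
          by (rule pnorm_le_sum)
        ultimately show ?case
          by linarith
      qed
      ultimately have "pnorm {j..<k} (\<lambda>i. \<sigma> n i - a i) \<le> \<epsilon> + (\<Sum>i=j..<k. norm (a i - a i))"
        by (rule tendsto_lowerbound[OF _ _ nontrivial])
      then show ?thesis
        by simp
    qed
    then show ?thesis
      by blast
  qed
  have "a \<in> pts"
    unfolding pts_def
  proof (intro CollectI allI impI)
    fix \<epsilon> :: real assume "0 < \<epsilon>"
    then have e: "0 < \<epsilon> / 2"
      by simp
    obtain n where n: "\<And>j k. j \<le> k \<Longrightarrow> pnorm {j..<k} (\<lambda>i. \<sigma> n i - a i) \<le> \<epsilon> / 2"
      using close[OF e] by blast
    obtain K where K: "\<And>j k. K \<le> j \<Longrightarrow> j \<le> k \<Longrightarrow> pnorm {j..<k} (\<sigma> n) < \<epsilon> / 2"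
      using ptsD[OF pts e] by blast
    have "pnorm {j..<k} a < \<epsilon>" if "K \<le> j" "j \<le> k" for j k
      using n[of j k] K[of j k] that pnorm_diff[of "{j..<k}" "\<sigma> n" a] by linarith
    then show "\<exists>K. \<forall>j k. K \<le> j \<longrightarrow> j \<le> k \<longrightarrow> pnorm {j..<k} a < \<epsilon>"
      by blast
  qed
  moreover have "\<exists>n0. \<forall>n\<ge>n0. lnorm (\<lambda>i. \<sigma> n i - a i) < \<epsilon>" if "0 < \<epsilon>" for \<epsilon>
  proof -
    have "0 < \<epsilon> / 2"
      using that by simp
    then obtain n0 where n0: "\<And>n j k. n0 \<le> n \<Longrightarrow> j \<le> k \<Longrightarrow> pnorm {j..<k} (\<lambda>i. \<sigma> n i - a i) \<le> \<epsilon> / 2"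
      using close[of "\<epsilon> / 2"] by blast
    have "lnorm (\<lambda>i. \<sigma> n i - a i) \<le> \<epsilon> / 2" if "n0 \<le> n" for n
      using n0[OF that, of 0]
      by (intro tendsto_upperbound[OF lnorm_tendsto _ nontrivial] pts_diff pts \<open>a \<in> pts\<close>)
        (simp add: atLeast0LessThan)
    then have "lnorm (\<lambda>i. \<sigma> n i - a i) < \<epsilon>" if "n0 \<le> n" for n
      using that \<open>0 < \<epsilon>\<close> by fastforce
    then show ?thesis
      by blast
  qed
  ultimately show ?thesis
    by blast
qed

lemma banach_space_Y: "banach_space Y"
proof
  show "Metric_space.mcomplete (points Y) (\<lambda>u v. vnorm Y (vadd Y u (vscale Y (-1) v)))"
  proof -
    have d: "(\<lambda>u v. vnorm Y (vadd Y u (vscale Y (-1) v))) = (\<lambda>u v. lnorm (\<lambda>i. u i - v i))"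
      by (simp add: Y_def)
    interpret Metric_space pts "\<lambda>u v. lnorm (\<lambda>i. u i - v i)"
    proof
      show "0 \<le> lnorm (\<lambda>i. u i - v i)" for u v
        by (rule lnorm_nonneg)
      show "lnorm (\<lambda>i. u i - v i) = lnorm (\<lambda>i. v i - u i)" for u v
        by (rule lnorm_diff_commute)
      show "lnorm (\<lambda>i. u i - v i) = 0 \<longleftrightarrow> u = v" if "u \<in> pts" "v \<in> pts" for u v
        using lnorm_eq_0_iff[OF pts_diff[OF that]] by (simp add: fun_eq_iff)
    qed (rule lnorm_triangle)
    have "mcomplete"
      unfolding mcomplete_def
    proof (intro allI impI)
      fix \<sigma> assume "MCauchy \<sigma>"
      then have \<sigma>: "\<sigma> n \<in> pts" for n
        by (auto simp: MCauchy_def)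
      have "\<exists>n0. \<forall>m\<ge>n0. \<forall>n\<ge>n0. lnorm (\<lambda>i. \<sigma> m i - \<sigma> n i) < \<epsilon>" if "0 < \<epsilon>" for \<epsilon>
        using \<open>MCauchy \<sigma>\<close> that unfolding MCauchy_def by meson
      then obtain a where "a \<in> pts" "\<forall>\<epsilon>>0. \<exists>n0. \<forall>n\<ge>n0. lnorm (\<lambda>i. \<sigma> n i - a i) < \<epsilon>"
        using limit_of_Cauchy[of \<sigma>, OF \<sigma>] by metis
      then have "limitin mtopology \<sigma> a sequentially"
        by (simp add: limit_metric_sequentially \<sigma>)
      then show "\<exists>a. limitin mtopology \<sigma> a sequentially"
        by (rule exI[of _ a])
    qed
    then show ?thesis
      unfolding d by (simp add: Y_def)
  qed
next
  show "vzero Y \<in> points Y"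
    by (simp add: Y_def finite_support_pts[of 0])
next
  fix u v w assume "u \<in> points Y" "v \<in> points Y" "w \<in> points Y"
  then show "vadd Y u v \<in> points Y" "vadd Y (vadd Y u v) w = vadd Y u (vadd Y v w)"
    "vadd Y u v = vadd Y v u" "vnorm Y (vadd Y u v) \<le> vnorm Y u + vnorm Y v"
    by (simp_all add: Y_def pts_add lnorm_add add_ac)
next
  fix u v c assume "u \<in> points Y" "v \<in> points Y"
  then show "vscale Y c (vadd Y u v) = vadd Y (vscale Y c u) (vscale Y c v)"
    by (simp add: Y_def distrib_left)
next
  fix u c d assume "u \<in> points Y"
  then show "vscale Y c u \<in> points Y" "vadd Y u (vzero Y) = u"
    "vadd Y u (vscale Y (-1) u) = vzero Y"
    "vscale Y (c + d) u = vadd Y (vscale Y c u) (vscale Y d u)"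
    "vscale Y c (vscale Y d u) = vscale Y (c * d) u" "vscale Y 1 u = u"
    "vnorm Y u = 0 \<longleftrightarrow> u = vzero Y" "vnorm Y (vscale Y c u) = norm c * vnorm Y u"
    by (simp_all add: Y_def pts_scale lnorm_scale lnorm_eq_0_iff distrib_right mult.assoc)
qed

section \<open>The dual of the limit space and the failure of reflexivity\<close>

lemma lnorm_le_1_SUP:
  assumes f: "f \<in> points (dual Y)"
  shows "norm (f (unit_seq i)) \<le> vnorm (dual Y) f"
proof -
  obtain K where K: "\<And>u. u \<in> pts \<Longrightarrow> norm (f u) \<le> K * lnorm u"
    using f by (auto simp: dual_def Y_def)
  have "norm (f u) \<le> \<bar>K\<bar>" if "u \<in> pts" "lnorm u \<le> 1" for u
  proof -
    have "K * lnorm u \<le> \<bar>K\<bar> * lnorm u"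
      by (intro mult_right_mono lnorm_nonneg) simp
    also have "\<dots> \<le> \<bar>K\<bar> * 1"
      using that by (intro mult_left_mono) auto
    finally show ?thesis
      using K[OF that(1)] by simp
  qed
  \<comment> \<open>Boundedness makes the supremum in the dual norm a true upper bound. Since the
    unit vectors lie in the unit ball, the evaluations at them are uniformly bounded and have a
    limit along \<open>U\<close>.\<close>
  then have "bdd_above ((\<lambda>u. norm (f u)) ` {u \<in> points Y. vnorm Y u \<le> 1})"
    by (intro bdd_aboveI2[of _ _ "\<bar>K\<bar>"]) (simp add: Y_def)
  then show ?thesis
    unfolding dual_def
    by (simp, intro cSUP_upper) (simp_all add: Y_def unit_seq_pts lnorm_unit_seq)
qed

lemma dual_memberI:
  assumes "\<And>u v. u \<in> pts \<Longrightarrow> v \<in> pts \<Longrightarrow> f (\<lambda>i. u i + v i) = f u + f v"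
    and "\<And>c u. u \<in> pts \<Longrightarrow> f (\<lambda>i. c * u i) = c * f u"
    and "\<And>u. u \<in> pts \<Longrightarrow> norm (f u) \<le> K * lnorm u"
  shows "(\<lambda>u. if u \<in> pts then f u else 0) \<in> points (dual Y)"
proof -
  have "\<exists>K. \<forall>u\<in>pts. norm (f u) \<le> K * lnorm u"
    using assms(3) by blast
  then show ?thesis
    using assms(1,2) unfolding dual_def linear_map_on_def
    by (simp add: Y_def scalar_space_def pts_add pts_scale)
qed

lemma sum_tendsto:
  assumes "a \<in> pts"
  shows "((\<lambda>k. \<Sum>i<k. a i) \<longlongrightarrow> Lim U (\<lambda>k. \<Sum>i<k. a i)) U"
  by (rule tendsto_ulim) (rule sum_le_lnorm[OF assms])

definition total :: "(nat \<Rightarrow> 'k) \<Rightarrow> 'k" where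
  "total u = (if u \<in> pts then Lim U (\<lambda>k. \<Sum>i<k. u i) else 0)"

lemma total_dual: "total \<in> points (dual Y)"
proof -
  have "(\<lambda>u. if u \<in> pts then Lim U (\<lambda>k. \<Sum>i<k. u i) else 0) \<in> points (dual Y)"
  proof (rule dual_memberI)
    fix u v assume uv: "u \<in> pts" "v \<in> pts"
    show "Lim U (\<lambda>k. \<Sum>i<k. u i + v i) = Lim U (\<lambda>k. \<Sum>i<k. u i) + Lim U (\<lambda>k. \<Sum>i<k. v i)"
      using tendsto_add[OF sum_tendsto[OF uv(1)] sum_tendsto[OF uv(2)]] nontrivial
      by (simp add: sum.distrib tendsto_Lim)
  next
    fix c u assume u: "u \<in> pts"
    show "Lim U (\<lambda>k. \<Sum>i<k. c * u i) = c * Lim U (\<lambda>k. \<Sum>i<k. u i)"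
      using tendsto_mult_left[OF sum_tendsto[OF u], of c] nontrivial
      by (simp add: sum_distrib_left tendsto_Lim)
  next
    fix u assume u: "u \<in> pts"
    show "norm (Lim U (\<lambda>k. \<Sum>i<k. u i)) \<le> (B * B) * lnorm u"
      by (rule tendsto_upperbound[OF tendsto_norm[OF sum_tendsto[OF u]] _ nontrivial])
        (simp add: sum_le_lnorm[OF u])
  qed
  then show ?thesis
    by (simp add: total_def[abs_def])
qed

lemma total_unit_seq: "total (unit_seq i) = 1"
proof -
  have "eventually (\<lambda>k. (\<Sum>j<k. unit_seq i j) = 1) U"
    using eventually_ge[of "Suc i"]
    by eventually_elim (simp add: unit_seq_def)
  then have "((\<lambda>k. \<Sum>j<k. unit_seq i j) \<longlongrightarrow> 1) U"
    by (rule tendsto_eventually)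
  then show ?thesis
    by (simp add: total_def unit_seq_pts tendsto_Lim nontrivial)
qed

definition coord :: "nat \<Rightarrow> (nat \<Rightarrow> 'k) \<Rightarrow> 'k" where
  "coord j u = (if u \<in> pts then u j else 0)"

lemma coord_dual: "coord j \<in> points (dual Y)"
  using dual_memberI[where f = "\<lambda>u. u j" and K = "2 * B * B"] coordinate_le_lnorm
  by (simp add: coord_def[abs_def])

text \<open>
  The limit of the evaluations at the unit vectors kills all coordinates, but not the sum of the
  coordinates.
\<close>

lemma not_reflexive_Y: "\<not> reflexive Y"
proof
  assume refl: "reflexive Y"
  \<comment> \<open>The value 0 outside the dual is what membership in \<open>dual (dual Y)\<close>
    requires.\<close>
  define \<Phi> where "\<Phi> f = (if f \<in> points (dual Y) then Lim U (\<lambda>i. f (unit_seq i)) else 0)" for f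
  have \<Phi>: "((\<lambda>i. f (unit_seq i)) \<longlongrightarrow> \<Phi> f) U" if "f \<in> points (dual Y)" for f
    using tendsto_ulim[of "\<lambda>i. f (unit_seq i)", OF lnorm_le_1_SUP[OF that]] that
    by (simp add: \<Phi>_def)
  have add: "(\<lambda>u. f u + g u) \<in> points (dual Y)"
    if fg: "f \<in> points (dual Y)" "g \<in> points (dual Y)" for f g
  proof -
    obtain K L where "\<And>u. u \<in> points Y \<Longrightarrow> norm (f u) \<le> K * vnorm Y u"
      "\<And>u. u \<in> points Y \<Longrightarrow> norm (g u) \<le> L * vnorm Y u"
      using fg unfolding dual_def by fastforce
    then have "\<forall>u\<in>points Y. norm (f u + g u) \<le> (K + L) * vnorm Y u"
      unfolding distrib_right by (meson add_mono norm_triangle_le)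
    then have "\<exists>K. \<forall>u\<in>points Y. norm (f u + g u) \<le> K * vnorm Y u" ..
    then show ?thesis
      using fg unfolding dual_def linear_map_on_def
      by (simp add: scalar_space_def distrib_left)
  qed
  have scale: "(\<lambda>u. c * f u) \<in> points (dual Y)" if f: "f \<in> points (dual Y)" for c f
  proof -
    obtain K where "\<And>u. u \<in> points Y \<Longrightarrow> norm (f u) \<le> K * vnorm Y u"
      using f unfolding dual_def by fastforce
    then have "\<forall>u\<in>points Y. norm (c * f u) \<le> (norm c * K) * vnorm Y u"
      by (simp add: norm_mult mult.assoc mult_left_mono)
    then have "\<exists>K. \<forall>u\<in>points Y. norm (c * f u) \<le> K * vnorm Y u" ..
    then show ?thesis
      using f unfolding dual_def linear_map_on_def
      by (simp add: scalar_space_def distrib_left mult.left_commute)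
  qed
  have "\<Phi> (\<lambda>u. f u + g u) = \<Phi> f + \<Phi> g"
    if "f \<in> points (dual Y)" "g \<in> points (dual Y)" for f g
    using tendsto_unique[OF nontrivial \<Phi>[OF add[OF that]] tendsto_add[OF \<Phi> \<Phi>]] that by simp
  moreover have "\<Phi> (\<lambda>u. c * f u) = c * \<Phi> f" if "f \<in> points (dual Y)" for c f
    using tendsto_unique[OF nontrivial \<Phi>[OF scale[OF that]] tendsto_mult_left[OF \<Phi>]] that by simp
  moreover have bound: "norm (\<Phi> f) \<le> 1 * vnorm (dual Y) f" if "f \<in> points (dual Y)" for f
    using tendsto_upperbound[OF tendsto_norm[OF \<Phi>[OF that]] _ nontrivial] lnorm_le_1_SUP[OF that]
    by simp
  moreover have "vadd (dual Y) f g = (\<lambda>u. f u + g u)" "vscale (dual Y) c f = (\<lambda>u. c * f u)" for f g c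
    by (simp_all add: dual_def)
  ultimately have "linear_map_on (points (dual Y)) (dual Y) scalar_space \<Phi>"
    unfolding linear_map_on_def by (simp add: scalar_space_def)
  moreover have "\<exists>K. \<forall>f\<in>points (dual Y). norm (\<Phi> f) \<le> K * vnorm (dual Y) f"
    by (intro exI[of _ 1] ballI bound)
  moreover have "\<Phi> f = 0" if "f \<notin> points (dual Y)" for f
    using that by (simp add: \<Phi>_def)
  ultimately have "\<Phi> \<in> points (dual (dual Y))"
    by (subst dual_def) simp
  then obtain u where u: "u \<in> pts" "\<And>f. f \<in> points (dual Y) \<Longrightarrow> \<Phi> f = f u"
    using refl unfolding reflexive_def by (auto simp: Y_def)
  have "u j = 0" for j
  proof -
    have "eventually (\<lambda>i. coord j (unit_seq i) = 0) U"
      using eventually_ge[of "Suc j"]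
      by eventually_elim (simp add: coord_def unit_seq_def unit_seq_pts)
    then have "((\<lambda>i. coord j (unit_seq i)) \<longlongrightarrow> 0) U"
      by (rule tendsto_eventually)
    then have "\<Phi> (coord j) = 0"
      using tendsto_unique[OF nontrivial \<Phi>[OF coord_dual]] by blast
    then show ?thesis
      using u coord_dual by (simp add: coord_def)
  qed
  then have "total u = 0"
    using u(1) tendsto_Lim[OF nontrivial, of "\<lambda>k. 0" 0] by (simp add: total_def)
  moreover have "\<Phi> total = 1"
    using tendsto_unique[OF nontrivial \<Phi>[OF total_dual], of 1] by (simp add: total_unit_seq)
  ultimately show False
    using u(2)[OF total_dual] by simp
qed

end

section \<open>Coordinates in finite-dimensional spaces of sequences\<close>

definition lspan :: "(nat \<Rightarrow> 'k::field) set \<Rightarrow> (nat \<Rightarrow> 'k) set" where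
  "lspan S = {u. \<exists>c. u = (\<lambda>n. \<Sum>s\<in>S. c s * s n)}"

lemma lspanI: "u = (\<lambda>n. \<Sum>s\<in>S. c s * s n) \<Longrightarrow> u \<in> lspan S"
  unfolding lspan_def by (intro CollectI exI)

text \<open>The reduced echelon form of a spanning set.\<close>

lemma echelon_basis:
  fixes S :: "(nat \<Rightarrow> 'k::field) set"
  assumes "finite S"
  shows "\<exists>I b. finite I \<and> (\<forall>i\<in>I. b i \<in> lspan S) \<and>
    (\<forall>i\<in>I. \<forall>j\<in>I. b i j = (if i = j then 1 else 0)) \<and>
    (\<forall>u\<in>lspan S. \<forall>n. u n = (\<Sum>i\<in>I. u i * b i n))"
  using assms
proof (induction S)
  case empty
  show ?case
    by (intro exI[of _ "{}"]) (simp add: lspan_def)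
next
  case (insert v S)
  from insert.IH obtain I b where IH: "finite I \<and> (\<forall>i\<in>I. b i \<in> lspan S) \<and>
    (\<forall>i\<in>I. \<forall>j\<in>I. b i j = (if i = j then 1 else 0)) \<and>
    (\<forall>u\<in>lspan S. \<forall>n. u n = (\<Sum>i\<in>I. u i * b i n))"
    by (elim exE)
  have I: "finite I" and bL: "\<And>i. i \<in> I \<Longrightarrow> b i \<in> lspan S"
    and delta: "\<And>i j. i \<in> I \<Longrightarrow> j \<in> I \<Longrightarrow> b i j = (if i = j then 1 else 0)"
    and coords: "\<And>u n. u \<in> lspan S \<Longrightarrow> u n = (\<Sum>i\<in>I. u i * b i n)"
    using IH by (blast, blast, simp, blast)
  have L_insert: "u \<in> lspan (insert v S) \<longleftrightarrow> (\<exists>c. \<exists>w\<in>lspan S. u = (\<lambda>n. c * v n + w n))" for u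
  proof
    assume "u \<in> lspan (insert v S)"
    then obtain c where "u = (\<lambda>n. \<Sum>s\<in>insert v S. c s * s n)"
      by (auto simp: lspan_def)
    then have "u = (\<lambda>n. c v * v n + (\<Sum>s\<in>S. c s * s n))"
      using insert.hyps by simp
    moreover have "(\<lambda>n. \<Sum>s\<in>S. c s * s n) \<in> lspan S"
      by (auto simp: lspan_def)
    ultimately show "\<exists>c. \<exists>w\<in>lspan S. u = (\<lambda>n. c * v n + w n)"
      by (intro exI[of _ "c v"] bexI[of _ "\<lambda>n. \<Sum>s\<in>S. c s * s n"])
  next
    assume "\<exists>c. \<exists>w\<in>lspan S. u = (\<lambda>n. c * v n + w n)"
    then obtain c d where u: "u = (\<lambda>n. c * v n + (\<Sum>s\<in>S. d s * s n))"
      by (auto simp: lspan_def)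
    have "(\<Sum>s\<in>S. (if s = v then c else d s) * s n) = (\<Sum>s\<in>S. d s * s n)" for n
      using insert.hyps by (intro sum.cong) auto
    then have "u = (\<lambda>n. \<Sum>s\<in>insert v S. (if s = v then c else d s) * s n)"
      using insert.hyps by (simp add: u)
    then show "u \<in> lspan (insert v S)"
      unfolding lspan_def by (intro CollectI exI)
  qed
  have L_sum: "(\<lambda>n. \<Sum>i\<in>I. c i * b i n) \<in> lspan S" for c
  proof -
    have "\<forall>i\<in>I. \<exists>d. b i = (\<lambda>n. \<Sum>s\<in>S. d s * s n)"
      using bL by (simp add: lspan_def)
    from bchoice[OF this] obtain d where d: "\<And>i. i \<in> I \<Longrightarrow> b i = (\<lambda>n. \<Sum>s\<in>S. d i s * s n)"
      by blast
    have "(\<Sum>i\<in>I. c i * b i n) = (\<Sum>i\<in>I. \<Sum>s\<in>S. c i * d i s * s n)" for n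
      by (simp add: d sum_distrib_left mult.assoc)
    also have "\<dots> n = (\<Sum>s\<in>S. (\<Sum>i\<in>I. c i * d i s) * s n)" for n
      by (subst sum.swap) (simp add: sum_distrib_right)
    finally show ?thesis
      by (auto simp: lspan_def)
  qed
  have L_scale_add: "(\<lambda>n. c * u n + w n) \<in> lspan S" if uw: "u \<in> lspan S" "w \<in> lspan S" for c u w
  proof -
    have "c * u n + w n = (\<Sum>i\<in>I. (c * u i + w i) * b i n)" for n
    proof -
      have "(\<Sum>i\<in>I. (c * u i + w i) * b i n) = c * (\<Sum>i\<in>I. u i * b i n) + (\<Sum>i\<in>I. w i * b i n)"
        by (simp add: distrib_right sum.distrib sum_distrib_left mult.assoc)
      also have "\<dots> = c * u n + w n"
        by (simp only: coords[OF uw(1), of n, symmetric] coords[OF uw(2), of n, symmetric])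
      finally show ?thesis ..
    qed
    then have "(\<lambda>n. c * u n + w n) = (\<lambda>n. \<Sum>i\<in>I. (c * u i + w i) * b i n)"
      by (rule ext)
    then show ?thesis
      by (rule ssubst) (rule L_sum)
  qed
  have sub: "u \<in> lspan (insert v S)" if "u \<in> lspan S" for u
    unfolding L_insert using that by (intro exI[of _ 0] bexI[of _ u]) simp_all
  \<comment> \<open>The vector of \<open>lspan S\<close> with the entries of \<open>v\<close> at the
    pivots \<open>I\<close>; it equals \<open>v\<close> exactly when \<open>v\<close> already lies
    in \<open>lspan S\<close>.\<close>
  define p where "p n = (\<Sum>i\<in>I. v i * b i n)" for n
  have pL: "p \<in> lspan S"
    using L_sum[of v] by (simp add: p_def[abs_def])
  have p_I: "p i = v i" if "i \<in> I" for i
  proof -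
    have "p i = (\<Sum>k\<in>I. if k = i then v k else 0)"
      unfolding p_def by (rule sum.cong) (simp_all add: delta that)
    then show ?thesis
      using I that by simp
  qed
  show ?case
  proof (cases "p = v")
    case True
    show ?thesis
    proof (intro exI[of _ I] exI[of _ b] conjI ballI allI)
      fix u n assume "u \<in> lspan (insert v S)"
      then obtain c w where "w \<in> lspan S" "u = (\<lambda>n. c * v n + w n)"
        unfolding L_insert by blast
      then have "u \<in> lspan S"
        using L_scale_add[OF pL, of w c] True by simp
      then show "u n = (\<Sum>i\<in>I. u i * b i n)"
        by (rule coords)
    qed (use I sub bL delta in auto)
  next
    case False
    then obtain j where j: "p j \<noteq> v j"
      by blast
    then have "j \<notin> I"
      using p_I by blast
    \<comment> \<open>The nonzero remainder of \<open>v\<close>, scaled to be 1 at \<open>j\<close>,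
      is the new basis vector with pivot \<open>j\<close>; it vanishes at the old pivots.\<close>
    define t where "t n = (v n - p n) / (v j - p j)" for n
    have t: "t j = 1" "\<And>i. i \<in> I \<Longrightarrow> t i = 0"
      using j p_I by (simp_all add: t_def)
    \<comment> \<open>Subtracting \<open>b i j * t\<close> clears the new pivot from the old basis
      vectors and leaves their entries at the old pivots unchanged.\<close>
    define e where "e i = (if i = j then t else (\<lambda>n. b i n - b i j * t n))" for i
    have t_sub: "(\<lambda>n. c * t n + w n) \<in> lspan (insert v S)" if w: "w \<in> lspan S" for c w
    proof -
      define d where "d = c / (v j - p j)"
      have "(\<lambda>n. c * t n + w n) = (\<lambda>n. d * v n + ((- d) * p n + w n))"
        by (simp add: t_def d_def fun_eq_iff right_diff_distrib diff_divide_distrib)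
      then show ?thesis
        unfolding L_insert using L_scale_add[OF pL w, of "- d"]
        by (intro exI[of _ d] bexI[of _ "\<lambda>n. - d * p n + w n"])
    qed
    have L0: "(\<lambda>n. 0) \<in> lspan S"
      using L_sum[of "\<lambda>_. 0"] by simp
    show ?thesis
    proof (intro exI[of _ "insert j I"] exI[of _ e] conjI ballI allI)
      show "finite (insert j I)"
        using I by simp
      show "e i \<in> lspan (insert v S)" if i: "i \<in> insert j I" for i
      proof (cases "i = j")
        case True
        then show ?thesis
          using t_sub[OF L0, of 1] by (simp add: e_def)
      next
        case False
        then show ?thesis
          using t_sub[OF bL, of i "- b i j"] i by (simp add: e_def)
      qed
      show "e i k = (if i = k then 1 else 0)" if "i \<in> insert j I" "k \<in> insert j I" for i k
        using that \<open>j \<notin> I\<close> by (auto simp: e_def t delta)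
      show "u n = (\<Sum>i\<in>insert j I. u i * e i n)" if u: "u \<in> lspan (insert v S)" for u n
      proof -
        obtain c w where w: "w \<in> lspan S" "u = (\<lambda>n. c * v n + w n)"
          using u unfolding L_insert by blast
        define w1 where "w1 n = c * p n + w n" for n
        have w1L: "w1 \<in> lspan S"
          using L_scale_add[OF pL w(1)] by (simp add: w1_def[abs_def])
        define d where "d = c * (v j - p j)"
        have u_eq: "u n = w1 n + d * t n" for n
        proof -
          have "d * t n = c * (v n - p n)"
            using j by (simp add: d_def t_def)
          then show ?thesis
            by (simp add: w w1_def right_diff_distrib)
        qed
        have u_I: "u i = w1 i" if "i \<in> I" for i
          using u_eq[of i] t that by simp
        have w1: "w1 n = (\<Sum>i\<in>I. u i * b i n)" for n
          by (subst coords[OF w1L, of n]) (simp add: u_I)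
        have "(\<Sum>i\<in>insert j I. u i * e i n) = u j * t n + (\<Sum>i\<in>I. u i * (b i n - b i j * t n))"
          using I \<open>j \<notin> I\<close> by (simp add: e_def) (intro sum.cong, auto)
        also have "(\<Sum>i\<in>I. u i * (b i n - b i j * t n)) = w1 n - w1 j * t n"
          unfolding w1 by (simp add: right_diff_distrib sum_subtractf sum_distrib_right mult.assoc)
        also have "u j * t n + (w1 n - w1 j * t n) = u n"
          using u_eq[of j] u_eq[of n] t by (simp add: algebra_simps)
        finally show ?thesis ..
      qed
    qed
  qed
qed

section \<open>Finite representability of the limit space\<close>

context limit_space
begin

text \<open>Pointwise limits of equi-Lipschitz functions are uniform on the unit ball of a
  finite-dimensional space. Compactness of the ball is replaced by limits along \<open>U\<close>:
  counterexamples chosen for each \<open>m\<close> have convergent coordinates, and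
  \<open>coords\<close> expresses a vector through finitely many of them, so the counterexamples
  converge in norm to a vector of \<open>E\<close>.\<close>

lemma uniform_on_ball:
  fixes r :: "nat \<Rightarrow> (nat \<Rightarrow> 'k) \<Rightarrow> real"
  assumes E: "E \<subseteq> pts" and I: "finite I" and bE: "\<And>i. i \<in> I \<Longrightarrow> b i \<in> pts"
    and comb_E: "\<And>c. (\<lambda>n. \<Sum>i\<in>I. c i * b i n) \<in> E"
    and coords: "\<And>u n. u \<in> E \<Longrightarrow> u n = (\<Sum>i\<in>I. u i * b i n)"
    and lip: "\<And>m u v. u \<in> E \<Longrightarrow> v \<in> E \<Longrightarrow> \<bar>r m u - r m v\<bar> \<le> L * lnorm (\<lambda>i. u i - v i)"
    and L: "0 \<le> L"
    and lim: "\<And>u. u \<in> E \<Longrightarrow> ((\<lambda>m. r m u) \<longlongrightarrow> r' u) U"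
    and \<delta>: "0 < \<delta>"
  shows "eventually (\<lambda>m. \<forall>u\<in>E. lnorm u \<le> 1 \<longrightarrow> \<bar>r m u - r' u\<bar> \<le> \<delta>) U"
proof (rule ccontr)
  define bad where "bad m u \<longleftrightarrow> u \<in> E \<and> lnorm u \<le> 1 \<and> \<delta> < \<bar>r m u - r' u\<bar>" for m u
  assume "\<not> ?thesis"
  then have "eventually (\<lambda>m. \<not> (\<forall>u\<in>E. lnorm u \<le> 1 \<longrightarrow> \<bar>r m u - r' u\<bar> \<le> \<delta>)) U"
    using ultra[of "\<lambda>m. \<forall>u\<in>E. lnorm u \<le> 1 \<longrightarrow> \<bar>r m u - r' u\<bar> \<le> \<delta>"] by argo
  then have ex_bad: "eventually (\<lambda>m. \<exists>u. bad m u) U"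
    by (rule eventually_mono) (auto simp: bad_def not_le)
  \<comment> \<open>The default 0 keeps every \<open>u m\<close> in the unit ball of
    \<open>E\<close>, so its coordinates are bounded for all \<open>m\<close>.\<close>
  define u where "u m = (if \<exists>v. bad m v then SOME v. bad m v else (\<lambda>n. 0))" for m
  have bad_u: "bad m (u m)" if "\<exists>v. bad m v" for m
    using someI_ex[OF that] that by (simp add: u_def)
  have zero: "(\<lambda>n. 0) \<in> E" "lnorm (\<lambda>n. 0) \<le> 1"
    using comb_E[of "\<lambda>_. 0"] lnorm_eq_0_iff[OF finite_support_pts[of 0 "\<lambda>n. 0"]] by simp_all
  have u: "u m \<in> E" "lnorm (u m) \<le> 1" for m
    using bad_u[of m] zero by (cases "\<exists>v. bad m v"; simp add: bad_def u_def)+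
  have far: "eventually (\<lambda>m. \<delta> < \<bar>r m (u m) - r' (u m)\<bar>) U"
    using ex_bad by (rule eventually_mono) (use bad_u in \<open>simp add: bad_def\<close>)
  define c where "c i = Lim U (\<lambda>m. u m i)" for i
  have c: "((\<lambda>m. u m i) \<longlongrightarrow> c i) U" for i
    unfolding c_def
  proof (rule tendsto_ulim)
    fix m
    have "norm (u m i) \<le> 2 * B * B * lnorm (u m)"
      using u E by (intro coordinate_le_lnorm) auto
    also have "\<dots> \<le> 2 * B * B * 1"
      using u B_pos by (intro mult_left_mono) auto
    finally show "norm (u m i) \<le> 2 * B * B * 1" .
  qed
  define w where "w n = (\<Sum>i\<in>I. c i * b i n)" for n
  have w: "w \<in> E"
    using comb_E[of c] by (simp add: w_def[abs_def])
  have lnorm_sum: "lnorm (\<lambda>n. \<Sum>i\<in>J. a i * b i n) \<le> (\<Sum>i\<in>J. norm (a i) * lnorm (b i)) \<and>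
      (\<lambda>n. \<Sum>i\<in>J. a i * b i n) \<in> pts" if "finite J" "J \<subseteq> I" for a J
    using that
  proof (induction J)
    case empty
    show ?case
      using lnorm_eq_0_iff[OF finite_support_pts[of 0 "\<lambda>n. 0"]] by (simp add: finite_support_pts)
  next
    case (insert j J)
    then have *: "(\<lambda>n. a j * b j n) \<in> pts" "(\<lambda>n. \<Sum>i\<in>J. a i * b i n) \<in> pts" "b j \<in> pts"
      by (simp_all add: pts_scale bE)
    have "lnorm (\<lambda>n. a j * b j n + (\<Sum>i\<in>J. a i * b i n))
        \<le> norm (a j) * lnorm (b j) + (\<Sum>i\<in>J. norm (a i) * lnorm (b i))"
      using lnorm_add[OF *(1,2)] insert by (simp add: lnorm_scale[OF *(3)])
    then show ?case
      using insert pts_add[OF *(1,2)] by simp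
  qed
  define g where "g m = (\<Sum>i\<in>I. norm (u m i - c i) * lnorm (b i))" for m
  have g: "lnorm (\<lambda>n. u m n - w n) \<le> g m" for m
  proof -
    have "u m n - w n = (\<Sum>i\<in>I. (u m i - c i) * b i n)" for n
      by (subst coords[OF u(1)]) (simp add: w_def left_diff_distrib sum_subtractf)
    then have "(\<lambda>n. u m n - w n) = (\<lambda>n. \<Sum>i\<in>I. (u m i - c i) * b i n)"
      by (rule ext)
    then show ?thesis
      using lnorm_sum[OF I order_refl, of "\<lambda>i. u m i - c i"] by (simp add: g_def)
  qed
  have "((\<lambda>m. \<Sum>i\<in>I. norm (u m i - c i) * lnorm (b i)) \<longlongrightarrow> (\<Sum>i\<in>I. norm (c i - c i) * lnorm (b i))) U"
    by (intro tendsto_intros c)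
  then have g0: "(g \<longlongrightarrow> 0) U"
    by (simp add: g_def[abs_def])
  \<comment> \<open>The limit function inherits the Lipschitz bound, so \<open>u m\<close> can be
    replaced by the fixed vector \<open>w\<close> in both \<open>r m\<close> and
    \<open>r'\<close>.\<close>
  have lip': "\<bar>r' u - r' v\<bar> \<le> L * lnorm (\<lambda>i. u i - v i)" if "u \<in> E" "v \<in> E" for u v
    by (rule tendsto_upperbound[OF tendsto_rabs[OF tendsto_diff[OF lim[OF that(1)] lim[OF that(2)]]] _ nontrivial])
      (simp add: lip that)
  have "((\<lambda>m. L * g m + \<bar>r m w - r' w\<bar> + L * g m) \<longlongrightarrow> L * 0 + \<bar>r' w - r' w\<bar> + L * 0) U"
    by (intro tendsto_intros g0 lim w)
  moreover have "eventually (\<lambda>m. \<delta> \<le> L * g m + \<bar>r m w - r' w\<bar> + L * g m) U"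
    using far
  proof eventually_elim
    case (elim m)
    have "L * lnorm (\<lambda>n. u m n - w n) \<le> L * g m"
      using g L by (rule mult_left_mono)
    then show ?case
      using elim lip[OF u(1) w, of m m] lip'[OF u(1) w, of m] by linarith
  qed
  ultimately have "\<delta> \<le> L * 0 + \<bar>r' w - r' w\<bar> + L * 0"
    by (rule tendsto_lowerbound[OF _ _ nontrivial])
  then show False
    using \<delta> by simp
qed

lemma subspace_sum_closed:
  assumes "subspace_of E Y" "finite J" "\<And>i. i \<in> J \<Longrightarrow> b i \<in> E"
  shows "(\<lambda>n. \<Sum>i\<in>J. c i * b i n) \<in> E"
  using assms(2,3)
proof (induction J)
  case empty
  then show ?case
    using assms(1) by (simp add: subspace_of_def Y_def)
next
  case (insert j J)
  then have "(\<lambda>n. c j * b j n) \<in> E" "(\<lambda>n. \<Sum>i\<in>J. c i * b i n) \<in> E"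
    using assms(1) by (simp_all add: subspace_of_def Y_def)
  then have "(\<lambda>n. c j * b j n + (\<Sum>i\<in>J. c i * b i n)) \<in> E"
    using assms(1) by (simp add: subspace_of_def Y_def)
  then show ?case
    using insert.hyps by simp
qed

text \<open>Finite dimension is defined by minimality over a finite set \<open>S\<close>, and
  \<open>lspan S\<close> is a subspace containing \<open>S\<close>, whence
  \<open>E \<subseteq> lspan S\<close>. The reduced echelon form makes the coordinates of
  \<open>u\<close> entries of \<open>u\<close> itself, so coordinate bounds and coordinatewise
  limits apply to them directly.\<close>

lemma finite_dimensional_coordinates:
  assumes "finite_dimensional_subspace_of E Y"
  shows "\<exists>I b. finite I \<and> (\<forall>i\<in>I. b i \<in> E) \<and> (\<forall>u\<in>E. \<forall>n. u n = (\<Sum>i\<in>I. u i * b i n))"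
proof -
  have E: "subspace_of E Y"
    and ex: "\<exists>S. finite S \<and> S \<subseteq> E \<and> (\<forall>F. subspace_of F Y \<and> S \<subseteq> F \<longrightarrow> E \<subseteq> F)"
    using assms unfolding finite_dimensional_subspace_of_def by (rule conjunct1, rule conjunct2)
  then obtain S where S: "finite S" "S \<subseteq> E"
    and least: "\<forall>F. subspace_of F Y \<and> S \<subseteq> F \<longrightarrow> E \<subseteq> F"
    by (elim exE conjE)
  have lspan_E: "u \<in> E" if "u \<in> lspan S" for u
  proof -
    obtain c where u: "u = (\<lambda>n. \<Sum>s\<in>S. c s * s n)"
      using \<open>u \<in> lspan S\<close> unfolding lspan_def by blast
    show ?thesis
      unfolding u using S by (intro subspace_sum_closed[OF E]) auto
  qed
  have add: "(\<lambda>n. u n + v n) \<in> lspan S" if uv: "u \<in> lspan S" "v \<in> lspan S" for u v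
  proof -
    obtain c where c: "u = (\<lambda>n. \<Sum>s\<in>S. c s * s n)"
      using uv(1) unfolding lspan_def by blast
    obtain d where d: "v = (\<lambda>n. \<Sum>s\<in>S. d s * s n)"
      using uv(2) unfolding lspan_def by blast
    have "(\<lambda>n. u n + v n) = (\<lambda>n. \<Sum>s\<in>S. (c s + d s) * s n)"
      by (simp add: c d distrib_right sum.distrib)
    then show ?thesis
      by (rule lspanI)
  qed
  have scale: "(\<lambda>n. t * u n) \<in> lspan S" if u: "u \<in> lspan S" for t u
  proof -
    obtain c where c: "u = (\<lambda>n. \<Sum>s\<in>S. c s * s n)"
      using u unfolding lspan_def by blast
    have "(\<lambda>n. t * u n) = (\<lambda>n. \<Sum>s\<in>S. (t * c s) * s n)"
      by (simp add: c sum_distrib_left mult.assoc)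
    then show ?thesis
      by (rule lspanI)
  qed
  have gen: "v \<in> lspan S" if "v \<in> S" for v
  proof -
    have "(\<Sum>s\<in>S. (if s = v then 1 else 0) * s n) = (\<Sum>s\<in>S. if s = v then v n else 0)" for n
      by (intro sum.cong) auto
    then have "v n = (\<Sum>s\<in>S. (if s = v then 1 else 0) * s n)" for n
      using S(1) that by simp
    then have "v = (\<lambda>n. \<Sum>s\<in>S. (if s = v then 1 else 0) * s n)"
      by (rule ext)
    then show ?thesis
      by (rule lspanI)
  qed
  have "E \<subseteq> points Y"
    using E unfolding subspace_of_def by (rule conjunct1)
  then have "lspan S \<subseteq> points Y"
    using lspan_E by blast
  moreover have "vzero Y \<in> lspan S"
    by (rule lspanI[of _ "\<lambda>_. 0"]) (simp add: Y_def)
  moreover have "vadd Y u v \<in> lspan S" if "u \<in> lspan S" "v \<in> lspan S" for u v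
    using add[OF that] by (simp add: Y_def)
  moreover have "vscale Y c u \<in> lspan S" if "u \<in> lspan S" for c u
    using scale[OF that] by (simp add: Y_def)
  ultimately have "subspace_of (lspan S) Y"
    unfolding subspace_of_def by blast
  moreover have "S \<subseteq> lspan S"
    using gen by blast
  ultimately have E_lspan: "E \<subseteq> lspan S"
    using least by blast
  obtain I b where Ib: "finite I \<and> (\<forall>i\<in>I. b i \<in> lspan S) \<and>
    (\<forall>i\<in>I. \<forall>j\<in>I. b i j = (if i = j then 1 else 0)) \<and>
    (\<forall>u\<in>lspan S. \<forall>n. u n = (\<Sum>i\<in>I. u i * b i n))"
    using echelon_basis[OF S(1)] by (elim exE)
  note b = Ib[THEN conjunct2, THEN conjunct1]
    and coords = Ib[THEN conjunct2, THEN conjunct2, THEN conjunct2]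
  show ?thesis
  proof (intro exI[of _ I] exI[of _ b] conjI ballI allI)
    show "finite I"
      using Ib by (rule conjunct1)
    show "b i \<in> E" if "i \<in> I" for i
      using bspec[OF b that] by (rule lspan_E)
    show "u n = (\<Sum>i\<in>I. u i * b i n)" if "u \<in> E" for u n
      by (rule spec[OF bspec[OF coords subsetD[OF E_lspan that]]])
  qed
qed

text \<open>Two limits are undone one after the other, each with error \<open>\<delta>\<close> on
  the unit ball: a length \<open>k\<close> with \<open>pnorm {..<k}\<close> close to
  \<open>lnorm\<close>, and for this \<open>k\<close> a row \<open>m\<close>. The Lipschitz constant
  in the second approximation depends on \<open>k\<close>, which is harmless once \<open>k\<close>
  is fixed. Homogeneity extends the estimate to all of \<open>E\<close>.\<close>

lemma almost_isometry:
  assumes fd: "finite_dimensional_subspace_of E Y" and \<delta>: "0 < \<delta>"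
  shows "\<exists>m k. \<forall>u\<in>E. \<bar>norm (comb m {..<k} u) - lnorm u\<bar> \<le> 2 * \<delta> * lnorm u"
proof -
  have E: "subspace_of E Y"
    using fd unfolding finite_dimensional_subspace_of_def by (rule conjunct1)
  have "E \<subseteq> points Y"
    using E unfolding subspace_of_def by (rule conjunct1)
  then have E_pts: "E \<subseteq> pts"
    by (simp add: Y_def)
  have scale: "(\<lambda>n. c * u n) \<in> E" if "u \<in> E" for c u
  proof -
    have "vscale Y c u \<in> E"
      using E that unfolding subspace_of_def by blast
    then show ?thesis
      by (simp add: Y_def)
  qed
  obtain I b where Ib: "finite I \<and> (\<forall>i\<in>I. b i \<in> E) \<and> (\<forall>u\<in>E. \<forall>n. u n = (\<Sum>i\<in>I. u i * b i n))"
    using finite_dimensional_coordinates[OF fd] by (elim exE)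
  note I = Ib[THEN conjunct1] and bE = Ib[THEN conjunct2, THEN conjunct1]
    and coords = Ib[THEN conjunct2, THEN conjunct2]
  have b_pts: "b i \<in> pts" if "i \<in> I" for i
    using bspec[OF bE that] E_pts by blast
  have comb_E: "(\<lambda>n. \<Sum>i\<in>I. c i * b i n) \<in> E" for c
    by (rule subspace_sum_closed[OF E I]) (rule bspec[OF bE])
  note uniform = uniform_on_ball[OF E_pts I b_pts comb_E spec[OF bspec[OF coords]]]
  have "eventually (\<lambda>k. \<forall>u\<in>E. lnorm u \<le> 1 \<longrightarrow> \<bar>pnorm {..<k} u - lnorm u\<bar> \<le> \<delta>) U"
  proof (rule uniform)
    fix k u v assume "u \<in> E" "v \<in> E"
    then have "pnorm {..<k} (\<lambda>i. u i - v i) \<le> B * lnorm (\<lambda>i. u i - v i)"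
      using E_pts by (intro pnorm_le_lnorm pts_diff) auto
    then show "\<bar>pnorm {..<k} u - pnorm {..<k} v\<bar> \<le> B * lnorm (\<lambda>i. u i - v i)"
      using pnorm_diff[of "{..<k}" u v] by linarith
  next
    fix u assume "u \<in> E"
    then show "((\<lambda>k. pnorm {..<k} u) \<longlongrightarrow> lnorm u) U"
      using E_pts by (intro lnorm_tendsto) auto
  qed (use B_pos \<delta> in auto)
  then obtain k where k: "\<And>u. u \<in> E \<Longrightarrow> lnorm u \<le> 1 \<Longrightarrow> \<bar>pnorm {..<k} u - lnorm u\<bar> \<le> \<delta>"
    using eventually_happens'[OF nontrivial] by blast
  have "eventually (\<lambda>m. \<forall>u\<in>E. lnorm u \<le> 1 \<longrightarrow> \<bar>norm (comb m {..<k} u) - pnorm {..<k} u\<bar> \<le> \<delta>) U"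
  proof (rule uniform)
    fix m u v assume uv: "u \<in> E" "v \<in> E"
    have "\<bar>norm (comb m {..<k} u) - norm (comb m {..<k} v)\<bar> \<le> norm (comb m {..<k} (\<lambda>i. u i - v i))"
      by (simp add: comb_diff norm_triangle_ineq3)
    also have "\<dots> \<le> (\<Sum>i<k. norm (u i - v i))"
      by (rule norm_comb_le)
    also have "\<dots> \<le> (\<Sum>i<k. 2 * B * B * lnorm (\<lambda>i. u i - v i))"
      using uv E_pts coordinate_le_lnorm[OF pts_diff] by (intro sum_mono) blast
    also have "\<dots> = (real k * (2 * B * B)) * lnorm (\<lambda>i. u i - v i)"
      by simp
    finally show "\<bar>norm (comb m {..<k} u) - norm (comb m {..<k} v)\<bar>
        \<le> (real k * (2 * B * B)) * lnorm (\<lambda>i. u i - v i)" .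
  qed (use B_pos \<delta> pnorm_tendsto in auto)
  then obtain m where m: "\<And>u. u \<in> E \<Longrightarrow> lnorm u \<le> 1 \<Longrightarrow>
      \<bar>norm (comb m {..<k} u) - pnorm {..<k} u\<bar> \<le> \<delta>"
    using eventually_happens'[OF nontrivial] by blast
  have "\<bar>norm (comb m {..<k} u) - lnorm u\<bar> \<le> 2 * \<delta> * lnorm u" if u: "u \<in> E" for u
  proof (cases "lnorm u = 0")
    case True
    then have "u = (\<lambda>n. 0)"
      using lnorm_eq_0_iff u E_pts by blast
    then show ?thesis
      using True by (simp add: comb_def)
  next
    case False
    then have pos: "0 < lnorm u"
      using lnorm_nonneg[of u] by simp
    define t where "t = 1 / lnorm u"
    have "t > 0"
      using pos by (simp add: t_def)
    define v where "v n = of_real t * u n" for n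
    have v_eq: "v = (\<lambda>n. of_real t * u n)"
      by (simp add: v_def[abs_def])
    have "v \<in> E"
      unfolding v_eq by (rule scale[OF u])
    moreover have "lnorm v = 1"
    proof -
      have "lnorm v = norm (of_real t :: 'k) * lnorm u"
        unfolding v_eq using u E_pts by (intro lnorm_scale) auto
      also have "norm (of_real t :: 'k) = t"
        using \<open>t > 0\<close> by simp
      also have "t * lnorm u = 1"
        using pos by (simp add: t_def)
      finally show ?thesis .
    qed
    moreover have "norm (comb m {..<k} v) = t * norm (comb m {..<k} u)"
      unfolding v_eq comb_scale norm_scale using \<open>t > 0\<close> by simp
    ultimately have v: "v \<in> E" "lnorm v = 1" "norm (comb m {..<k} v) = t * norm (comb m {..<k} u)" .
    then have "\<bar>t * norm (comb m {..<k} u) - 1\<bar> \<le> 2 * \<delta>"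
      using k[of v] m[of v] by linarith
    moreover have "\<bar>norm (comb m {..<k} u) - lnorm u\<bar> = lnorm u * \<bar>t * norm (comb m {..<k} u) - 1\<bar>"
    proof -
      have "lnorm u * (t * norm (comb m {..<k} u) - 1) = norm (comb m {..<k} u) - lnorm u"
        using pos by (simp add: t_def right_diff_distrib)
      then show ?thesis
        using pos by (metis abs_mult abs_of_pos)
    qed
    ultimately show ?thesis
      using pos by (simp add: mult.commute)
  qed
  then show ?thesis
    by blast
qed

lemma finitely_representable_Y: "finitely_representable Y (space_of smul)"
  unfolding finitely_representable_def
proof (intro allI impI, elim conjE)
  fix E and \<epsilon> :: real
  assume fd: "finite_dimensional_subspace_of E Y" and \<epsilon>: "0 < \<epsilon>"
  \<comment> \<open>Small enough for the ratio of \<open>1 + 2 * \<delta>\<close> to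
    \<open>1 - 2 * \<delta>\<close> to be at most \<open>1 + \<epsilon>\<close>.\<close>
  define \<delta> where "\<delta> = min (1 / 8) (\<epsilon> / 8)"
  have \<delta>: "0 < \<delta>" "\<delta> \<le> 1 / 8" "\<delta> \<le> \<epsilon> / 8"
    using \<epsilon> by (auto simp: \<delta>_def)
  obtain m k where mk: "\<And>u. u \<in> E \<Longrightarrow> \<bar>norm (comb m {..<k} u) - lnorm u\<bar> \<le> 2 * \<delta> * lnorm u"
    using almost_isometry[OF fd \<delta>(1)] by blast
  \<comment> \<open>Finite representability asks for a lower bound with constant exactly 1; dilating
    by \<open>t\<close> moves the whole distortion into the upper bound.\<close>
  define t where "t = 1 / (1 - 2 * \<delta>)"
  have t: "0 < t" "t * (1 - 2 * \<delta>) = 1"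
    using \<delta> by (auto simp: t_def)
  have t_le: "t * (1 + 2 * \<delta>) \<le> 1 + \<epsilon>"
  proof -
    have "\<delta> * \<epsilon> \<le> 1 / 8 * \<epsilon>"
      using \<delta> \<epsilon> by (intro mult_right_mono) auto
    moreover have "(1 + \<epsilon>) * (1 - 2 * \<delta>) = 1 + \<epsilon> - 2 * \<delta> - 2 * (\<delta> * \<epsilon>)"
      by (simp add: algebra_simps)
    ultimately have "1 + 2 * \<delta> \<le> (1 + \<epsilon>) * (1 - 2 * \<delta>)"
      using \<delta> \<epsilon> by linarith
    then have "t * (1 + 2 * \<delta>) \<le> t * ((1 + \<epsilon>) * (1 - 2 * \<delta>))"
      using t by simp
    also have "\<dots> = 1 + \<epsilon>"
      using t(2) by (simp add: mult.left_commute)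
    finally show ?thesis .
  qed
  define T where "T u = smul (of_real t) (comb m {..<k} u)" for u
  have "linear_map_on E Y (space_of smul) T"
    unfolding linear_map_on_def
    by (simp add: Y_def space_of_def T_def comb_add comb_scale scale_right_distrib mult.commute)
  moreover have "lnorm u \<le> norm (T u) \<and> norm (T u) \<le> (1 + \<epsilon>) * lnorm u" if u: "u \<in> E" for u
  proof -
    have lo: "(1 - 2 * \<delta>) * lnorm u \<le> norm (comb m {..<k} u)"
      and hi: "norm (comb m {..<k} u) \<le> (1 + 2 * \<delta>) * lnorm u"
      using mk[OF u] by (simp_all add: left_diff_distrib distrib_right abs_le_iff)
    have T: "norm (T u) = t * norm (comb m {..<k} u)"
      using t by (simp add: T_def norm_scale)
    have "lnorm u = t * ((1 - 2 * \<delta>) * lnorm u)"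
      using t(2) by (simp add: mult.assoc[symmetric])
    also have "\<dots> \<le> norm (T u)"
      unfolding T using lo t by simp
    finally have "lnorm u \<le> norm (T u)" .
    moreover have "norm (T u) \<le> t * ((1 + 2 * \<delta>) * lnorm u)"
      unfolding T using hi t by simp
    moreover have "t * ((1 + 2 * \<delta>) * lnorm u) \<le> (1 + \<epsilon>) * lnorm u"
      using mult_right_mono[OF t_le lnorm_nonneg[of u]] by (simp add: mult.assoc)
    ultimately show ?thesis
      by linarith
  qed
  ultimately show "\<exists>T. linear_map_on E Y (space_of smul) T \<and>
      (\<forall>u\<in>E. vnorm Y u \<le> vnorm (space_of smul) (T u) \<and>
             vnorm (space_of smul) (T u) \<le> (1 + \<epsilon>) * vnorm Y u)"
    by (intro exI[of _ T]) (simp add: Y_def space_of_def)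
qed

lemma not_superreflexive: "\<not> superreflexive (space_of smul)"
  using banach_space_Y finitely_representable_Y not_reflexive_Y
  unfolding superreflexive_def by blast

end

text \<open>One sequence is chosen for each length and padded with zeros to form an array. The
  hypotheses compare with the full sum only; applied to coefficients cut off at \<open>l\<close>,
  they give the bounds for initial segments required by \<open>limit_space\<close>.\<close>

lemma not_superreflexive_if_long_basic_sequences:
  fixes smul :: "'k::real_or_complex \<Rightarrow> 'a::banach \<Rightarrow> 'a"
  assumes "scalar_banach smul" and "1 \<le> B"
    and ex: "\<And>m::nat. \<exists>z. (\<forall>i<m. norm (z i) \<le> 1) \<and>
      (\<forall>a. \<forall>k\<le>m. norm (\<Sum>i<k. smul (a i) (z i)) \<le> B * norm (\<Sum>i<m. smul (a i) (z i))) \<and>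
      (\<forall>a. norm (\<Sum>i<m. a i) \<le> B * norm (\<Sum>i<m. smul (a i) (z i)))"
  shows "\<not> superreflexive (space_of smul)"
proof -
  interpret scalar_banach smul by fact
  define Q where "Q m z \<longleftrightarrow> (\<forall>i<m. norm (z i) \<le> 1) \<and>
      (\<forall>a. \<forall>k\<le>m. norm (\<Sum>i<k. smul (a i) (z i)) \<le> B * norm (\<Sum>i<m. smul (a i) (z i))) \<and>
      (\<forall>a. norm (\<Sum>i<m. a i) \<le> B * norm (\<Sum>i<m. smul (a i) (z i)))" for m :: nat and z
  have "\<forall>m. \<exists>z. Q m z"
    unfolding Q_def by (rule allI) (rule ex)
  from choice[OF this] obtain z where z: "\<forall>m. Q m (z m)" ..
  have norm_z: "\<And>m i. i < m \<Longrightarrow> norm (z m i) \<le> 1"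
    and partial: "\<And>m k a. k \<le> m \<Longrightarrow>
      norm (\<Sum>i<k. smul (a i) (z m i)) \<le> B * norm (\<Sum>i<m. smul (a i) (z m i))"
    and total: "\<And>m a. norm (\<Sum>i<m. a i) \<le> B * norm (\<Sum>i<m. smul (a i) (z m i))"
    using z by (simp_all add: Q_def)
  obtain U :: "nat filter" where U: "U \<le> sequentially \<and> U \<noteq> bot \<and>
      (\<forall>P. eventually P U \<or> eventually (\<lambda>n. \<not> P n) U)"
    using ultrafilter_exists[OF sequentially_bot] by (elim exE)
  define y where "y m i = (if i < m then z m i else 0)" for m i
  have y_sum: "(\<Sum>i<k. smul (a i) (y m i)) = (\<Sum>i<k. smul (a i) (z m i))" if "k \<le> m" for k m a
    using that by (intro sum.cong) (auto simp: y_def)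
  have cut1: "(\<Sum>i<m. smul (if i < l then a i else 0) (z m i)) = (\<Sum>i<l. smul (a i) (z m i))"
    if "l \<le> m" for l m a
    by (rule sum.mono_neutral_cong_right) (use that in auto)
  have cut2: "(\<Sum>i<k. smul (if i < l then a i else 0) (z m i)) = (\<Sum>i<k. smul (a i) (z m i))"
    if "k \<le> l" for k l m a
    by (rule sum.cong) (use that in auto)
  have cut3: "(\<Sum>i<m. if i < l then a i else 0) = (\<Sum>i<l. a i)" if "l \<le> m" for l m and a :: "nat \<Rightarrow> 'k"
    by (rule sum.mono_neutral_cong_right) (use that in auto)
  interpret limit_space U smul y B
  proof
    show "norm (y m i) \<le> 1" for m i
      using norm_z by (simp add: y_def)
    show "norm (\<Sum>i<k. smul (a i) (y m i)) \<le> B * norm (\<Sum>i<l. smul (a i) (y m i))"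
      if "k \<le> l" "l \<le> m" for k l m a
      using partial[where k = k and m = m and a = "\<lambda>i. if i < l then a i else 0"] that
      by (simp add: y_sum cut1 cut2)
    show "norm (\<Sum>i<l. a i) \<le> B * norm (\<Sum>i<l. smul (a i) (y m i))" if "l \<le> m" for l m a
      using total[where m = m and a = "\<lambda>i. if i < l then a i else 0"] that
      by (simp add: y_sum cut1 cut3)
  qed (use U assms in auto)
  show ?thesis
    by (rule not_superreflexive)
qed

section \<open>Decreasing blocks\<close>

locale quasi_greedy_system = scalar_banach smul
  for smul :: "'k::real_or_complex \<Rightarrow> 'a::banach \<Rightarrow> 'a" +
  fixes x :: "nat \<Rightarrow> 'a" and xs :: "nat \<Rightarrow> 'a \<Rightarrow> 'k" and C :: real
  assumes xs_add: "xs n (u + v) = xs n u + xs n v"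
    and xs_scale: "xs n (smul c u) = c * xs n u"
    and biorthogonal: "xs n (x k) = (if n = k then 1 else 0)"
    and xs_tendsto: "(\<lambda>n. xs n f) \<longlonglongrightarrow> 0"
    and C_ge_1: "1 \<le> C"
    and greedy_bound: "norm (greedy_sum smul x xs m f) \<le> C * norm f"
begin

section \<open>Greedy projections onto the larger coefficients\<close>

definition lincomb :: "(nat \<Rightarrow> 'k) \<Rightarrow> nat set \<Rightarrow> 'a" where
  "lincomb a A = (\<Sum>n\<in>A. smul (a n) (x n))"

lemma xs_zero: "xs n 0 = 0"
  using xs_scale[of n 0 0] by simp

lemma xs_lincomb: "finite A \<Longrightarrow> xs n (lincomb a A) = (if n \<in> A then a n else 0)"
  by (induction A rule: finite_induct)
    (auto simp: lincomb_def xs_zero xs_add xs_scale biorthogonal)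

lemma lincomb_union:
  "finite A \<Longrightarrow> finite B \<Longrightarrow> A \<inter> B = {} \<Longrightarrow> lincomb a (A \<union> B) = lincomb a A + lincomb a B"
  unfolding lincomb_def by (rule sum.union_disjoint)

lemma lincomb_cong: "(\<And>n. n \<in> A \<Longrightarrow> a n = b n) \<Longrightarrow> lincomb a A = lincomb b A"
  unfolding lincomb_def by (rule sum.cong) auto

lemma lincomb_scale: "lincomb (\<lambda>n. c * a n) A = smul c (lincomb a A)"
  by (simp add: lincomb_def scale_sum_right)

text \<open>Strict inequalities make \<open>P\<close> the greedy set of its size for the vector with
  coefficients \<open>a\<close> on \<open>P \<union> Q\<close>. Nonvanishing on \<open>P\<close>
  separates it from the indices outside \<open>P \<union> Q\<close>, whose coefficients are
  0.\<close>

lemma greedy_split_strict: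
  assumes fin: "finite P" "finite Q" and disj: "P \<inter> Q = {}"
    and less: "\<And>n k. n \<in> P \<Longrightarrow> k \<in> Q \<Longrightarrow> norm (a k) < norm (a n)"
    and nz: "\<And>n. n \<in> P \<Longrightarrow> a n \<noteq> 0"
  shows "norm (lincomb a P) \<le> C * norm (lincomb a P + lincomb a Q)"
proof -
  define f where "f = lincomb a (P \<union> Q)"
  have xs_f: "xs n f = (if n \<in> P \<union> Q then a n else 0)" for n
    using fin by (simp add: f_def xs_lincomb)
  have "norm (xs k f) < norm (xs n f)" if "n \<in> P" "k \<notin> P" for n k
    using that less[of n k] nz[of n] by (cases "k \<in> Q") (simp_all add: xs_f)
  then have "greedy_set_of (\<lambda>n. xs n f) (card P) P"
    using fin by (simp add: greedy_set_of_def)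
  then have "greedy_set (\<lambda>n. xs n f) (card P) = P"
    using greedy_set_of_unique greedy_set_of_greedy_set[OF xs_tendsto] by blast
  then have "greedy_sum smul x xs (card P) f = lincomb a P"
    unfolding greedy_sum_def lincomb_def by (intro sum.cong) (auto simp: xs_f)
  then show ?thesis
    using greedy_bound[of "card P" f] lincomb_union[OF fin disj, of a] by (simp add: f_def)
qed

text \<open>Shrinking the coefficients on \<open>Q\<close> by a factor tending to 1 makes the ties irrelevant.\<close>

lemma greedy_split:
  assumes fin: "finite P" "finite Q" and disj: "P \<inter> Q = {}"
    and le: "\<And>n k. n \<in> P \<Longrightarrow> k \<in> Q \<Longrightarrow> norm (a k) \<le> norm (a n)"
  shows "norm (lincomb a P) \<le> C * norm (lincomb a P + lincomb a Q)"
proof (cases "\<exists>n\<in>P. a n = 0")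
  case True
  then obtain n where n: "n \<in> P" "a n = 0" ..
  have "a k = 0" if "k \<in> Q" for k
    using le[OF n(1) that] n(2) by simp
  then have "lincomb a Q = 0"
    by (simp add: lincomb_def)
  then show ?thesis
    using mult_right_mono[OF C_ge_1, of "norm (lincomb a P)"] by simp
next
  case False
  have bound: "norm (lincomb a P) \<le> C * norm (lincomb a P + lincomb a Q) + t * (C * norm (lincomb a Q))"
    if t: "0 < t" "t < 1" for t
  proof -
    define b where "b n = (if n \<in> Q then of_real (1 - t) * a n else a n)" for n
    have P: "lincomb b P = lincomb a P"
      using disj by (intro lincomb_cong) (auto simp: b_def)
    have "lincomb b Q = lincomb (\<lambda>n. of_real (1 - t) * a n) Q"
      by (intro lincomb_cong) (simp add: b_def)
    then have Q: "lincomb b Q = (1 - t) *\<^sub>R lincomb a Q"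
      by (simp only: lincomb_scale scale_of_real)
    have "norm (b k) < norm (b n)" if nk: "n \<in> P" "k \<in> Q" for n k
    proof -
      have pos: "0 < norm (a n)"
        using False nk by auto
      have b: "norm (b k) = (1 - t) * norm (a k)" "norm (b n) = norm (a n)"
        using nk disj t norm_of_real[of "1 - t", where 'a = 'k] by (auto simp: b_def norm_mult)
      have "(1 - t) * norm (a k) \<le> (1 - t) * norm (a n)"
        using le[OF nk] t by (intro mult_left_mono) auto
      also have "\<dots> < norm (a n)"
        using t pos by simp
      finally show ?thesis
        by (simp add: b)
    qed
    moreover have "b n \<noteq> 0" if "n \<in> P" for n
      using False that disj by (auto simp: b_def)
    ultimately have split: "norm (lincomb b P) \<le> C * norm (lincomb b P + lincomb b Q)"
      using greedy_split_strict[OF fin disj] by blast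
    have eq: "lincomb b P + lincomb b Q = (lincomb a P + lincomb a Q) - t *\<^sub>R lincomb a Q"
      by (simp add: P Q scaleR_left_diff_distrib)
    have "norm (lincomb a P) \<le> C * norm ((lincomb a P + lincomb a Q) - t *\<^sub>R lincomb a Q)"
      using split[unfolded eq] unfolding P .
    also have "\<dots> \<le> C * (norm (lincomb a P + lincomb a Q) + t * norm (lincomb a Q))"
      using norm_triangle_ineq4[of "lincomb a P + lincomb a Q" "t *\<^sub>R lincomb a Q"] t C_ge_1
      by (intro mult_left_mono) auto
    finally have "norm (lincomb a P) \<le> C * (norm (lincomb a P + lincomb a Q) + t * norm (lincomb a Q))" .
    then show ?thesis
      by (simp add: distrib_left mult.left_commute)
  qed
  have "((\<lambda>t. C * norm (lincomb a P + lincomb a Q) + t * (C * norm (lincomb a Q)))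
      \<longlongrightarrow> C * norm (lincomb a P + lincomb a Q) + 0 * (C * norm (lincomb a Q))) (at_right 0)"
    by (intro tendsto_intros)
  moreover have "eventually (\<lambda>t. norm (lincomb a P) \<le>
      C * norm (lincomb a P + lincomb a Q) + t * (C * norm (lincomb a Q))) (at_right (0::real))"
    by (rule eventually_at_rightI[of 0 1]) (use bound in auto)
  ultimately have "norm (lincomb a P)
      \<le> C * norm (lincomb a P + lincomb a Q) + 0 * (C * norm (lincomb a Q))"
    by (rule tendsto_lowerbound) simp
  then show ?thesis
    by simp
qed

text \<open>The order concerns different blocks only. Coefficients within a block are free and
  blocks may be empty, so the notion is stable under merging consecutive blocks and under leaving
  blocks out.\<close>

definition decreasing_blocks :: "(nat \<Rightarrow> 'a) \<Rightarrow> nat \<Rightarrow> bool" where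
  "decreasing_blocks f N \<longleftrightarrow> (\<exists>a A. (\<forall>i<N. finite (A i) \<and> f i = lincomb a (A i)) \<and>
     (\<forall>i<N. \<forall>j<N. i < j \<longrightarrow> A i \<inter> A j = {} \<and> (\<forall>n\<in>A i. \<forall>k\<in>A j. norm (a k) \<le> norm (a n))))"

lemma decreasing_blocksE:
  assumes "decreasing_blocks f N"
  obtains a A where "\<And>i. i < N \<Longrightarrow> finite (A i)" "\<And>i. i < N \<Longrightarrow> f i = lincomb a (A i)"
    "\<And>i j. i < N \<Longrightarrow> j < N \<Longrightarrow> i \<noteq> j \<Longrightarrow> A i \<inter> A j = {}"
    "\<And>i j n k. i < j \<Longrightarrow> j < N \<Longrightarrow> n \<in> A i \<Longrightarrow> k \<in> A j \<Longrightarrow> norm (a k) \<le> norm (a n)"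
proof -
  from assms obtain a A where aA: "\<forall>i<N. finite (A i) \<and> f i = lincomb a (A i)"
    "\<forall>i<N. \<forall>j<N. i < j \<longrightarrow> A i \<inter> A j = {} \<and> (\<forall>n\<in>A i. \<forall>k\<in>A j. norm (a k) \<le> norm (a n))"
    unfolding decreasing_blocks_def by (elim exE conjE)
  show ?thesis
  proof (rule that)
    have disj: "A i \<inter> A j = {}" if "i < N" "j < N" "i < j" for i j
      using aA(2)[rule_format, OF that] by (rule conjunct1)
    show "A i \<inter> A j = {}" if "i < N" "j < N" "i \<noteq> j" for i j
      using disj[of i j] disj[of j i] that by (cases "i < j") (simp_all add: Int_commute)
    show "norm (a k) \<le> norm (a n)" if "i < j" "j < N" "n \<in> A i" "k \<in> A j" for i j n k
      using aA(2) that less_trans[OF that(1,2)] by blast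
  qed (use aA(1) in auto)
qed

lemma decreasing_blocksI:
  assumes "\<And>i. i < N \<Longrightarrow> finite (A i)" "\<And>i. i < N \<Longrightarrow> f i = lincomb a (A i)"
    "\<And>i j. i < j \<Longrightarrow> j < N \<Longrightarrow> A i \<inter> A j = {}"
    "\<And>i j n k. i < j \<Longrightarrow> j < N \<Longrightarrow> n \<in> A i \<Longrightarrow> k \<in> A j \<Longrightarrow> norm (a k) \<le> norm (a n)"
  shows "decreasing_blocks f N"
  unfolding decreasing_blocks_def
  by (intro exI[of _ a] exI[of _ A] conjI allI impI ballI) (simp_all add: assms)

lemma sum_lincomb:
  assumes "finite J" "\<And>i. i \<in> J \<Longrightarrow> finite (A i)"
    "\<And>i j. i \<in> J \<Longrightarrow> j \<in> J \<Longrightarrow> i \<noteq> j \<Longrightarrow> A i \<inter> A j = {}"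
  shows "(\<Sum>i\<in>J. lincomb a (A i)) = lincomb a (\<Union>i\<in>J. A i)"
  unfolding lincomb_def using assms by (intro sum.UNION_disjoint[symmetric]) auto

lemma decreasing_blocks_group:
  assumes f: "decreasing_blocks f N"
    and J: "\<And>i. i < M \<Longrightarrow> J i \<subseteq> {..<N}"
    and less: "\<And>i i' j j'. i < i' \<Longrightarrow> i' < M \<Longrightarrow> j \<in> J i \<Longrightarrow> j' \<in> J i' \<Longrightarrow> j < j'"
  shows "decreasing_blocks (\<lambda>i. \<Sum>j\<in>J i. f j) M"
proof -
  obtain a A where aA: "\<And>i. i < N \<Longrightarrow> finite (A i)" "\<And>i. i < N \<Longrightarrow> f i = lincomb a (A i)"
    "\<And>i j. i < N \<Longrightarrow> j < N \<Longrightarrow> i \<noteq> j \<Longrightarrow> A i \<inter> A j = {}"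
    "\<And>i j n k. i < j \<Longrightarrow> j < N \<Longrightarrow> n \<in> A i \<Longrightarrow> k \<in> A j \<Longrightarrow> norm (a k) \<le> norm (a n)"
    by (rule decreasing_blocksE[OF f]) blast
  have J_less: "j < N" if "i < M" "j \<in> J i" for i j
    using J that by blast
  have fin: "finite (J i)" if "i < M" for i
    using finite_subset[OF J[OF that]] by simp
  show ?thesis
  proof (rule decreasing_blocksI[where a = a and A = "\<lambda>i. \<Union>j\<in>J i. A j"])
    fix i assume i: "i < M"
    show "finite (\<Union>j\<in>J i. A j)"
      using fin[OF i] aA(1) J_less[OF i] by simp
    have "(\<Sum>j\<in>J i. f j) = (\<Sum>j\<in>J i. lincomb a (A j))"
      using aA(2) J_less[OF i] by simp
    also have "\<dots> = lincomb a (\<Union>j\<in>J i. A j)"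
      using J_less[OF i] by (intro sum_lincomb fin i aA(1,3)) auto
    finally show "(\<Sum>j\<in>J i. f j) = lincomb a (\<Union>j\<in>J i. A j)" .
  next
    fix i i' assume i: "i < i'" "i' < M"
    then have "i < M"
      by simp
    have "A j \<inter> A j' = {}" if "j \<in> J i" "j' \<in> J i'" for j j'
      using less[OF i that] J_less[OF \<open>i < M\<close> that(1)] J_less[OF i(2) that(2)]
      by (intro aA(3)) simp_all
    then show "(\<Union>j\<in>J i. A j) \<inter> (\<Union>j\<in>J i'. A j) = {}"
      by blast
    fix n k assume "n \<in> (\<Union>j\<in>J i. A j)" "k \<in> (\<Union>j\<in>J i'. A j)"
    then obtain j j' where j: "j \<in> J i" "n \<in> A j" "j' \<in> J i'" "k \<in> A j'"
      by blast
    then show "norm (a k) \<le> norm (a n)"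
      using less[OF i j(1,3)] J_less[OF i(2) j(3)] by (intro aA(4)[of j j'])
  qed
qed

lemma decreasing_blocks_scale:
  assumes f: "decreasing_blocks f N"
    and b: "\<And>i j. i < j \<Longrightarrow> j < N \<Longrightarrow> norm (b j) \<le> norm (b i)"
  shows "decreasing_blocks (\<lambda>i. smul (b i) (f i)) N"
proof -
  obtain a A where aA: "\<And>i. i < N \<Longrightarrow> finite (A i)" "\<And>i. i < N \<Longrightarrow> f i = lincomb a (A i)"
    "\<And>i j. i < N \<Longrightarrow> j < N \<Longrightarrow> i \<noteq> j \<Longrightarrow> A i \<inter> A j = {}"
    "\<And>i j n k. i < j \<Longrightarrow> j < N \<Longrightarrow> n \<in> A i \<Longrightarrow> k \<in> A j \<Longrightarrow> norm (a k) \<le> norm (a n)"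
    by (rule decreasing_blocksE[OF f]) blast
  \<comment> \<open>The supports are disjoint, so at most one summand survives and the block scalars
    combine into a single coefficient function.\<close>
  define c where "c n = (\<Sum>i<N. if n \<in> A i then b i else 0) * a n" for n
  have c: "c n = b i * a n" if "i < N" "n \<in> A i" for i n
  proof -
    have "(\<Sum>j<N. if n \<in> A j then b j else 0) = (\<Sum>j<N. if j = i then b i else 0)"
      using aA(3) that by (intro sum.cong) auto
    then show ?thesis
      using that by (simp add: c_def)
  qed
  show ?thesis
  proof (rule decreasing_blocksI[where a = c and A = A])
    fix i assume i: "i < N"
    then show "finite (A i)"
      by (rule aA(1))
    have "lincomb c (A i) = lincomb (\<lambda>n. b i * a n) (A i)"
      using c[OF i] by (intro lincomb_cong) auto
    then show "smul (b i) (f i) = lincomb c (A i)"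
      using aA(2)[OF i] by (simp add: lincomb_scale)
  next
    fix i j assume ij: "i < j" "j < N"
    then show "A i \<inter> A j = {}"
      by (intro aA(3)) auto
    fix n k assume nk: "n \<in> A i" "k \<in> A j"
    then have "norm (b j) * norm (a k) \<le> norm (b i) * norm (a n)"
      using ij aA(4) b by (intro mult_mono) auto
    then show "norm (c k) \<le> norm (c n)"
      using ij nk by (simp add: c[of j] c[of i] norm_mult)
  qed
qed

lemma decreasing_blocks_partial:
  assumes f: "decreasing_blocks f N" and k: "k \<le> N"
  shows "norm (\<Sum>i<k. f i) \<le> C * norm (\<Sum>i<N. f i)"
proof -
  obtain a A where aA: "\<And>i. i < N \<Longrightarrow> finite (A i)" "\<And>i. i < N \<Longrightarrow> f i = lincomb a (A i)"
    "\<And>i j. i < N \<Longrightarrow> j < N \<Longrightarrow> i \<noteq> j \<Longrightarrow> A i \<inter> A j = {}"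
    "\<And>i j n k. i < j \<Longrightarrow> j < N \<Longrightarrow> n \<in> A i \<Longrightarrow> k \<in> A j \<Longrightarrow> norm (a k) \<le> norm (a n)"
    by (rule decreasing_blocksE[OF f]) blast
  have sum_f: "(\<Sum>i\<in>J. f i) = lincomb a (\<Union>i\<in>J. A i)" if "J \<subseteq> {..<N}" for J
  proof -
    have "(\<Sum>i\<in>J. f i) = (\<Sum>i\<in>J. lincomb a (A i))"
      using that by (intro sum.cong) (auto intro!: aA(2))
    also have "\<dots> = lincomb a (\<Union>i\<in>J. A i)"
      using that finite_subset[OF that] by (intro sum_lincomb aA(1,3)) auto
    finally show ?thesis .
  qed
  have P: "(\<Sum>i<k. f i) = lincomb a (\<Union>i<k. A i)"
    and Q: "(\<Sum>i=k..<N. f i) = lincomb a (\<Union>i\<in>{k..<N}. A i)"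
    using k by (auto intro!: sum_f)
  have "norm (lincomb a (\<Union>i<k. A i)) \<le>
      C * norm (lincomb a (\<Union>i<k. A i) + lincomb a (\<Union>i\<in>{k..<N}. A i))"
  proof (rule greedy_split)
    show "(\<Union>i<k. A i) \<inter> (\<Union>i\<in>{k..<N}. A i) = {}"
    proof -
      have "A i \<inter> A j = {}" if "i < k" "k \<le> j" "j < N" for i j
        using that by (intro aA(3)) auto
      then show ?thesis
        by force
    qed
    show "norm (a m) \<le> norm (a n)" if nm: "n \<in> (\<Union>i<k. A i)" "m \<in> (\<Union>i\<in>{k..<N}. A i)" for n m
    proof -
      obtain i j where "i < k" "n \<in> A i" "k \<le> j" "j < N" "m \<in> A j"
        using nm by auto
      then show ?thesis
        using aA(4)[of i j n m] by simp
    qed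
  qed (use k aA(1) in auto)
  moreover have "(\<Sum>i<N. f i) = (\<Sum>i<k. f i) + (\<Sum>i=k..<N. f i)"
    using k by (simp add: lessThan_atLeast0 sum.atLeastLessThan_concat)
  ultimately show ?thesis
    by (simp add: P Q)
qed

text \<open>The blocks outside \<open>J\<close> contribute at most their number, so the defect
  \<open>\<epsilon>\<close> of the full sum bounds the defect of every subfamily.\<close>

lemma norm_block_sum_ge:
  assumes f: "\<And>i. i < N \<Longrightarrow> norm (f i) \<le> 1" and sum: "real N - \<epsilon> < norm (\<Sum>i<N. f i)"
    and J: "J \<subseteq> {..<N}"
  shows "real (card J) - \<epsilon> \<le> norm (\<Sum>j\<in>J. f j)"
proof -
  have "norm (\<Sum>j\<in>{..<N} - J. f j) \<le> of_nat (card ({..<N} - J)) * 1"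
    by (rule order_trans[OF norm_sum sum_bounded_above]) (simp add: f)
  moreover have "card ({..<N} - J) = N - card J" "card J \<le> N"
    using J card_Diff_subset[of J "{..<N}"] finite_subset[OF J] card_mono[OF _ J] by auto
  moreover have "(\<Sum>i<N. f i) = (\<Sum>j\<in>{..<N} - J. f j) + (\<Sum>j\<in>J. f j)"
    using J by (simp add: sum.subset_diff)
  ultimately show ?thesis
    using sum norm_triangle_ineq[of "\<Sum>j\<in>{..<N} - J. f j" "\<Sum>j\<in>J. f j"] by (simp add: of_nat_diff)
qed

text \<open>
  With \<open>n = N A\<close>, the sum of the vectors \<open>n f\<^sub>j\<close> is almost as long as possible, so it cannot be
  shortened much by subtracting the vectors \<open>b\<^sub>j f\<^sub>j\<close>, whatever the directions of the \<open>b\<^sub>j\<close>.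
\<close>

lemma norm_sum_coefficients_le:
  assumes f: "\<And>i. i < N \<Longrightarrow> norm (f i) \<le> 1"
    and sum: "real N - 1 / (2 * real N) < norm (\<Sum>i<N. f i)"
    and J: "J \<subseteq> {..<N}" and A: "0 \<le> A" and b: "\<And>j. j \<in> J \<Longrightarrow> norm (b j) \<le> A"
  shows "norm (\<Sum>j\<in>J. b j) \<le> norm (\<Sum>j\<in>J. smul (b j) (f j)) + A"
proof (cases "(\<Sum>j\<in>J. b j) = 0 \<or> A = 0 \<or> N = 0")
  case True
  then consider "(\<Sum>j\<in>J. b j) = 0" | "A = 0" | "N = 0"
    by blast
  then have "(\<Sum>j\<in>J. b j) = 0"
  proof cases
    case 2
    then show ?thesis
      using b by (intro sum.neutral) auto
  qed (use J in auto)
  then show ?thesis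
    using A by simp
next
  case False
  define s where "s = (\<Sum>j\<in>J. b j)"
  \<comment> \<open>A rotation that makes the sum of the coefficients a positive real number, so
    that it equals the sum of real parts.\<close>
  define d where "d = of_real (norm s) / s"
  define n where "n = real N * A"
  have s: "s \<noteq> 0" and n: "0 < n" "0 < real N" "0 < A"
    using False A by (auto simp: s_def n_def)
  have d: "norm d = 1"
    using s by (simp add: d_def norm_divide)
  obtain \<phi> :: "'k \<Rightarrow> complex"
    where \<phi>: "\<And>a b. \<phi> (a + b) = \<phi> a + \<phi> b" "\<And>a. norm (\<phi> a) = norm a"
      "\<And>r. \<phi> (of_real r) = of_real r"
    using real_or_complex_embedding by metis
  have \<phi>_0: "\<phi> 0 = 0"
    using \<phi>(3)[of 0] by simp
  have \<phi>_diff: "\<phi> (a - b) = \<phi> a - \<phi> b" for a b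
    using \<phi>(1)[of "a - b" b] by simp
  have \<phi>_sum: "\<phi> (\<Sum>j\<in>J. a j) = (\<Sum>j\<in>J. \<phi> (a j))" for a
    using finite_subset[OF J] by (induction J rule: finite_induct) (simp_all add: \<phi>_0 \<phi>(1))
  define e where "e j = d * b j" for j
  have e: "norm (e j) \<le> A" if "j \<in> J" for j
    using b[OF that] d by (simp add: e_def norm_mult)
  have sum_e: "(\<Sum>j\<in>J. e j) = of_real (norm s)"
  proof -
    have "(\<Sum>j\<in>J. e j) = d * s"
      by (simp add: e_def s_def sum_distrib_left)
    then show ?thesis
      using s by (simp add: d_def)
  qed
  have smul_e: "(\<Sum>j\<in>J. smul (e j) (f j)) = smul d (\<Sum>j\<in>J. smul (b j) (f j))"
    by (simp add: e_def scale_sum_right)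
  \<comment> \<open>Far out on the real axis the modulus is nearly linear: |n - w| is at most n - Re
    w + |w|^2 / (2 n). With |w| at most A and n = N A, the error is A / (2 N).\<close>
  have pointwise: "norm (of_real n - e j) \<le> n - Re (\<phi> (e j)) + A / (2 * real N)" if j: "j \<in> J" for j
  proof -
    define w where "w = \<phi> (e j)"
    define r where "r = cmod (of_real n - w)"
    have "norm (of_real n - e j) = r"
      using \<phi>(2)[of "of_real n - e j"] by (simp add: \<phi>_diff \<phi>(3) r_def w_def)
    moreover have "r\<^sup>2 = n\<^sup>2 - 2 * n * Re w + (cmod w)\<^sup>2"
      unfolding r_def cmod_power2 by (simp add: power2_eq_square algebra_simps)
    moreover have "2 * (n * r) \<le> n\<^sup>2 + r\<^sup>2"
      using sum_squares_bound[of n r] by (simp add: mult.assoc)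
    moreover have "(cmod w)\<^sup>2 \<le> A\<^sup>2"
      using e[OF j] \<phi>(2)[of "e j"] by (intro power_mono) (auto simp: w_def)
    ultimately have "2 * (n * norm (of_real n - e j)) \<le> 2 * n\<^sup>2 - 2 * n * Re w + A\<^sup>2"
      by simp
    also have "\<dots> = 2 * (n * (n - Re w + A / (2 * real N)))"
      using n by (simp add: n_def power2_eq_square algebra_simps)
    finally show ?thesis
      using n by (simp add: w_def)
  qed
  have "real (card J) - 1 / (2 * real N) \<le> norm (\<Sum>j\<in>J. f j)"
    using norm_block_sum_ge[OF f sum J] .
  then have "n * (real (card J) - 1 / (2 * real N)) \<le> n * norm (\<Sum>j\<in>J. f j)"
    using n by (intro mult_left_mono) auto
  also have "\<dots> = norm (smul (of_real n) (\<Sum>j\<in>J. f j))"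
    using n by (simp add: norm_scale)
  also have "smul (of_real n) (\<Sum>j\<in>J. f j) = (\<Sum>j\<in>J. smul (of_real n - e j) (f j)) + (\<Sum>j\<in>J. smul (e j) (f j))"
    by (simp add: scale_sum_right sum.distrib[symmetric] scale_left_distrib[symmetric])
  also have "norm \<dots> \<le> norm (\<Sum>j\<in>J. smul (of_real n - e j) (f j)) + norm (\<Sum>j\<in>J. smul (e j) (f j))"
    by (rule norm_triangle_ineq)
  also have "norm (\<Sum>j\<in>J. smul (of_real n - e j) (f j)) \<le> (\<Sum>j\<in>J. n - Re (\<phi> (e j)) + A / (2 * real N))"
  proof (rule order_trans[OF norm_sum], rule sum_mono)
    fix j assume j: "j \<in> J"
    then have "norm (f j) \<le> 1"
      using J f by auto
    then have "norm (of_real n - e j) * norm (f j) \<le> norm (of_real n - e j)"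
      by (simp add: mult_left_le)
    then show "norm (smul (of_real n - e j) (f j)) \<le> n - Re (\<phi> (e j)) + A / (2 * real N)"
      using pointwise[OF j] by (simp add: norm_scale)
  qed
  also have "(\<Sum>j\<in>J. n - Re (\<phi> (e j)) + A / (2 * real N))
      = real (card J) * n - norm s + real (card J) * (A / (2 * real N))"
  proof -
    have "(\<Sum>j\<in>J. Re (\<phi> (e j))) = Re (\<phi> (\<Sum>j\<in>J. e j))"
      by (simp add: \<phi>_sum)
    also have "\<dots> = norm s"
      by (simp add: sum_e \<phi>(3))
    finally show ?thesis
      by (simp add: sum.distrib sum_subtractf)
  qed
  also have "norm (\<Sum>j\<in>J. smul (e j) (f j)) = norm (\<Sum>j\<in>J. smul (b j) (f j))"
    by (simp add: smul_e norm_scale d)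
  \<comment> \<open>The pointwise errors and the defect of the block sum, multiplied by
    \<open>n\<close>, account for at most \<open>A / 2\<close> each.\<close>
  finally have "norm s \<le> norm (\<Sum>j\<in>J. smul (b j) (f j)) + real (card J) * (A / (2 * real N)) + n / (2 * real N)"
    by (simp add: algebra_simps)
  moreover have "n / (2 * real N) = A / 2"
    using n by (simp add: n_def)
  moreover have "real (card J) * (A / (2 * real N)) \<le> real N * (A / (2 * real N))"
    using card_mono[OF _ J] A by (intro mult_right_mono) auto
  moreover have "real N * (A / (2 * real N)) = A / 2"
    using n by simp
  ultimately show ?thesis
    by (simp add: s_def)
qed

text \<open>All errors are measured by the largest modulus \<open>A\<close> of the coefficients of
  the averages \<open>z i\<close>. Once \<open>A\<close> is bounded by \<open>8 * C\<close> times
  the norm of the combination, both required estimates follow with a constant that does not depend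
  on \<open>m\<close>.\<close>

lemma not_superreflexive_if_long_blocks:
  assumes ex: "\<And>N \<epsilon>. 2 \<le> N \<Longrightarrow> 0 < \<epsilon> \<Longrightarrow>
    \<exists>f. decreasing_blocks f N \<and> (\<forall>i<N. norm (f i) \<le> 1) \<and> real N - \<epsilon> < norm (\<Sum>i<N. f i)"
  shows "\<not> superreflexive (space_of smul)"
proof (rule not_superreflexive_if_long_basic_sequences)
  show "scalar_banach smul"
    by unfold_locales
  show "1 \<le> 1 + 8 * C"
    using C_ge_1 by simp
  fix m :: nat
  show "\<exists>z. (\<forall>i<m. norm (z i) \<le> 1) \<and>
      (\<forall>a. \<forall>k\<le>m. norm (\<Sum>i<k. smul (a i) (z i)) \<le> (1 + 8 * C) * norm (\<Sum>i<m. smul (a i) (z i))) \<and>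
      (\<forall>a. norm (\<Sum>i<m. a i) \<le> (1 + 8 * C) * norm (\<Sum>i<m. smul (a i) (z i)))"
  proof (cases "m = 0")
    case True
    then show ?thesis
      by simp
  next
    case False
    \<comment> \<open>Chosen so that \<open>m\<close> errors of size \<open>A / real R\<close> add
      up to at most \<open>A / (8 * C)\<close>.\<close>
    define R where "R = nat \<lceil>8 * C * real m\<rceil> + 2"
    have R: "2 \<le> R" "8 * C * real m \<le> real R"
      unfolding R_def by linarith+
    define N where "N = R ^ m"
    have N: "2 \<le> N"
      using R False power_increasing[of 1 m R] by (simp add: N_def)
    obtain f where f: "decreasing_blocks f N" and norm_f: "\<And>i. i < N \<Longrightarrow> norm (f i) \<le> 1"
      and sum_f: "real N - 1 / (2 * real N) < norm (\<Sum>i<N. f i)"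
      using ex[of N "1 / (2 * real N)"] N by auto
    \<comment> \<open>Consecutive groups whose sizes grow exactly by the factor \<open>R\<close>;
      those with \<open>i < m\<close> lie below \<open>N = R ^ m\<close>.\<close>
    define I where "I i = {R ^ i..<R ^ Suc i}" for i
    define M where "M i = real (card (I i))" for i
    have M: "M i = real R ^ i * (real R - 1)" for i
      using R by (simp add: M_def I_def of_nat_diff algebra_simps)
    have M_ge_1: "1 \<le> M i" for i
      using R one_le_power[of "real R" i] mult_mono[of 1 "real R ^ i" 1 "real R - 1"] by (simp add: M)
    have M_less: "real R * M i \<le> M j" if "i < j" for i j
    proof -
      have "real R ^ Suc i \<le> real R ^ j"
        using that R by (intro power_increasing) auto
      then show ?thesis
        using R mult_right_mono[of "real R ^ Suc i" "real R ^ j" "real R - 1"] by (simp add: M mult.assoc)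
    qed
    have I_N: "I i \<subseteq> {..<N}" if "i < m" for i
      using that R power_increasing[of "Suc i" m R] by (auto simp: I_def N_def)
    have I_less: "j < j'" if "i < i'" "j \<in> I i" "j' \<in> I i'" for i i' j j'
      using that R power_increasing[of "Suc i" i' R] by (auto simp: I_def)
    define g where "g i = (\<Sum>j\<in>I i. f j)" for i
    define z where "z i = smul (of_real (1 / M i)) (g i)" for i
    have g_z: "g i = smul (of_real (M i)) (z i)" for i
      using M_ge_1[of i] by (simp add: z_def)
    have norm_g: "norm (g i) = M i * norm (z i)" for i
      using M_ge_1[of i] by (simp add: g_z norm_scale)
    have norm_z: "norm (z i) \<le> 1" if "i < m" for i
    proof -
      have "norm (g i) \<le> of_nat (card (I i)) * 1"
        unfolding g_def using I_N[OF that]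
        by (intro order_trans[OF norm_sum sum_bounded_above]) (auto intro: norm_f)
      then have "M i * norm (z i) \<le> M i * 1"
        by (simp only: norm_g M_def)
      then show ?thesis
        using M_ge_1[of i] by simp
    qed
    \<comment> \<open>A group has at least one element and a defect of at most 1/2, so averaging
      leaves at least half of the maximal norm.\<close>
    have norm_z_ge: "1 / 2 \<le> norm (z i)" if "i < m" for i
    proof -
      have "M i - 1 / (2 * real N) \<le> norm (g i)"
        unfolding g_def M_def by (rule norm_block_sum_ge[OF norm_f sum_f I_N[OF that]])
      moreover have "1 / (2 * real N) \<le> 1 / 2"
        using N by (simp add: field_simps)
      ultimately have "M i * (1 / 2) \<le> M i * norm (z i)"
        using M_ge_1[of i] norm_g[of i] by linarith
      then show ?thesis
        using M_ge_1[of i] by simp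
    qed
    have g: "decreasing_blocks g m"
      unfolding g_def by (rule decreasing_blocks_group[OF f I_N]) (auto intro: I_less)
    have main: "(\<forall>k\<le>m. norm (\<Sum>i<k. smul (a i) (z i)) \<le> (1 + 8 * C) * norm (\<Sum>i<m. smul (a i) (z i))) \<and>
      norm (\<Sum>i<m. a i) \<le> (1 + 8 * C) * norm (\<Sum>i<m. smul (a i) (z i))" for a
    proof -
      define Z where "Z k = (\<Sum>i<k. smul (a i) (z i))" for k
      define A where "A = Max ((\<lambda>i. norm (a i)) ` {..<m})"
      have "A \<in> (\<lambda>i. norm (a i)) ` {..<m}"
        unfolding A_def using False by (intro Max_in) auto
      then obtain s where s: "s < m" "norm (a s) = A"
        by auto
      have A: "norm (a i) \<le> A" if "i < m" for i
        unfolding A_def using that by (intro Max_ge) auto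
      have A0: "0 \<le> A"
        using s(2) norm_ge_zero[of "a s"] by simp
      define \<tau> where "\<tau> i = norm (a i) / M i" for i
      \<comment> \<open>The least nonincreasing majorant of \<open>\<tau>\<close> on the indices
        below \<open>m\<close>.\<close>
      define \<sigma> where "\<sigma> i = Max (\<tau> ` {i..<m})" for i
      \<comment> \<open>The direction of \<open>a i\<close> is kept and only its modulus is raised;
        a zero coefficient gets the direction 1.\<close>
      define b where "b i = (if a i = 0 then of_real (\<sigma> i) else a i / of_real (norm (a i)) * of_real (\<sigma> i))" for i
      have \<tau>_M: "\<tau> i * M i = norm (a i)" for i
        using M_ge_1[of i] by (simp add: \<tau>_def)
      have \<sigma>_ge: "\<tau> j \<le> \<sigma> i" if "i \<le> j" "j < m" for i j
        unfolding \<sigma>_def using that by (intro Max_ge) auto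
      have \<sigma>_in: "\<exists>j. i \<le> j \<and> j < m \<and> \<sigma> i = \<tau> j" if "i < m" for i
      proof -
        have "\<sigma> i \<in> \<tau> ` {i..<m}"
          unfolding \<sigma>_def using that by (intro Max_in) auto
        then show ?thesis
          by auto
      qed
      have \<sigma>_mono: "\<sigma> j \<le> \<sigma> i" if "i < j" "j < m" for i j
        using \<sigma>_in[OF that(2)] \<sigma>_ge[of i] that by auto
      have \<sigma>_nonneg: "0 \<le> \<sigma> i" if "i < m" for i
        using \<sigma>_ge[of i i] that M_ge_1[of i] by (auto simp: \<tau>_def intro: order_trans[rotated])
      have norm_b: "norm (b i) = \<sigma> i" if "i < m" for i
        using \<sigma>_nonneg[OF that] by (simp add: b_def norm_mult norm_divide)
      \<comment> \<open>If the maximum is attained at some \<open>j > i\<close>, then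
        \<open>M i * \<tau> j\<close> is \<open>norm (a j)\<close> times \<open>M i / M j\<close>,
        and the latter quotient is at most \<open>1 / real R\<close>.\<close>
      have raise: "M i * (\<sigma> i - \<tau> i) \<le> A / real R" if i: "i < m" for i
      proof -
        obtain j where j: "i \<le> j" "j < m" "\<sigma> i = \<tau> j"
          using \<sigma>_in[OF i] by blast
        show ?thesis
        proof (cases "i = j")
          case True
          then show ?thesis
            using j A0 R by simp
        next
          case False
          have "M i * \<tau> j = M i * norm (a j) / M j"
            by (simp add: \<tau>_def)
          also have "\<dots> \<le> M i * A / (real R * M i)"
            using M_less[of i j] False j A[OF j(2)] M_ge_1[of i] M_ge_1[of j] R A0
            by (intro frac_le mult_left_mono) auto
          also have "\<dots> = A / real R"
            using M_ge_1[of i] by simp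
          finally have "M i * \<tau> j \<le> A / real R" .
          moreover have "0 \<le> M i * \<tau> i"
            using \<tau>_M[of i] by (simp add: mult.commute)
          ultimately show ?thesis
            by (simp add: j right_diff_distrib)
        qed
      qed
      have a_b: "norm (a i - b i * of_real (M i)) = M i * (\<sigma> i - \<tau> i)" if i: "i < m" for i
      proof (cases "a i = 0")
        case True
        then show ?thesis
          using \<sigma>_nonneg[OF i] M_ge_1[of i] by (simp add: b_def \<tau>_def norm_mult)
      next
        case False
        have "a i = a i / of_real (norm (a i)) * of_real (\<tau> i * M i)"
          unfolding \<tau>_M using False by simp
        then have "a i - b i * of_real (M i) = a i / of_real (norm (a i)) * of_real (M i * (\<tau> i - \<sigma> i))"
          using False by (simp add: b_def algebra_simps)
        then have "norm (a i - b i * of_real (M i)) = \<bar>M i * (\<tau> i - \<sigma> i)\<bar>"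
          using False by (simp add: norm_mult norm_divide flip: of_real_mult of_real_diff)
        then show ?thesis
          using \<sigma>_ge[of i i] i M_ge_1[of i] by (simp add: abs_mult)
      qed
      define G where "G k = (\<Sum>i<k. smul (b i) (g i))" for k
      have "decreasing_blocks (\<lambda>i. smul (b i) (g i)) m"
        by (rule decreasing_blocks_scale[OF g]) (simp add: norm_b \<sigma>_mono)
      then have G: "norm (G k) \<le> C * norm (G m)" if "k \<le> m" for k
        unfolding G_def using that by (rule decreasing_blocks_partial)
      have Z_G: "norm (Z k - G k) \<le> A / (8 * C)" if k: "k \<le> m" for k
      proof -
        have "Z k - G k = (\<Sum>i<k. smul (a i - b i * of_real (M i)) (z i))"
          unfolding Z_def G_def by (simp add: sum_subtractf[symmetric] scale_left_diff_distrib g_z)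
        also have "norm \<dots> \<le> (\<Sum>i<k. A / real R)"
        proof (rule order_trans[OF norm_sum], rule sum_mono)
          fix i assume "i \<in> {..<k}"
          then have i: "i < m"
            using k by simp
          have "norm (a i - b i * of_real (M i)) * norm (z i) \<le> A / real R * 1"
            using raise[OF i] norm_z[OF i] A0 by (intro mult_mono) (simp_all add: a_b[OF i])
          then show "norm (smul (a i - b i * of_real (M i)) (z i)) \<le> A / real R"
            by (simp add: norm_scale)
        qed
        also have "\<dots> \<le> real m * (A / real R)"
          using k A0 by (simp add: mult_right_mono divide_right_mono)
        also have "\<dots> \<le> A / (8 * C)"
        proof -
          have "A * (8 * C * real m) \<le> A * real R"
            using R A0 by (intro mult_left_mono)
          then show ?thesis
            using C_ge_1 R by (simp add: field_simps)
        qed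
        finally show ?thesis .
      qed
      define W where "W = norm (Z m)"
      have CA: "C * (A / (8 * C)) = A / 8"
        using C_ge_1 by simp
      have A8: "A / (8 * C) \<le> A / 8"
        using C_ge_1 A0 by (intro divide_left_mono) auto
      have "norm (G m) \<le> W + A / (8 * C)"
        using Z_G[of m] norm_triangle_ineq3[of "Z m" "G m"] by (simp add: W_def)
      then have "C * norm (G m) \<le> C * (W + A / (8 * C))"
        using C_ge_1 by (intro mult_left_mono) auto
      then have CG: "C * norm (G m) \<le> C * W + A / 8"
        by (simp only: distrib_left CA)
      \<comment> \<open>The block at \<open>s\<close> has norm at least \<open>A / 2\<close> and is
        a difference of two partial sums, hence at most \<open>2 * (C * norm (G m))\<close>. Since
        \<open>C * norm (G m)\<close> is at most \<open>C * W + A / 8\<close>, the resulting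
        \<open>A / 4\<close> is absorbed on the left.\<close>
      have "A * (1 / 2) \<le> (\<sigma> s * M s) * norm (z s)"
      proof (rule mult_mono)
        have "\<tau> s * M s \<le> \<sigma> s * M s"
          using \<sigma>_ge[of s s] s M_ge_1[of s] by (intro mult_right_mono) auto
        then show "A \<le> \<sigma> s * M s"
          by (simp add: \<tau>_M s)
        then show "0 \<le> \<sigma> s * M s"
          using A0 by simp
      qed (use norm_z_ge[OF s(1)] in auto)
      also have "\<dots> = norm (G (Suc s) - G s)"
        by (simp add: G_def norm_scale norm_b[OF s(1)] norm_g)
      also have "\<dots> \<le> norm (G (Suc s)) + norm (G s)"
        by (rule norm_triangle_ineq4)
      also have "\<dots> \<le> 2 * (C * norm (G m))"
        using G[of s] G[of "Suc s"] s by simp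
      finally have AW: "A \<le> 8 * C * W"
        using CG by simp
      have "norm (Z k) \<le> (1 + 8 * C) * W" if k: "k \<le> m" for k
      proof -
        have "norm (Z k) \<le> norm (G k) + A / (8 * C)"
          using Z_G[OF k] norm_triangle_ineq3[of "Z k" "G k"] by simp
        also have "\<dots> \<le> C * W + A / 8 + A / 8"
          using G[OF k] CG A8 by simp
        also have "\<dots> \<le> 3 * (C * W)"
          using AW by simp
        also have "\<dots> \<le> (1 + 8 * C) * W"
          using C_ge_1 by (simp add: W_def algebra_simps)
        finally show ?thesis .
      qed
      moreover have "norm (\<Sum>i<m. a i) \<le> (1 + 8 * C) * W"
      proof -
        \<comment> \<open>Over the single blocks \<open>f j\<close> the combination has the
          coefficient \<open>a i / M i\<close> throughout the group \<open>I i\<close>. These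
          coefficients have the same total as the \<open>a i\<close>, so near-extremality bounds the
          total by \<open>W + A\<close>.\<close>
        define J where "J = (\<Union>i<m. I i)"
        define c where "c j = (\<Sum>i<m. if j \<in> I i then a i / of_real (M i) else 0)" for j
        have I_disj: "I i \<inter> I i' = {}" if "i \<noteq> i'" for i i'
          using that I_less[of i i'] I_less[of i' i] by (cases "i < i'") force+
        have c: "c j = a i / of_real (M i)" if "i < m" "j \<in> I i" for i j
        proof -
          have "c j = (\<Sum>l<m. if l = i then a i / of_real (M i) else 0)"
            unfolding c_def using I_disj that by (intro sum.cong) auto
          then show ?thesis
            using that by simp
        qed
        have sum_J: "(\<Sum>j\<in>J. c j) = (\<Sum>i<m. \<Sum>j\<in>I i. c j)"
          "(\<Sum>j\<in>J. smul (c j) (f j)) = (\<Sum>i<m. \<Sum>j\<in>I i. smul (c j) (f j))"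
          unfolding J_def using I_disj by (intro sum.UNION_disjoint; auto simp: I_def)+
        have "norm (\<Sum>j\<in>J. c j) \<le> norm (\<Sum>j\<in>J. smul (c j) (f j)) + A"
        proof (rule norm_sum_coefficients_le[OF norm_f sum_f _ A0])
          show "J \<subseteq> {..<N}"
            unfolding J_def using I_N by blast
          fix j assume "j \<in> J"
          then obtain i where i: "i < m" "j \<in> I i"
            by (auto simp: J_def)
          have "norm (a i) / M i \<le> A / 1"
            using A[OF i(1)] M_ge_1[of i] A0 by (intro frac_le) auto
          then show "norm (c j) \<le> A"
            using M_ge_1[of i] by (simp add: c[OF i] norm_divide)
        qed
        moreover have "(\<Sum>j\<in>J. c j) = (\<Sum>i<m. a i)"
        proof -
          have "(\<Sum>j\<in>I i. c j) = a i" if "i < m" for i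
          proof -
            have "(\<Sum>j\<in>I i. c j) = (\<Sum>j\<in>I i. a i / of_real (M i))"
              using c[OF that] by (intro sum.cong) auto
            also have "\<dots> = a i"
              using M_ge_1[of i] by (simp add: M_def)
            finally show ?thesis .
          qed
          then show ?thesis
            unfolding sum_J by (intro sum.cong) auto
        qed
        moreover have "(\<Sum>j\<in>J. smul (c j) (f j)) = Z m"
        proof -
          have "(\<Sum>j\<in>I i. smul (c j) (f j)) = smul (a i) (z i)" if "i < m" for i
          proof -
            have "(\<Sum>j\<in>I i. smul (c j) (f j)) = (\<Sum>j\<in>I i. smul (a i / of_real (M i)) (f j))"
              using c[OF that] by (intro sum.cong) auto
            also have "\<dots> = smul (a i) (z i)"
              by (simp add: z_def g_def scale_sum_right)
            finally show ?thesis .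
          qed
          then show ?thesis
            unfolding sum_J Z_def by (intro sum.cong) auto
        qed
        ultimately show ?thesis
          using AW by (simp add: W_def algebra_simps)
      qed
      ultimately show ?thesis
        by (simp add: W_def Z_def)
    qed
    show ?thesis
      by (intro exI[of _ z] conjI allI impI) (use norm_z main in auto)
  qed
qed

lemma block_sum_contraction:
  assumes "superreflexive (space_of smul)"
  shows "\<exists>N \<rho>. 2 \<le> N \<and> 0 < \<rho> \<and> \<rho> < 1 \<and>
    (\<forall>f t. decreasing_blocks f N \<longrightarrow> (\<forall>i<N. norm (f i) \<le> t) \<longrightarrow> norm (\<Sum>i<N. f i) \<le> \<rho> * real N * t)"
proof -
  obtain N \<epsilon> where N: "2 \<le> N" and \<epsilon>: "0 < \<epsilon>"
    and none: "\<not> (\<exists>f. decreasing_blocks f N \<and> (\<forall>i<N. norm (f i) \<le> 1) \<and> real N - \<epsilon> < norm (\<Sum>i<N. f i))"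
    using not_superreflexive_if_long_blocks assms by blast
  \<comment> \<open>The maximum with 1/2 keeps \<open>\<rho>\<close> positive when
    \<open>\<epsilon>\<close> exceeds \<open>N\<close>.\<close>
  define \<rho> where "\<rho> = max (1 - \<epsilon> / real N) (1 / 2)"
  have \<rho>: "0 < \<rho>" "\<rho> < 1" "real N - \<epsilon> \<le> \<rho> * real N"
  proof -
    show "0 < \<rho>" "\<rho> < 1"
      using N \<epsilon> by (auto simp: \<rho>_def)
    have "(1 - \<epsilon> / real N) * real N \<le> \<rho> * real N"
      by (intro mult_right_mono) (auto simp: \<rho>_def)
    then show "real N - \<epsilon> \<le> \<rho> * real N"
      using N by (simp add: left_diff_distrib)
  qed
  have "norm (\<Sum>i<N. f i) \<le> \<rho> * real N * t"
    if f: "decreasing_blocks f N" and t: "\<forall>i<N. norm (f i) \<le> t" for f t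
  proof (cases "t > 0")
    case False
    then have "f i = 0" if "i < N" for i
      using t that by (meson norm_le_zero_iff not_le order_trans)
    moreover have "0 \<le> t"
      using t N norm_ge_zero[of "f 0"] by (meson less_le_trans order_trans zero_less_numeral)
    ultimately show ?thesis
      using False by simp
  next
    case True
    have "decreasing_blocks (\<lambda>i. smul (of_real (1 / t)) (f i)) N"
      by (rule decreasing_blocks_scale[OF f]) simp
    moreover have "norm (smul (of_real (1 / t)) (f i)) \<le> 1" if "i < N" for i
      using t that True by (simp add: scale_of_real del: of_real_divide)
    ultimately have "norm (\<Sum>i<N. smul (of_real (1 / t)) (f i)) \<le> real N - \<epsilon>"
      using none by (meson not_le)
    moreover have "norm (\<Sum>i<N. smul (of_real (1 / t)) (f i)) = norm (\<Sum>i<N. f i) / t"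
      using True by (simp add: scale_of_real scaleR_sum_right[symmetric] del: of_real_divide)
    ultimately have "norm (\<Sum>i<N. f i) / t \<le> \<rho> * real N"
      using \<rho>(3) by simp
    then show ?thesis
      using True by (simp add: divide_le_eq)
  qed
  then show ?thesis
    using N \<rho> by blast
qed

end

section \<open>An upper estimate for decreasing blocks\<close>

text \<open>The factor N^(1 - 1/q) tends to 1 as q decreases to 1. Stopping at
  \<open>(1 + \<rho>) / 2\<close> rather than at 1 leaves room for the crossing terms in
  \<open>upper_estimate\<close>.\<close>

lemma ex_contracting_exponent:
  assumes "2 \<le> N" "0 < \<rho>" "\<rho> < 1"
  shows "\<exists>q>1. \<rho> * (real N * (1 / real N) powr (1 / q)) \<le> (1 + \<rho>) / 2"
proof -
  define \<kappa> where "\<kappa> = (1 + \<rho>) / (2 * \<rho>)"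
  have \<kappa>: "1 < \<kappa>"
    using assms by (simp add: \<kappa>_def field_simps)
  \<comment> \<open>This is 1 - 1/q; the cap 1/2 keeps q finite, and the other bound gives N^s at
    most \<open>\<kappa>\<close>.\<close>
  define s where "s = min (1 / 2) (ln \<kappa> / ln (real N))"
  have s: "0 < s" "s \<le> 1 / 2" "s * ln (real N) \<le> ln \<kappa>"
  proof -
    show "0 < s"
      using \<kappa> assms by (auto simp: s_def)
    show "s \<le> 1 / 2"
      unfolding s_def by (rule min.cobounded1)
    have "s * ln (real N) \<le> ln \<kappa> / ln (real N) * ln (real N)"
      unfolding s_def using assms by (intro mult_right_mono min.cobounded2) auto
    then show "s * ln (real N) \<le> ln \<kappa>"
      using assms by simp
  qed
  define q where "q = 1 / (1 - s)"
  have q: "1 < q" "1 / q = 1 - s"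
    using s by (simp_all add: q_def)
  have "real N * (1 / real N) powr (1 / q) = real N powr s"
    using assms by (simp add: q powr_divide powr_diff)
  also have "\<dots> = exp (s * ln (real N))"
    using assms by (simp add: powr_def)
  also have "\<dots> \<le> \<kappa>"
    using s(3) \<kappa> by (metis exp_le_cancel_iff exp_ln less_trans zero_less_one)
  finally have "\<rho> * (real N * (1 / real N) powr (1 / q)) \<le> \<rho> * \<kappa>"
    using assms by (intro mult_left_mono) auto
  also have "\<rho> * \<kappa> = (1 + \<rho>) / 2"
    using assms by (simp add: \<kappa>_def)
  finally show ?thesis
    using q by blast
qed

text \<open>
  Cut the sum of the \<open>norm (f j) powr q\<close> into \<open>N\<close> equal parts. Each part is taken up by the indices
  that fit into it, to which the induction hypothesis applies, and by at most one index that
  crosses its right end.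
\<close>

lemma upper_estimate:
  fixes f :: "nat \<Rightarrow> 'a::real_normed_vector"
  assumes N: "2 \<le> N" and \<rho>: "0 < \<rho>" "\<rho> < 1" and q: "1 < q"
    and exponent: "\<rho> * (real N * (1 / real N) powr (1 / q)) \<le> (1 + \<rho>) / 2"
    and "finite K"
    and contraction: "\<And>J t. (\<And>i. i < N \<Longrightarrow> J i \<subseteq> K) \<Longrightarrow>
      (\<And>i i' j j'. i < i' \<Longrightarrow> i' < N \<Longrightarrow> j \<in> J i \<Longrightarrow> j' \<in> J i' \<Longrightarrow> j < j') \<Longrightarrow>
      (\<And>i. i < N \<Longrightarrow> norm (\<Sum>j\<in>J i. f j) \<le> t) \<Longrightarrow>
      norm (\<Sum>i<N. \<Sum>j\<in>J i. f j) \<le> \<rho> * real N * t"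
  shows "norm (\<Sum>j\<in>K. f j) \<le> 2 * real N / (1 - \<rho>) * (\<Sum>j\<in>K. norm (f j) powr q) powr (1 / q)"
  using \<open>finite K\<close> contraction
proof (induction K rule: finite_psubset_induct)
  case (psubset K)
  \<comment> \<open>The solution of \<open>(1 + \<rho>) / 2 * D + real N = D\<close>, by which the
    induction closes.\<close>
  define D where "D = 2 * real N / (1 - \<rho>)"
  have D: "0 < D"
    using N \<rho> by (simp add: D_def)
  have IH: "norm (\<Sum>j\<in>L. f j) \<le> D * (\<Sum>j\<in>L. norm (f j) powr q) powr (1 / q)" if L: "L \<subset> K" for L
    unfolding D_def
  proof (rule psubset.IH[OF L])
    fix J :: "nat \<Rightarrow> nat set" and t
    assume "\<And>i. i < N \<Longrightarrow> J i \<subseteq> L"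
      and "\<And>i i' j j'. i < i' \<Longrightarrow> i' < N \<Longrightarrow> j \<in> J i \<Longrightarrow> j' \<in> J i' \<Longrightarrow> j < j'"
      and "\<And>i. i < N \<Longrightarrow> norm (\<Sum>j\<in>J i. f j) \<le> t"
    then show "norm (\<Sum>i<N. \<Sum>j\<in>J i. f j) \<le> \<rho> * real N * t"
      using L by (intro psubset.prems) blast+
  qed
  show ?case
  proof (cases "\<exists>j\<in>K. f j = 0")
    \<comment> \<open>A zero term is removed by the induction hypothesis. Afterwards all
      \<open>s j\<close> are positive, so every index starts strictly before the end of the total
      mass.\<close>
    case True
    then obtain j where j: "j \<in> K" "f j = 0"
      by blast
    then have "K - {j} \<subset> K"
      by blast
    moreover have "(\<Sum>i\<in>K - {j}. f i) = (\<Sum>i\<in>K. f i)"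
      "(\<Sum>i\<in>K - {j}. norm (f i) powr q) = (\<Sum>i\<in>K. norm (f i) powr q)"
      using j psubset.hyps by (auto intro!: sum.mono_neutral_left)
    ultimately show ?thesis
      using IH[of "K - {j}"] by (simp add: D_def)
  next
    case False
    define s where "s j = norm (f j) powr q" for j
    define S where "S = (\<Sum>j\<in>K. s j)"
    have s: "0 < s j" if "j \<in> K" for j
      using False that by (auto simp: s_def)
    have s_root: "norm (f j) = s j powr (1 / q)" for j
      using q by (simp add: s_def powr_powr)
    show ?thesis
    proof (cases "K = {}")
      case True
      then show ?thesis
        by simp
    next
      case False
      then have S: "0 < S"
        unfolding S_def using psubset.hyps s by (intro sum_pos)
      \<comment> \<open>With the masses \<open>s j\<close> laid end to end on an interval of length
        \<open>S\<close>, index \<open>j\<close> occupies the stretch from \<open>F j\<close> to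
        \<open>F j + s j\<close>; \<open>\<kappa> j\<close> is the part in which it starts, and
        \<open>Fit\<close> and \<open>Cross\<close> record whether it ends there.\<close>
      define F where "F j = (\<Sum>i\<in>{i\<in>K. i < j}. s i)" for j
      define \<kappa> where "\<kappa> j = nat \<lfloor>real N * F j / S\<rfloor>" for j
      define Fit where "Fit i = {j\<in>K. \<kappa> j = i \<and> real N * (F j + s j) / S \<le> real i + 1}" for i
      define Cross where "Cross i = {j\<in>K. \<kappa> j = i \<and> \<not> real N * (F j + s j) / S \<le> real i + 1}" for i
      have F_nonneg: "0 \<le> F j" for j
        unfolding F_def using s by (intro sum_nonneg) (auto intro: less_imp_le)
      have F_mono: "F j \<le> F j'" if "j \<le> j'" for j j'
        unfolding F_def using psubset.hyps s that by (intro sum_mono2) (auto intro: less_imp_le)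
      have F_step: "F j + s j \<le> F j'" if "j \<in> K" "j < j'" for j j'
      proof -
        have "F j + s j = (\<Sum>i\<in>insert j {i\<in>K. i < j}. s i)"
          using psubset.hyps by (simp add: F_def add.commute)
        also have "\<dots> \<le> F j'"
          unfolding F_def using psubset.hyps s that by (intro sum_mono2) (auto intro: less_imp_le)
        finally show ?thesis .
      qed
      have F_S: "F j + s j \<le> S" if "j \<in> K" for j
      proof -
        have "F j + s j = (\<Sum>i\<in>insert j {i\<in>K. i < j}. s i)"
          using psubset.hyps by (simp add: F_def add.commute)
        also have "\<dots> \<le> S"
          unfolding S_def using psubset.hyps s that by (intro sum_mono2) (auto intro: less_imp_le)
        finally show ?thesis .
      qed
      have \<kappa>_le: "real (\<kappa> j) \<le> real N * F j / S" for j
        using F_nonneg[of j] S by (simp add: \<kappa>_def)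
      have \<kappa>_gt: "real N * F j / S < real (\<kappa> j) + 1" for j
        using F_nonneg[of j] S unfolding \<kappa>_def by linarith
      have \<kappa>_N: "\<kappa> j < N" if "j \<in> K" for j
      proof -
        have "F j < S"
          using F_S[OF that] s[OF that] by simp
        then have "real N * F j / S < real N"
          using S N by (simp add: divide_less_eq)
        then show ?thesis
          using \<kappa>_le[of j] by linarith
      qed
      have \<kappa>_less: "j < j'" if "\<kappa> j < \<kappa> j'" for j j'
      proof (rule ccontr)
        assume "\<not> j < j'"
        then have "real N * F j' / S \<le> real N * F j / S"
          using F_mono[of j' j] S by (simp add: divide_right_mono mult_left_mono)
        then show False
          using \<kappa>_le[of j'] \<kappa>_gt[of j] that by linarith
      qed
      have fin: "finite (Fit i)" "finite (Cross i)" for i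
        using psubset.hyps by (simp_all add: Fit_def Cross_def)
      have sub: "Fit i \<subseteq> K" "Cross i \<subseteq> K" for i
        by (auto simp: Fit_def Cross_def)
      \<comment> \<open>Everything that fits lies between the start of the lowest and the end of the
        highest such index, and both points belong to the same part.\<close>
      have sum_Fit: "(\<Sum>j\<in>Fit i. s j) \<le> S * (1 / real N)" for i
      proof (cases "Fit i = {}")
        case True
        then show ?thesis
          using S by simp
      next
        case False
        define lo where "lo = Min (Fit i)"
        define hi where "hi = Max (Fit i)"
        have lo: "lo \<in> Fit i" and hi: "hi \<in> Fit i"
          using fin(1) False by (simp_all add: lo_def hi_def)
        have between: "lo \<le> j" "j \<le> hi" if "j \<in> Fit i" for j
          using fin(1)[of i] that by (simp_all add: lo_def hi_def)
        have disj: "Fit i \<inter> {j\<in>K. j < lo} = {}"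
        proof -
          have "\<not> j < lo" if "j \<in> Fit i" for j
            using between(1)[OF that] by simp
          then show ?thesis
            by blast
        qed
        have into: "Fit i \<union> {j \<in> K. j < lo} \<subseteq> insert hi {j \<in> K. j < hi}"
        proof
          fix j assume "j \<in> Fit i \<union> {j \<in> K. j < lo}"
          then consider "j \<in> Fit i" | "j \<in> K" "j < lo"
            by blast
          then show "j \<in> insert hi {j \<in> K. j < hi}"
          proof cases
            case 1
            then show ?thesis
              using between(2)[of j] sub(1)[of i] by (auto simp: le_less)
          next
            case 2
            then show ?thesis
              using between(2)[OF lo] by simp
          qed
        qed
        have "(\<Sum>j\<in>Fit i. s j) + F lo = (\<Sum>j\<in>Fit i \<union> {j\<in>K. j < lo}. s j)"
          unfolding F_def using fin(1)[of i] psubset.hyps disj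
          by (intro sum.union_disjoint[symmetric]) simp_all
        also have "\<dots> \<le> (\<Sum>j\<in>insert hi {j\<in>K. j < hi}. s j)"
        proof (rule sum_mono2[OF _ into])
          show "finite (insert hi {j \<in> K. j < hi})"
            using psubset.hyps by simp
          show "0 \<le> s j" for j
            by (simp add: s_def)
        qed
        also have "\<dots> = F hi + s hi"
          using psubset.hyps by (simp add: F_def add.commute)
        finally have le: "(\<Sum>j\<in>Fit i. s j) \<le> F hi + s hi - F lo"
          by simp
        have "real N * (F hi + s hi) / S \<le> real i + 1" "real i \<le> real N * F lo / S"
          using hi lo \<kappa>_le[of lo] by (auto simp: Fit_def)
        then have "real N * (F hi + s hi) / S - real N * F lo / S \<le> 1"
          by linarith
        then have "real N * (F hi + s hi - F lo) / S \<le> 1"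
          by (simp add: diff_divide_distrib[symmetric] right_diff_distrib)
        then have "F hi + s hi - F lo \<le> S * (1 / real N)"
          using S N by (simp add: field_simps)
        then show ?thesis
          using le by simp
      qed
      \<comment> \<open>One part carries at most \<open>S / real N\<close>, which is less than
        \<open>S\<close> because \<open>N\<close> is at least 2; this makes the induction hypothesis
        available.\<close>
      have proper: "Fit i \<subset> K" for i
      proof -
        have "S * (1 / real N) < S"
          using S N by (simp add: field_simps)
        then have "Fit i \<noteq> K"
          using sum_Fit[of i] by (auto simp: S_def)
        then show ?thesis
          using sub(1) by blast
      qed
      have root_mono: "u powr (1 / q) \<le> v powr (1 / q)" if "0 \<le> u" "u \<le> v" for u v :: real
        using that q by (intro powr_mono2) auto
      have norm_Fit: "norm (\<Sum>j\<in>Fit i. f j) \<le> D * (S * (1 / real N)) powr (1 / q)" for i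
      proof -
        have "norm (\<Sum>j\<in>Fit i. f j) \<le> D * (\<Sum>j\<in>Fit i. s j) powr (1 / q)"
          unfolding s_def by (rule IH[OF proper])
        also have "\<dots> \<le> D * (S * (1 / real N)) powr (1 / q)"
          using D sum_Fit by (intro mult_left_mono root_mono sum_nonneg) (auto simp: s_def)
        finally show ?thesis .
      qed
      \<comment> \<open>An index after a crossing one starts no earlier than that one ends, hence
        beyond the part.\<close>
      have Cross_unique: "j = j'" if "j \<in> Cross i" "j' \<in> Cross i" for i j j'
      proof -
        have False if j: "j \<in> Cross i" "j' \<in> Cross i" "j < j'" for j j'
        proof -
          have "real N * (F j + s j) / S \<le> real N * F j' / S"
            using F_step[of j j'] j S sub(2)[of i] by (intro divide_right_mono mult_left_mono) auto
          then show False
            using j \<kappa>_gt[of j'] by (auto simp: Cross_def)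
        qed
        then show ?thesis
          using that nat_neq_iff by blast
      qed
      have norm_Cross: "norm (\<Sum>j\<in>Cross i. f j) \<le> S powr (1 / q)" for i
      proof (cases "Cross i = {}")
        case True
        then show ?thesis
          by simp
      next
        case False
        then obtain j where j: "j \<in> Cross i"
          by blast
        then have "Cross i = {j}"
          using Cross_unique by blast
        moreover have "s j \<le> S"
          using F_S[of j] F_nonneg[of j] j sub(2)[of i] by auto
        ultimately show ?thesis
          using root_mono[of "s j" S] by (simp add: s_root) (simp add: s_def)
      qed
      have "(\<Sum>i<N. \<Sum>j\<in>{j\<in>K. \<kappa> j = i}. f j) = (\<Sum>j\<in>K. f j)"
        using psubset.hyps \<kappa>_N by (intro sum.group) auto
      moreover have "(\<Sum>j\<in>{j\<in>K. \<kappa> j = i}. f j) = (\<Sum>j\<in>Fit i. f j) + (\<Sum>j\<in>Cross i. f j)" for i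
      proof -
        have "{j\<in>K. \<kappa> j = i} = Fit i \<union> Cross i"
          by (auto simp: Fit_def Cross_def)
        then show ?thesis
          using fin by (simp add: sum.union_disjoint Fit_def Cross_def disjoint_iff)
      qed
      ultimately have "(\<Sum>j\<in>K. f j) = (\<Sum>i<N. \<Sum>j\<in>Fit i. f j) + (\<Sum>i<N. \<Sum>j\<in>Cross i. f j)"
        by (simp add: sum.distrib)
      then have split: "norm (\<Sum>j\<in>K. f j) \<le>
          norm (\<Sum>i<N. \<Sum>j\<in>Fit i. f j) + norm (\<Sum>i<N. \<Sum>j\<in>Cross i. f j)"
        by (simp add: norm_triangle_ineq)
      have "norm (\<Sum>i<N. \<Sum>j\<in>Cross i. f j) \<le> of_nat (card {..<N}) * S powr (1 / q)"
        by (rule order_trans[OF norm_sum sum_bounded_above]) (rule norm_Cross)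
      then have cross: "norm (\<Sum>i<N. \<Sum>j\<in>Cross i. f j) \<le> real N * S powr (1 / q)"
        by simp
      have "norm (\<Sum>i<N. \<Sum>j\<in>Fit i. f j) \<le> \<rho> * real N * (D * (S * (1 / real N)) powr (1 / q))"
      proof (rule psubset.prems)
        show "Fit i \<subseteq> K" for i
          by (rule sub)
        show "norm (\<Sum>j\<in>Fit i. f j) \<le> D * (S * (1 / real N)) powr (1 / q)" for i
          by (rule norm_Fit)
        show "j < j'" if "i < i'" "i' < N" "j \<in> Fit i" "j' \<in> Fit i'" for i i' j j'
          by (rule \<kappa>_less) (use that in \<open>simp add: Fit_def\<close>)
      qed
      also have "(S * (1 / real N)) powr (1 / q) = S powr (1 / q) * (1 / real N) powr (1 / q)"
        by (rule powr_mult)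
      also have "\<rho> * real N * (D * (S powr (1 / q) * (1 / real N) powr (1 / q)))
          = (\<rho> * (real N * (1 / real N) powr (1 / q))) * (D * S powr (1 / q))"
        by (simp only: mult_ac)
      also have "\<dots> \<le> (1 + \<rho>) / 2 * (D * S powr (1 / q))"
        using exponent D by (intro mult_right_mono) auto
      finally have "norm (\<Sum>j\<in>K. f j) \<le> (1 + \<rho>) / 2 * (D * S powr (1 / q)) + real N * S powr (1 / q)"
        using split cross by linarith
      then have "norm (\<Sum>j\<in>K. f j) \<le> ((1 + \<rho>) / 2 * D + real N) * S powr (1 / q)"
        by (simp only: distrib_right mult.assoc)
      also have "(1 + \<rho>) / 2 * D + real N = D"
        using \<rho> by (simp add: D_def field_simps)
      finally show ?thesis
        by (simp add: D_def S_def s_def)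
    qed
  qed
qed

section \<open>Levels of a weight\<close>

text \<open>
  The level of \<open>j\<close> is the \<open>l\<close> with \<open>4 ^ l * s 1 \<le> s (Suc j) < 4 ^ Suc l * s 1\<close>. Since \<open>s\<close>
  grows by at most \<open>s 1\<close> at each step, the increments over level \<open>l - 1\<close> already add up to a
  fixed proportion of the values of \<open>s\<close> on level \<open>l\<close>.
\<close>

lemma level_sum_estimate:
  fixes s d :: "nat \<Rightarrow> real"
  assumes s0: "s 0 = 0" and s1: "0 < s 1" and s_mono: "\<And>i j. i \<le> j \<Longrightarrow> s i \<le> s j"
    and s_step: "\<And>j. s (Suc j) \<le> s j + s 1"
    and d_mono: "\<And>i j. i \<le> j \<Longrightarrow> j < n \<Longrightarrow> d j \<le> d i" and d_nonneg: "\<And>j. j < n \<Longrightarrow> 0 \<le> d j"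
    and q: "0 < q"
  shows "\<exists>lv :: nat \<Rightarrow> nat. mono lv \<and> (\<forall>j. s (Suc j) \<le> 4 ^ Suc (lv j) * s 1) \<and>
    (\<Sum>l\<in>lv ` {..<n}. (d (LEAST j. lv j = l) * (4 ^ Suc l * s 1)) powr q)
      \<le> 8 * 16 powr q * (\<Sum>j<n. (d j * s (Suc j)) powr q * ((s (Suc j) - s j) / s (Suc j)))"
proof -
  define \<sigma> where "\<sigma> = s 1"
  have \<sigma>: "0 < \<sigma>"
    using s1 by (simp add: \<sigma>_def)
  define lv where "lv j = (LEAST l. s (Suc j) < 4 ^ Suc l * \<sigma>)" for j
  have hi: "s (Suc j) < 4 ^ Suc (lv j) * \<sigma>" for j
  proof -
    obtain l where "s (Suc j) / \<sigma> < 4 ^ l"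
      using real_arch_pow[of 4] by auto
    also have "(4::real) ^ l \<le> 4 ^ Suc l"
      by simp
    finally have "s (Suc j) < 4 ^ Suc l * \<sigma>"
      using \<sigma> by (simp add: divide_less_eq)
    then show ?thesis
      unfolding lv_def by (rule LeastI)
  qed
  have lo: "4 ^ lv j * \<sigma> \<le> s (Suc j)" for j
  proof (cases "lv j")
    case 0
    then show ?thesis
      using s_mono[of 1 "Suc j"] by (simp add: \<sigma>_def)
  next
    case (Suc l)
    then show ?thesis
      using not_less_Least[of l "\<lambda>l. s (Suc j) < 4 ^ Suc l * \<sigma>"] by (simp add: lv_def)
  qed
  have lv_mono: "lv i \<le> lv j" if "i \<le> j" for i j
  proof -
    have "4 ^ lv i * \<sigma> < 4 ^ Suc (lv j) * \<sigma>"
      using lo[of i] hi[of j] s_mono[of "Suc i" "Suc j"] that by linarith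
    then have "(4::real) ^ lv i < 4 ^ Suc (lv j)"
      using \<sigma> by simp
    then have "lv i < Suc (lv j)"
      by (subst (asm) power_strict_increasing_iff) simp_all
    then show ?thesis
      by simp
  qed
  define T where "T j = (d j * s (Suc j)) powr q * ((s (Suc j) - s j) / s (Suc j))" for j
  have s_pos: "0 < s (Suc j)" for j
    using s_mono[of 1 "Suc j"] \<sigma> by (simp add: \<sigma>_def)
  have T_nonneg: "0 \<le> T j" for j
    unfolding T_def using s_pos[of j] s_mono[of j "Suc j"] by simp
  define first where "first l = (LEAST j. lv j = l)" for l
  \<comment> \<open>The indices whose terms pay for level \<open>l\<close>: those of the level
    below. For level 0 the index 0 suffices, since \<open>s 0 = 0\<close> makes its increment ratio
    1.\<close>
  define E where "E l = (if l = 0 then {0} else {j. j < n \<and> lv j = l - 1})" for l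
  have key: "(d (first l) * (4 ^ Suc l * \<sigma>)) powr q \<le> 4 * 16 powr q * (\<Sum>j\<in>E l. T j)"
    if l: "l \<in> lv ` {..<n}" for l
  proof -
    obtain j where j: "j < n" "lv j = l"
      using l by auto
    have first: "lv (first l) = l" "first l \<le> j"
      unfolding first_def using LeastI[of "\<lambda>j. lv j = l" j] Least_le[of "\<lambda>j. lv j = l" j] j by auto
    then have first_n: "first l < n"
      using j by simp
    show ?thesis
    proof (cases l)
      case 0
      have "lv 0 = 0"
        using lv_mono[of 0 j] j 0 by simp
      then have "first l = 0"
        using 0 Least_le[of "\<lambda>j. lv j = l" 0] by (simp add: first_def)
      then have "(d (first l) * (4 ^ Suc l * \<sigma>)) powr q = 4 powr q * (d 0 * \<sigma>) powr q"
        using 0 powr_mult[of 4 "d 0 * \<sigma>" q] by (simp add: mult.left_commute)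
      also have "\<dots> = 4 powr q * T 0"
        using \<sigma> by (simp add: T_def \<sigma>_def s0)
      also have "\<dots> \<le> (4 * 16 powr q) * T 0"
      proof (rule mult_right_mono[OF _ T_nonneg])
        have "(4::real) powr q \<le> 16 powr q"
          using q by (intro powr_mono2) auto
        then show "(4::real) powr q \<le> 4 * 16 powr q"
          using powr_ge_zero[of 16 q] by linarith
      qed
      finally show ?thesis
        using 0 by (simp add: E_def)
    next
      case (Suc k)
      define v where "v = d (first l) * (4 ^ k * \<sigma>)"
      have v: "0 \<le> v"
        using d_nonneg[OF first_n] \<sigma> by (simp add: v_def)
      \<comment> \<open>The start of level \<open>k\<close>, or the start of level \<open>l\<close>
        if level \<open>k\<close> were empty; the lower bound for the increments below rules out the
        latter.\<close>
      define p where "p = (LEAST j. 4 ^ k * \<sigma> \<le> s (Suc j))"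
      have l_lo: "4 ^ l * \<sigma> \<le> s (Suc (first l))"
        using lo[of "first l"] first by simp
      have k_l: "4 ^ l * \<sigma> = 4 * (4 ^ k * \<sigma>)" "\<sigma> \<le> 4 ^ k * \<sigma>"
        using Suc \<sigma> one_le_power[of "4::real" k] by simp_all
      have ex_p: "4 ^ k * \<sigma> \<le> s (Suc (first l))"
        using l_lo k_l \<sigma> by linarith
      have p: "4 ^ k * \<sigma> \<le> s (Suc p)" "p \<le> first l"
        unfolding p_def
        using LeastI[of "\<lambda>j. 4 ^ k * \<sigma> \<le> s (Suc j)", OF ex_p]
          Least_le[of "\<lambda>j. 4 ^ k * \<sigma> \<le> s (Suc j)", OF ex_p] by simp_all
      have s_p: "s p \<le> 4 ^ k * \<sigma>"
      proof (cases p)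
        case 0
        then show ?thesis
          using \<sigma> by (simp add: s0)
      next
        case (Suc i)
        then show ?thesis
          using not_less_Least[of i "\<lambda>j. 4 ^ k * \<sigma> \<le> s (Suc j)"] by (simp add: p_def)
      qed
      have E_sub: "{p..<first l} \<subseteq> E l"
      proof
        fix i assume i: "i \<in> {p..<first l}"
        have "lv i \<noteq> l"
          using i not_less_Least[of i "\<lambda>j. lv j = l"] by (simp add: first_def)
        then have "lv i < l"
          using lv_mono[of i "first l"] i first by simp
        moreover have "k \<le> lv i"
        proof -
          have "4 ^ k * \<sigma> < 4 ^ Suc (lv i) * \<sigma>"
            using p(1) s_mono[of "Suc p" "Suc i"] i hi[of i] by simp
          then have "(4::real) ^ k < 4 ^ Suc (lv i)"
            using \<sigma> by simp
          then have "k < Suc (lv i)"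
            by (subst (asm) power_strict_increasing_iff) simp_all
          then show ?thesis
            by simp
        qed
        ultimately show "i \<in> E l"
          using i first_n Suc by (simp add: E_def)
      qed
      have T_ge: "v powr q * ((s (Suc i) - s i) / (4 ^ l * \<sigma>)) \<le> T i" if i: "i \<in> {p..<first l}" for i
        unfolding T_def
      proof (rule mult_mono)
        have "d (first l) \<le> d i"
          using i first_n by (intro d_mono) auto
        moreover have "4 ^ k * \<sigma> \<le> s (Suc i)"
          using p(1) s_mono[of "Suc p" "Suc i"] i by simp
        ultimately have "v \<le> d i * s (Suc i)"
          unfolding v_def using d_nonneg[OF first_n] \<sigma> by (intro mult_mono) auto
        then show "v powr q \<le> (d i * s (Suc i)) powr q"
          using v q by (intro powr_mono2) auto
        have "lv i = k"
          using E_sub i Suc by (auto simp: E_def)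
        then have "s (Suc i) \<le> 4 ^ l * \<sigma>"
          using hi[of i] Suc by simp
        then show "(s (Suc i) - s i) / (4 ^ l * \<sigma>) \<le> (s (Suc i) - s i) / s (Suc i)"
          using s_pos[of i] s_mono[of i "Suc i"] \<sigma> by (intro divide_left_mono mult_pos_pos) auto
        show "0 \<le> (s (Suc i) - s i) / (4 ^ l * \<sigma>)"
          using s_mono[of i "Suc i"] \<sigma> by simp
      qed simp
      have "(\<Sum>i=p..<first l. s (Suc i) - s i) = s (first l) - s p"
        using p(2) by (rule sum_Suc_diff')
      moreover have "4 ^ l * \<sigma> - \<sigma> \<le> s (first l)"
        using l_lo s_step[of "first l"] by (simp add: \<sigma>_def)
      \<comment> \<open>The sum telescopes to at least 4 * 4^k \<sigma> - \<sigma> - 4^k \<sigma>,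
        the middle term being the single step that may jump over the threshold.\<close>
      ultimately have "4 ^ k * \<sigma> \<le> (\<Sum>i=p..<first l. s (Suc i) - s i)"
        using s_p k_l \<sigma> by linarith
      then have "v powr q * (4 ^ k * \<sigma> / (4 ^ l * \<sigma>))
          \<le> v powr q * ((\<Sum>i=p..<first l. s (Suc i) - s i) / (4 ^ l * \<sigma>))"
        using \<sigma> by (intro mult_left_mono divide_right_mono) auto
      also have "\<dots> = (\<Sum>i=p..<first l. v powr q * ((s (Suc i) - s i) / (4 ^ l * \<sigma>)))"
        by (simp add: sum_distrib_left sum_divide_distrib)
      also have "\<dots> \<le> (\<Sum>i=p..<first l. T i)"
        using T_ge by (rule sum_mono)
      also have "\<dots> \<le> (\<Sum>i\<in>E l. T i)"
        using E_sub T_nonneg by (intro sum_mono2) (auto simp: E_def)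
      finally have "v powr q \<le> 4 * (\<Sum>i\<in>E l. T i)"
        using \<sigma> Suc by simp
      then have "16 powr q * v powr q \<le> 16 powr q * (4 * (\<Sum>i\<in>E l. T i))"
        by (intro mult_left_mono) auto
      \<comment> \<open>Since \<open>l = Suc k\<close>, the upper threshold of level
        \<open>l\<close> is 16 times the lower threshold of level \<open>k\<close>.\<close>
      moreover have "(d (first l) * (4 ^ Suc l * \<sigma>)) powr q = 16 powr q * v powr q"
      proof -
        have "d (first l) * (4 ^ Suc l * \<sigma>) = 16 * v"
          using Suc by (simp add: v_def)
        then show ?thesis
          by (simp only: powr_mult)
      qed
      ultimately show ?thesis
        by simp
    qed
  qed
  define K where "K = lv ` {..<n}"
  have E_n: "E l \<subseteq> {..<n}" if "l \<in> K" for l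
    using that by (auto simp: E_def K_def)
  have "(\<Sum>l\<in>K. \<Sum>j\<in>E l. T j) = (\<Sum>l\<in>K. \<Sum>j\<in>{j\<in>{..<n}. j \<in> E l}. T j)"
    using E_n by (intro sum.cong refl) auto
  also have "\<dots> = (\<Sum>j<n. \<Sum>l\<in>{l\<in>K. j \<in> E l}. T j)"
    by (rule sum.swap_restrict) (simp_all add: K_def)
  also have "\<dots> \<le> (\<Sum>j<n. 2 * T j)"
  proof (rule sum_mono)
    fix j
    \<comment> \<open>An index pays for the level above its own and, if it is 0, also for level 0;
      this accounts for the factor 2.\<close>
    have "{l \<in> K. j \<in> E l} \<subseteq> {0, Suc (lv j)}"
      by (auto simp: E_def split: if_splits)
    then have "card {l \<in> K. j \<in> E l} \<le> card {0, Suc (lv j)}"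
      by (rule card_mono[rotated]) simp
    then have "real (card {l \<in> K. j \<in> E l}) * T j \<le> 2 * T j"
      using T_nonneg by (intro mult_right_mono) auto
    then show "(\<Sum>l\<in>{l\<in>K. j \<in> E l}. T j) \<le> 2 * T j"
      by simp
  qed
  finally have E_sum: "(\<Sum>l\<in>K. \<Sum>j\<in>E l. T j) \<le> 2 * (\<Sum>j<n. T j)"
    by (simp add: sum_distrib_left)
  have "(\<Sum>l\<in>K. (d (first l) * (4 ^ Suc l * \<sigma>)) powr q) \<le> (\<Sum>l\<in>K. 4 * 16 powr q * (\<Sum>j\<in>E l. T j))"
    by (rule sum_mono) (rule key, simp add: K_def)
  also have "\<dots> = 4 * 16 powr q * (\<Sum>l\<in>K. \<Sum>j\<in>E l. T j)"
    by (simp add: sum_distrib_left)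
  also have "\<dots> \<le> 4 * 16 powr q * (2 * (\<Sum>j<n. T j))"
    using E_sum by (intro mult_left_mono) auto
  finally have "(\<Sum>l\<in>K. (d (first l) * (4 ^ Suc l * \<sigma>)) powr q) \<le> 8 * 16 powr q * (\<Sum>j<n. T j)"
    by simp
  moreover have "mono lv"
    using lv_mono by (rule monoI)
  ultimately show ?thesis
    using hi by (intro exI[of _ lv]) (auto simp: K_def first_def T_def \<sigma>_def less_imp_le)
qed

section \<open>The fundamental function and the Lorentz estimate\<close>

lemma decreasing_enumeration:
  fixes v :: "nat \<Rightarrow> real"
  assumes "finite A"
  shows "\<exists>\<pi>. bij_betw \<pi> {..<card A} A \<and> (\<forall>i j. i \<le> j \<longrightarrow> j < card A \<longrightarrow> v (\<pi> j) \<le> v (\<pi> i))"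
proof -
  define ys where "ys = sort_key (\<lambda>n. - v n) (sorted_list_of_set A)"
  have ys: "distinct ys" "set ys = A" "length ys = card A" "sorted (map (\<lambda>n. - v n) ys)"
    using assms by (simp_all add: ys_def)
  show ?thesis
  proof (intro exI[of _ "(!) ys"] conjI allI impI)
    show "bij_betw ((!) ys) {..<card A} A"
      by (rule bij_betw_nth[OF ys(1)]) (simp_all only: ys(2,3))
    show "v (ys ! j) \<le> v (ys ! i)" if "i \<le> j" "j < card A" for i j
    proof -
      have "j < length ys"
        using that(2) by (simp only: ys(3))
      then show ?thesis
        using sorted_nth_mono[OF ys(4) that(1)] that(1) by simp
    qed
  qed
qed

text \<open>For \<open>t\<close> below \<open>norm (a (\<pi> j))\<close> the \<open>j + 1\<close>
  distinct indices \<open>\<pi> 0\<close> to \<open>\<pi> j\<close> all have modulus above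
  \<open>t\<close>, so \<open>t\<close> is not among the candidates for the infimum. The bound
  \<open>c\<close> is a candidate, so the infimum is over a nonempty set.\<close>

lemma norm_le_rearrangement:
  fixes a :: "nat \<Rightarrow> 'k::real_normed_vector"
  assumes bdd: "\<And>n. norm (a n) \<le> c" and inj: "inj_on \<pi> {..j}"
    and ge: "\<And>i. i \<le> j \<Longrightarrow> norm (a (\<pi> j)) \<le> norm (a (\<pi> i))"
  shows "norm (a (\<pi> j)) \<le> rearrangement a j"
  unfolding rearrangement_def
proof (rule cInf_greatest)
  have "0 \<le> c"
    using bdd[of 0] norm_ge_zero[of "a 0"] by linarith
  moreover have "{k. c < norm (a k)} = {}"
    using bdd by (auto simp: not_less)
  ultimately show "{t. 0 \<le> t \<and> finite {k. t < norm (a k)} \<and> card {k. t < norm (a k)} \<le> j} \<noteq> {}"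
    by (auto intro!: exI[of _ c])
next
  fix t assume "t \<in> {t. 0 \<le> t \<and> finite {k. t < norm (a k)} \<and> card {k. t < norm (a k)} \<le> j}"
  then have t: "finite {k. t < norm (a k)}" "card {k. t < norm (a k)} \<le> j"
    by auto
  show "norm (a (\<pi> j)) \<le> t"
  proof (rule ccontr)
    assume "\<not> norm (a (\<pi> j)) \<le> t"
    then have less: "t < norm (a (\<pi> j))"
      by simp
    have "\<pi> ` {..j} \<subseteq> {k. t < norm (a k)}"
    proof
      fix k assume "k \<in> \<pi> ` {..j}"
      then obtain i where "i \<le> j" "k = \<pi> i"
        by auto
      then show "k \<in> {k. t < norm (a k)}"
        using ge[of i] less by simp
    qed
    then have "card (\<pi> ` {..j}) \<le> card {k. t < norm (a k)}"
      using t(1) by (intro card_mono)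
    then show False
      using t(2) inj by (simp add: card_image)
  qed
qed

locale bounded_quasi_greedy_system = quasi_greedy_system smul x xs C
  for smul :: "'k::real_or_complex \<Rightarrow> 'a::banach \<Rightarrow> 'a" and x xs C +
  fixes K :: real
  assumes norm_x: "norm (x n) \<le> K"
    and x0: "x 0 \<noteq> 0"
begin

section \<open>Elementary properties of the fundamental function\<close>

abbreviation phi :: "nat \<Rightarrow> real" where
  "phi \<equiv> fundamental_function smul x"

definition unimodular_norms :: "nat \<Rightarrow> real set" where
  "unimodular_norms m = {norm (\<Sum>n\<in>A. smul (\<epsilon> n) (x n)) | A \<epsilon>.
     finite A \<and> card A \<le> m \<and> (\<forall>n\<in>A. norm (\<epsilon> n) = 1)}"

lemma phi_eq: "phi m = Sup (unimodular_norms m)"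
  by (simp add: fundamental_function_def unimodular_norms_def)

lemma unimodular_normsI:
  "finite A \<Longrightarrow> card A \<le> m \<Longrightarrow> (\<And>n. n \<in> A \<Longrightarrow> norm (b n) = 1) \<Longrightarrow>
    norm (lincomb b A) \<in> unimodular_norms m"
  unfolding unimodular_norms_def lincomb_def by blast

lemma unimodular_normsE:
  assumes "y \<in> unimodular_norms m"
  obtains A b where "finite A" "card A \<le> m" "\<And>n. n \<in> A \<Longrightarrow> norm (b n) = 1" "y = norm (lincomb b A)"
  using assms unfolding unimodular_norms_def lincomb_def by blast

lemma unimodular_norms_nonempty: "unimodular_norms m \<noteq> {}"
  using unimodular_normsI[of "{}" m "\<lambda>_. 0"] by auto

lemma unimodular_norms_bdd_above: "bdd_above (unimodular_norms m)"
proof (rule bdd_aboveI)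
  fix y assume "y \<in> unimodular_norms m"
  then obtain A b where A: "finite A" "card A \<le> m" "\<And>n. n \<in> A \<Longrightarrow> norm (b n) = 1"
    and y: "y = norm (lincomb b A)"
    by (rule unimodular_normsE) blast
  have "0 \<le> K"
    using norm_x[of 0] norm_ge_zero[of "x 0"] by linarith
  have "y \<le> of_nat (card A) * K"
    unfolding y lincomb_def
    by (rule order_trans[OF norm_sum sum_bounded_above]) (simp add: norm_scale A norm_x)
  also have "\<dots> \<le> real m * K"
    using A(2) \<open>0 \<le> K\<close> by (simp add: mult_right_mono)
  finally show "y \<le> real m * K" .
qed

lemma norm_unimodular_le:
  assumes "finite A" "card A \<le> m" "\<And>n. n \<in> A \<Longrightarrow> norm (b n) = 1"
  shows "norm (lincomb b A) \<le> phi m"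
  unfolding phi_eq using unimodular_normsI[OF assms] unimodular_norms_bdd_above by (rule cSup_upper)

lemma phi_0: "phi 0 = 0"
  using primitive_upper_weight[of smul x 0] by (simp add: primitive_def)

lemma phi_mono:
  assumes "i \<le> j"
  shows "phi i \<le> phi j"
  unfolding phi_eq
proof (rule cSup_least[OF unimodular_norms_nonempty])
  fix y assume "y \<in> unimodular_norms i"
  then obtain A b where "finite A" "card A \<le> i" "\<And>n. n \<in> A \<Longrightarrow> norm (b n) = 1" "y = norm (lincomb b A)"
    by (rule unimodular_normsE) blast
  then show "y \<le> Sup (unimodular_norms j)"
    using norm_unimodular_le[of A j b] assms by (simp add: phi_eq)
qed

lemma norm_x_le_phi: "norm (x n) \<le> phi 1"
  using norm_unimodular_le[of "{n}" 1 "\<lambda>_. 1"] by (simp add: lincomb_def)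

lemma phi_1_pos: "0 < phi 1"
  using norm_x_le_phi[of 0] x0 by (meson less_le_trans zero_less_norm_iff)

lemma phi_step: "phi (Suc m) \<le> phi m + phi 1"
  unfolding phi_eq[of "Suc m"]
proof (rule cSup_least[OF unimodular_norms_nonempty])
  fix y assume "y \<in> unimodular_norms (Suc m)"
  then obtain A b where A: "finite A" "card A \<le> Suc m" "\<And>n. n \<in> A \<Longrightarrow> norm (b n) = 1"
    and y: "y = norm (lincomb b A)"
    by (rule unimodular_normsE) blast
  show "y \<le> phi m + phi 1"
  proof (cases "A = {}")
    case True
    then show ?thesis
      using y phi_1_pos phi_mono[of 0 m] by (simp add: lincomb_def phi_0)
  next
    case False
    then obtain n where n: "n \<in> A"
      by blast
    have "lincomb b A = smul (b n) (x n) + lincomb b (A - {n})"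
      unfolding lincomb_def using A(1) n by (rule sum.remove)
    then have "y \<le> norm (x n) + norm (lincomb b (A - {n}))"
      using norm_triangle_ineq[of "smul (b n) (x n)" "lincomb b (A - {n})"] A(3)[OF n]
      by (simp add: y norm_scale)
    moreover have "norm (lincomb b (A - {n})) \<le> phi m"
      using A n by (intro norm_unimodular_le) auto
    ultimately show ?thesis
      using norm_x_le_phi[of n] by linarith
  qed
qed

text \<open>
  A scalar of modulus at most 1 is a convex combination of two opposite scalars of modulus 1, so
  the coefficients can be made unimodular one at a time.
\<close>

lemma norm_lincomb_le_phi_aux:
  assumes "finite B" "finite A"
  shows "\<forall>b :: nat \<Rightarrow> 'k. (\<forall>n\<in>A. norm (b n) \<le> 1) \<and> (\<forall>n\<in>A - B. norm (b n) = 1) \<longrightarrow>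
    norm (lincomb b A) \<le> phi (card A)"
  using assms(1)
\<comment> \<open>\<open>B\<close> holds the indices at which the modulus may still differ from 1;
  the full set \<open>A\<close> is the case wanted.\<close>
proof (induction B)
  case empty
  then show ?case
    using norm_unimodular_le[OF assms(2) order_refl] by simp
next
  case (insert m B)
  show ?case
  proof (intro allI impI, elim conjE)
    fix b :: "nat \<Rightarrow> 'k" assume b: "\<forall>n\<in>A. norm (b n) \<le> 1" "\<forall>n\<in>A - insert m B. norm (b n) = 1"
    define r where "r = norm (b m)"
    define \<beta> where "\<beta> = (if b m = 0 then 1 else b m / of_real r)"
    have \<beta>: "norm \<beta> = 1" "b m = of_real r * \<beta>"
      by (auto simp: \<beta>_def r_def norm_divide)
    show "norm (lincomb b A) \<le> phi (card A)"
    proof (cases "m \<in> A")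
      case False
      then show ?thesis
        using insert.IH b by auto
    next
      case True
      then have r: "0 \<le> r" "r \<le> 1"
        using b(1) by (auto simp: r_def)
      have bound: "norm (lincomb (b(m := \<gamma>)) A) \<le> phi (card A)" if "norm \<gamma> = 1" for \<gamma>
        using insert.IH b that by (auto intro!: insert.IH[rule_format])
      have split: "lincomb (b(m := \<gamma>)) A = smul \<gamma> (x m) + lincomb b (A - {m})" for \<gamma>
      proof -
        have "lincomb (b(m := \<gamma>)) (A - {m}) = lincomb b (A - {m})"
          by (rule lincomb_cong) simp
        then show ?thesis
          using sum.remove[OF assms(2) True, of "\<lambda>n. smul ((b(m := \<gamma>)) n) (x n)"]
          by (simp add: lincomb_def)
      qed
      define u where "u = smul \<beta> (x m)"
      have "lincomb b A = r *\<^sub>R u + lincomb b (A - {m})"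
      proof -
        have "lincomb b A = smul (b m) (x m) + lincomb b (A - {m})"
          using split[of "b m"] by simp
        also have "smul (b m) (x m) = r *\<^sub>R u"
          by (subst \<beta>(2)) (simp add: u_def flip: scale_of_real)
        finally show ?thesis .
      qed
      also have "\<dots> = ((1 + r) / 2) *\<^sub>R (u + lincomb b (A - {m})) + ((1 - r) / 2) *\<^sub>R (- u + lincomb b (A - {m}))"
      proof -
        have "((1 + r) / 2) *\<^sub>R (u + v) + ((1 - r) / 2) *\<^sub>R (- u + v)
            = ((1 + r) / 2 - (1 - r) / 2) *\<^sub>R u + ((1 + r) / 2 + (1 - r) / 2) *\<^sub>R v" for v
          by (simp only: scaleR_add_right scaleR_add_left scaleR_diff_left scaleR_minus_right) simp
        moreover have "(1 + r) / 2 - (1 - r) / 2 = r" "(1 + r) / 2 + (1 - r) / 2 = 1"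
          by (simp_all add: field_simps)
        ultimately show ?thesis
          by simp
      qed
      finally have "norm (lincomb b A) \<le> (1 + r) / 2 * norm (u + lincomb b (A - {m}))
          + (1 - r) / 2 * norm (- u + lincomb b (A - {m}))"
        using norm_triangle_ineq[of "((1 + r) / 2) *\<^sub>R (u + lincomb b (A - {m}))"
            "((1 - r) / 2) *\<^sub>R (- u + lincomb b (A - {m}))"] r by simp
      also have "\<dots> \<le> (1 + r) / 2 * phi (card A) + (1 - r) / 2 * phi (card A)"
      proof (intro add_mono mult_left_mono)
        show "norm (u + lincomb b (A - {m})) \<le> phi (card A)"
          using bound[OF \<beta>(1)] by (simp add: split u_def)
        show "norm (- u + lincomb b (A - {m})) \<le> phi (card A)"
          using bound[of "- \<beta>"] \<beta>(1) by (simp add: split u_def)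
      qed (use r in auto)
      also have "\<dots> = phi (card A)"
        by (simp add: field_simps)
      finally show ?thesis .
    qed
  qed
qed

lemma norm_lincomb_le_phi:
  assumes A: "finite A" and b: "\<And>n. n \<in> A \<Longrightarrow> norm (b n) \<le> t" and t: "0 \<le> t"
  shows "norm (lincomb b A) \<le> t * phi (card A)"
proof (cases "t = 0")
  case True
  then have "lincomb b A = 0"
    using b by (auto simp: lincomb_def intro!: sum.neutral)
  with True show ?thesis
    by simp
next
  case False
  then have "0 < t"
    using t by simp
  have "norm (of_real (1 / t) * b n) \<le> 1" if "n \<in> A" for n
    using b[OF that] \<open>0 < t\<close> by (simp add: norm_mult norm_divide)
  then have "norm (lincomb (\<lambda>n. of_real (1 / t) * b n) A) \<le> phi (card A)"
    using norm_lincomb_le_phi_aux[OF A A] by simp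
  moreover have "lincomb (\<lambda>n. of_real (1 / t) * b n) A = (1 / t) *\<^sub>R lincomb b A"
    by (simp only: lincomb_scale scale_of_real)
  ultimately have "norm (lincomb b A) / t \<le> phi (card A)"
    using \<open>0 < t\<close> by simp
  then show ?thesis
    using \<open>0 < t\<close> by (simp add: divide_le_eq mult.commute)
qed

text \<open>The terms of the \<open>q\<close>-th power of the Lorentz quasi-norm for the weight with
  primitive \<open>phi\<close>. The sequence \<open>d\<close> is arbitrary, so that the coefficients
  of finite pieces can be compared with the rearrangement and with constants.\<close>

definition lorentz_term :: "real \<Rightarrow> (nat \<Rightarrow> real) \<Rightarrow> nat \<Rightarrow> real" where
  "lorentz_term q d j = (d j * phi (Suc j)) powr q * ((phi (Suc j) - phi j) / phi (Suc j))"

lemma phi_Suc_pos: "0 < phi (Suc j)"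
  using phi_1_pos phi_mono[of 1 "Suc j"] by simp

lemma lorentz_term_nonneg: "0 \<le> lorentz_term q d j"
  unfolding lorentz_term_def using phi_Suc_pos[of j] phi_mono[of j "Suc j"] by simp

lemma lorentz_term_mono:
  assumes "0 < q" "0 \<le> d j" "d j \<le> e j"
  shows "lorentz_term q d j \<le> lorentz_term q e j"
  unfolding lorentz_term_def using assms phi_Suc_pos[of j] phi_mono[of j "Suc j"]
  by (intro mult_right_mono powr_mono2) auto

text \<open>The part of the sum on one level is at most its largest coefficient times
  \<open>phi\<close> of its size, and the latter is below the upper threshold of the level. The
  upper estimate sums the \<open>q\<close>-th powers of these bounds, and
  \<open>level_sum_estimate\<close> converts them into Lorentz terms. The constants \<open>q\<close>
  and \<open>D\<close> serve all finite sums at once.\<close>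

lemma lorentz_estimate:
  assumes "superreflexive (space_of smul)"
  shows "\<exists>q D. 1 < q \<and> 0 < D \<and> (\<forall>a A \<pi>. finite A \<longrightarrow> bij_betw \<pi> {..<card A} A \<longrightarrow>
    (\<forall>i j. i \<le> j \<longrightarrow> j < card A \<longrightarrow> norm (a (\<pi> j)) \<le> norm (a (\<pi> i))) \<longrightarrow>
    norm (lincomb a A) \<le> D * (\<Sum>j<card A. lorentz_term q (\<lambda>j. norm (a (\<pi> j))) j) powr (1 / q))"
proof -
  obtain N \<rho> where N: "2 \<le> N" and \<rho>: "0 < \<rho>" "\<rho> < 1"
    and contraction: "\<And>f t. decreasing_blocks f N \<Longrightarrow> (\<And>i. i < N \<Longrightarrow> norm (f i) \<le> t) \<Longrightarrow>
      norm (\<Sum>i<N. f i) \<le> \<rho> * real N * t"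
    using block_sum_contraction[OF assms] by blast
  obtain q where q: "1 < q" and exponent: "\<rho> * (real N * (1 / real N) powr (1 / q)) \<le> (1 + \<rho>) / 2"
    using ex_contracting_exponent[OF N \<rho>] by blast
  define D1 where "D1 = 2 * real N / (1 - \<rho>)"
  have D1: "0 < D1"
    using N \<rho> by (simp add: D1_def)
  define c where "c = (8 * 16 powr q :: real)"
  have c: "0 < c"
    by (simp add: c_def)
  define D where "D = D1 * c powr (1 / q)"
  have "0 < D"
    using D1 c by (simp add: D_def)
  moreover have "norm (lincomb a A) \<le> D * (\<Sum>j<card A. lorentz_term q (\<lambda>j. norm (a (\<pi> j))) j) powr (1 / q)"
    if A: "finite A" and \<pi>: "bij_betw \<pi> {..<card A} A"
      and dec: "\<forall>i j. i \<le> j \<longrightarrow> j < card A \<longrightarrow> norm (a (\<pi> j)) \<le> norm (a (\<pi> i))" for a A \<pi>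
  proof -
    define n where "n = card A"
    define d where "d j = norm (a (\<pi> j))" for j
    have inj: "inj_on \<pi> {..<n}"
      using \<pi> by (simp add: bij_betw_def n_def)
    have d_mono: "d j \<le> d i" if "i \<le> j" "j < n" for i j
      using dec that by (simp add: d_def n_def)
    have d_nonneg: "0 \<le> d j" for j
      by (simp add: d_def)
    have "\<exists>lv :: nat \<Rightarrow> nat. mono lv \<and> (\<forall>j. phi (Suc j) \<le> 4 ^ Suc (lv j) * phi 1) \<and>
      (\<Sum>l\<in>lv ` {..<n}. (d (LEAST j. lv j = l) * (4 ^ Suc l * phi 1)) powr q)
        \<le> c * (\<Sum>j<n. lorentz_term q d j)"
      unfolding lorentz_term_def c_def
      by (rule level_sum_estimate[OF phi_0 phi_1_pos phi_mono phi_step d_mono d_nonneg]) (use q in simp_all)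
    then obtain lv :: "nat \<Rightarrow> nat" where "mono lv \<and> (\<forall>j. phi (Suc j) \<le> 4 ^ Suc (lv j) * phi 1) \<and>
      (\<Sum>l\<in>lv ` {..<n}. (d (LEAST j. lv j = l) * (4 ^ Suc l * phi 1)) powr q)
        \<le> c * (\<Sum>j<n. lorentz_term q d j)"
      by (elim exE)
    then have lv: "mono lv" and phi_lv: "\<And>j. phi (Suc j) \<le> 4 ^ Suc (lv j) * phi 1"
      and levels: "(\<Sum>l\<in>lv ` {..<n}. (d (LEAST j. lv j = l) * (4 ^ Suc l * phi 1)) powr q)
        \<le> c * (\<Sum>j<n. lorentz_term q d j)"
      by blast+
    define L where "L l = {j. j < n \<and> lv j = l}" for l
    define h where "h j = smul (a (\<pi> j)) (x (\<pi> j))" for j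
    define f where "f l = (\<Sum>j\<in>L l. h j)" for l
    have h: "decreasing_blocks h n"
    proof (rule decreasing_blocksI[where a = a and A = "\<lambda>j. {\<pi> j}"])
      show "{\<pi> i} \<inter> {\<pi> j} = {}" if "i < j" "j < n" for i j
        using inj_onD[OF inj, of i j] that by auto
      show "norm (a k) \<le> norm (a m)" if "i < j" "j < n" "m \<in> {\<pi> i}" "k \<in> {\<pi> j}" for i j m k
        using d_mono[of i j] that by (simp add: d_def)
    qed (simp_all add: h_def lincomb_def)
    have L_disj: "L l \<inter> L l' = {}" if "l \<noteq> l'" for l l'
      using that by (auto simp: L_def)
    have finite_L: "finite (L l)" for l
      by (simp add: L_def)
    have sum_f: "(\<Sum>l\<in>J. f l) = (\<Sum>j\<in>(\<Union>l\<in>J. L l). h j)" if "finite J" for J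
      unfolding f_def using that L_disj finite_L by (intro sum.UNION_disjoint[symmetric]) auto
    define M where "M = lv ` {..<n}"
    have M: "finite M"
      by (simp add: M_def)
    have upper: "norm (\<Sum>l\<in>M. f l) \<le> D1 * (\<Sum>l\<in>M. norm (f l) powr q) powr (1 / q)"
      unfolding D1_def
    proof (rule upper_estimate[OF N \<rho> q exponent M])
      fix J :: "nat \<Rightarrow> nat set" and t
      assume J: "\<And>i. i < N \<Longrightarrow> J i \<subseteq> M"
        and less: "\<And>i i' j j'. i < i' \<Longrightarrow> i' < N \<Longrightarrow> j \<in> J i \<Longrightarrow> j' \<in> J i' \<Longrightarrow> j < j'"
        and t: "\<And>i. i < N \<Longrightarrow> norm (\<Sum>l\<in>J i. f l) \<le> t"
      have eq: "(\<Sum>l\<in>J i. f l) = (\<Sum>j\<in>(\<Union>l\<in>J i. L l). h j)" if "i < N" for i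
        using finite_subset[OF J[OF that] M] by (rule sum_f)
      \<comment> \<open>Ordered sets of levels pull back to ordered sets of indices because
        \<open>lv\<close> is monotone, so the contraction for decreasing blocks applies to groups of
        levels.\<close>
      have "decreasing_blocks (\<lambda>i. \<Sum>j\<in>(\<Union>l\<in>J i. L l). h j) N"
      proof (rule decreasing_blocks_group[OF h])
        show "(\<Union>l\<in>J i. L l) \<subseteq> {..<n}" for i
          by (auto simp: L_def)
        fix i i' j j' assume i: "i < i'" "i' < N" and "j \<in> (\<Union>l\<in>J i. L l)" "j' \<in> (\<Union>l\<in>J i'. L l)"
        then have "lv j \<in> J i" "lv j' \<in> J i'"
          by (auto simp: L_def)
        then have "lv j < lv j'"
          by (rule less[OF i])
        show "j < j'"
        proof (rule ccontr)
          assume "\<not> j < j'"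
          then have "lv j' \<le> lv j"
            by (intro monoD[OF lv]) simp
          with \<open>lv j < lv j'\<close> show False
            by simp
        qed
      qed
      then have "norm (\<Sum>i<N. \<Sum>j\<in>(\<Union>l\<in>J i. L l). h j) \<le> \<rho> * real N * t"
        by (rule contraction) (use t in \<open>simp add: eq[symmetric]\<close>)
      then show "norm (\<Sum>i<N. \<Sum>l\<in>J i. f l) \<le> \<rho> * real N * t"
        by (simp add: eq)
    qed
    have norm_f: "norm (f l) \<le> d (LEAST j. lv j = l) * (4 ^ Suc l * phi 1)" if l: "l \<in> M" for l
    proof -
      obtain i where i: "i < n" "lv i = l"
        using l by (auto simp: M_def)
      define j0 where "j0 = (LEAST j. lv j = l)"
      have j0_le: "j0 \<le> j" if "j \<in> L l" for j
        unfolding j0_def using that by (intro Least_le) (simp add: L_def)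
      have "f l = lincomb a (\<pi> ` L l)"
      proof -
        have "inj_on \<pi> (L l)"
          using inj by (rule inj_on_subset) (auto simp: L_def)
        then show ?thesis
          by (simp add: f_def h_def lincomb_def sum.reindex)
      qed
      moreover have "norm (lincomb a (\<pi> ` L l)) \<le> d j0 * phi (card (\<pi> ` L l))"
      proof (rule norm_lincomb_le_phi)
        fix k assume "k \<in> \<pi> ` L l"
        then obtain j where "j \<in> L l" "k = \<pi> j"
          by blast
        then show "norm (a k) \<le> d j0"
          using d_mono[OF j0_le, of j] by (simp add: d_def L_def)
      qed (simp_all add: finite_L d_def)
      moreover have "phi (card (\<pi> ` L l)) \<le> 4 ^ Suc l * phi 1"
      proof -
        \<comment> \<open>The level has at most \<open>Suc j1\<close> indices, and
          \<open>Suc j1\<close> is precisely the argument at which the level of \<open>j1\<close>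
          bounds \<open>phi\<close>.\<close>
        define j1 where "j1 = Max (L l)"
        have "i \<in> L l"
          using i by (simp add: L_def)
        then have j1: "j1 \<in> L l"
          unfolding j1_def using finite_L by (intro Max_in) auto
        have "L l \<subseteq> {..j1}"
          unfolding j1_def using finite_L by (auto intro: Max_ge)
        then have "card (L l) \<le> card {..j1}"
          by (intro card_mono) auto
        then have "card (\<pi> ` L l) \<le> Suc j1"
          using card_image_le[OF finite_L, of \<pi> l] by simp
        then have "phi (card (\<pi> ` L l)) \<le> phi (Suc j1)"
          by (rule phi_mono)
        then show ?thesis
          using phi_lv[of j1] j1 by (simp add: L_def)
      qed
      ultimately show ?thesis
        using mult_left_mono[of "phi (card (\<pi> ` L l))" "4 ^ Suc l * phi 1" "d j0"]
        by (simp add: d_def j0_def)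
    qed
    have "(\<Sum>l\<in>M. f l) = lincomb a A"
    proof -
      have "(\<Union>l\<in>M. L l) = {..<n}"
        by (auto simp: M_def L_def)
      then have "(\<Sum>l\<in>M. f l) = (\<Sum>j<n. h j)"
        by (simp add: sum_f[OF M])
      also have "\<dots> = lincomb a A"
        unfolding h_def lincomb_def n_def by (rule sum.reindex_bij_betw[OF \<pi>])
      finally show ?thesis .
    qed
    then have "norm (lincomb a A) \<le> D1 * (\<Sum>l\<in>M. norm (f l) powr q) powr (1 / q)"
      using upper by simp
    also have "\<dots> \<le> D1 * (c * (\<Sum>j<n. lorentz_term q d j)) powr (1 / q)"
    proof (intro mult_left_mono powr_mono2)
      have "(\<Sum>l\<in>M. norm (f l) powr q) \<le> (\<Sum>l\<in>M. (d (LEAST j. lv j = l) * (4 ^ Suc l * phi 1)) powr q)"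
        using norm_f q by (intro sum_mono powr_mono2) auto
      then show "(\<Sum>l\<in>M. norm (f l) powr q) \<le> c * (\<Sum>j<n. lorentz_term q d j)"
        using levels by (simp add: M_def)
    qed (use q D1 in \<open>auto intro: sum_nonneg\<close>)
    also have "\<dots> = D * (\<Sum>j<n. lorentz_term q d j) powr (1 / q)"
      by (simp add: D_def powr_mult)
    finally show ?thesis
      by (simp add: n_def d_def[abs_def])
  qed
  ultimately show ?thesis
    using q by blast
qed

text \<open>In a late stretch of the series, sorted by modulus, ranks from \<open>n0\<close> on are
  dominated by the rearrangement, whose tail is small by summability. The finitely many ranks below
  \<open>n0\<close> are harmless because all coefficients of the stretch are small. Together this is
  the Cauchy criterion.\<close>

lemma lorentz_summable:
  assumes q: "1 < q" and D: "0 < D"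
    and estimate: "\<And>A \<pi>. finite A \<Longrightarrow> bij_betw \<pi> {..<card A} A \<Longrightarrow>
      (\<And>i j. i \<le> j \<Longrightarrow> j < card A \<Longrightarrow> norm (a (\<pi> j)) \<le> norm (a (\<pi> i))) \<Longrightarrow>
      norm (lincomb a A) \<le> D * (\<Sum>j<card A. lorentz_term q (\<lambda>j. norm (a (\<pi> j))) j) powr (1 / q)"
    and a: "a \<in> lorentz q (upper_weight smul x)"
  shows "summable (\<lambda>n. smul (a n) (x n))"
proof -
  have lim: "a \<longlonglongrightarrow> 0"
    using a by (simp add: lorentz_def)
  then obtain c where c: "\<And>n. norm (a n) \<le> c"
    using convergent_imp_bounded[of a] convergentI unfolding bounded_iff by blast
  define r where "r = rearrangement a"
  have summable: "summable (lorentz_term q r)"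
    using a by (simp add: lorentz_def lorentz_term_def[abs_def] primitive_upper_weight upper_weight_def r_def)
  show ?thesis
    unfolding summable_Cauchy
  proof (intro allI impI)
    fix e :: real assume e: "0 < e"
    \<comment> \<open>With this choice \<open>D * \<delta> powr (1 / q)\<close> equals
      \<open>e / 2\<close>.\<close>
    define \<delta> where "\<delta> = (e / (2 * D)) powr q"
    have \<delta>: "0 < \<delta>" "D * \<delta> powr (1 / q) < e"
      using e D q by (auto simp: \<delta>_def powr_powr)
    obtain n0 where n0: "\<And>n. (\<Sum>j=n0..<n. lorentz_term q r j) < \<delta> / 2"
    proof -
      have "0 < \<delta> / 2"
        using \<delta> by simp
      then obtain n0 where "\<forall>m\<ge>n0. \<forall>n. norm (\<Sum>j=m..<n. lorentz_term q r j) < \<delta> / 2"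
        using summable unfolding summable_Cauchy by blast
      then have "\<bar>\<Sum>j=n0..<n. lorentz_term q r j\<bar> < \<delta> / 2" for n
        by simp
      then show ?thesis
        by (rule that[of n0, OF order_le_less_trans[OF abs_ge_self]])
    qed
    define P where "P = (\<Sum>j<n0. lorentz_term q (\<lambda>_. 1) j)"
    have P: "0 \<le> P"
      unfolding P_def by (intro sum_nonneg lorentz_term_nonneg)
    \<comment> \<open>Coefficients of modulus at most \<open>\<tau>\<close> make the first
      \<open>n0\<close> terms contribute at most \<open>\<delta> / 2\<close>; adding 1 keeps the
      denominator positive when \<open>P = 0\<close>.\<close>
    define \<tau> where "\<tau> = (\<delta> / (2 * (P + 1))) powr (1 / q)"
    have \<tau>: "0 < \<tau>" "\<tau> powr q = \<delta> / (2 * (P + 1))"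
      using \<delta> P q by (simp_all add: \<tau>_def powr_powr)
    have \<tau>_P: "\<tau> powr q * P \<le> \<delta> / 2"
    proof -
      have "\<tau> powr q * P = \<delta> / 2 * (P / (P + 1))"
        using P by (simp add: \<tau>)
      also have "\<dots> \<le> \<delta> / 2 * 1"
        using \<delta> P by (intro mult_left_mono) auto
      finally show ?thesis
        by simp
    qed
    obtain m0 where m0: "\<And>k. m0 \<le> k \<Longrightarrow> norm (a k) < \<tau>"
      using LIMSEQ_D[OF lim \<tau>(1)] by auto
    have "norm (\<Sum>k=m..<n. smul (a k) (x k)) < e" if m: "m0 \<le> m" for m n
    proof -
      define A where "A = {m..<n}"
      have A: "finite A"
        by (simp add: A_def)
      obtain \<pi> where \<pi>: "bij_betw \<pi> {..<card A} A"
        and dec: "\<And>i j. i \<le> j \<Longrightarrow> j < card A \<Longrightarrow> norm (a (\<pi> j)) \<le> norm (a (\<pi> i))"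
        using decreasing_enumeration[OF A, of "\<lambda>k. norm (a k)"] by blast
      define d where "d j = norm (a (\<pi> j))" for j
      have d_r: "d j \<le> r j" if "j < card A" for j
        unfolding d_def r_def
      proof (rule norm_le_rearrangement[OF c])
        show "inj_on \<pi> {..j}"
          using \<pi> that unfolding bij_betw_def by (auto intro: inj_on_subset)
        show "norm (a (\<pi> j)) \<le> norm (a (\<pi> i))" if "i \<le> j" for i
          using that \<open>j < card A\<close> by (rule dec)
      qed
      have d_\<tau>: "d j \<le> \<tau>" if "j < card A" for j
      proof -
        have "\<pi> j \<in> A"
          using \<pi> that by (auto simp: bij_betw_def)
        then show ?thesis
          using m0[of "\<pi> j"] m by (simp add: A_def d_def)
      qed
      have d_0: "0 \<le> d j" for j
        by (simp add: d_def)
      have "(\<Sum>j<card A. lorentz_term q d j) \<le> (\<Sum>j<n0. \<tau> powr q * lorentz_term q (\<lambda>_. 1) j)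
          + (\<Sum>j=n0..<card A. lorentz_term q r j)"
      proof -
        have "(\<Sum>j<card A. lorentz_term q d j) \<le>
            (\<Sum>j\<in>{j. j < card A \<and> j < n0}. lorentz_term q d j) + (\<Sum>j=n0..<card A. lorentz_term q d j)"
        proof -
          have "{..<card A} = {j. j < card A \<and> j < n0} \<union> {n0..<card A}"
            by auto
          moreover have "{j. j < card A \<and> j < n0} \<inter> {n0..<card A} = {}"
            by auto
          ultimately show ?thesis
            by (simp add: sum.union_disjoint)
        qed
        also have "\<dots> \<le> (\<Sum>j\<in>{j. j < card A \<and> j < n0}. \<tau> powr q * lorentz_term q (\<lambda>_. 1) j)
            + (\<Sum>j=n0..<card A. lorentz_term q r j)"
        proof (intro add_mono sum_mono)
          fix j assume "j \<in> {j. j < card A \<and> j < n0}"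
          then have "lorentz_term q d j \<le> lorentz_term q (\<lambda>_. \<tau>) j"
            using q d_0 d_\<tau> by (intro lorentz_term_mono) auto
          also have "\<dots> = \<tau> powr q * lorentz_term q (\<lambda>_. 1) j"
            by (simp add: lorentz_term_def powr_mult)
          finally show "lorentz_term q d j \<le> \<tau> powr q * lorentz_term q (\<lambda>_. 1) j" .
        next
          fix j assume "j \<in> {n0..<card A}"
          then show "lorentz_term q d j \<le> lorentz_term q r j"
            using q d_0 d_r by (intro lorentz_term_mono) auto
        qed
        also have "(\<Sum>j\<in>{j. j < card A \<and> j < n0}. \<tau> powr q * lorentz_term q (\<lambda>_. 1) j)
            \<le> (\<Sum>j<n0. \<tau> powr q * lorentz_term q (\<lambda>_. 1) j)"
          by (intro sum_mono2) (auto simp: lorentz_term_nonneg)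
        finally show ?thesis
          by simp
      qed
      also have "\<dots> \<le> \<delta>"
        using n0[of "card A"] \<tau>_P by (simp add: P_def sum_distrib_left)
      finally have le_\<delta>: "(\<Sum>j<card A. lorentz_term q d j) \<le> \<delta>" .
      have "norm (lincomb a A) \<le> D * (\<Sum>j<card A. lorentz_term q d j) powr (1 / q)"
        unfolding d_def using A \<pi> dec by (rule estimate)
      also have "\<dots> \<le> D * \<delta> powr (1 / q)"
        using D q le_\<delta> lorentz_term_nonneg by (intro mult_left_mono powr_mono2 sum_nonneg) auto
      also have "\<dots> < e"
        by (rule \<delta>)
      finally show ?thesis
        by (simp add: lincomb_def A_def)
    qed
    then show "\<exists>M. \<forall>m\<ge>M. \<forall>n. norm (\<Sum>k=m..<n. smul (a k) (x k)) < e"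
      by blast
  qed
qed

end

theorem theorem4p1:
  fixes smul :: "'k::real_or_complex \<Rightarrow> 'a::banach \<Rightarrow> 'a"
    and x :: "nat \<Rightarrow> 'a"
    and xs :: "nat \<Rightarrow> 'a \<Rightarrow> 'k"
  assumes "scalar_banach smul"
    and "\<nexists>B. finite B \<and> module.span smul B = UNIV"
    and "separable_space (euclidean :: 'a topology)"
    and "superreflexive (space_of smul)"
    and "basis smul x xs"
    and "quasi_greedy smul x xs"
  shows "\<exists>q>1. embeds_via (lorentz q (upper_weight smul x)) smul x"
proof -
  interpret scalar_banach smul by fact
  have xs: "xs n \<in> points (dual (space_of smul))" for n
    using assms(5) by (simp add: basis_def)
  obtain c where c: "0 < c" "\<And>n. c \<le> norm (x n)"
    using assms(5) unfolding basis_def by blast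
  obtain K where K: "\<And>n. norm (x n) \<le> K"
    using assms(5) unfolding basis_def by blast
  obtain C where C: "\<And>f m. max (norm (f - greedy_sum smul x xs m f)) (norm (greedy_sum smul x xs m f))
      \<le> C * norm f"
    using assms(6) unfolding quasi_greedy_def by blast
  interpret bounded_quasi_greedy_system smul x xs "max 1 C" K
  proof
    show "xs n (u + v) = xs n u + xs n v" "xs n (smul t u) = t * xs n u" for n u v t
      using xs[of n] by (simp_all add: dual_def linear_map_on_def space_of_def scalar_space_def)
    show "xs n (x k) = (if n = k then 1 else 0)" for n k
      using assms(5) by (simp add: basis_def)
    show "(\<lambda>n. xs n f) \<longlonglongrightarrow> 0" for f
      using assms(6) by (simp add: quasi_greedy_def)
    show "norm (greedy_sum smul x xs m f) \<le> max 1 C * norm f" for m f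
      using C[of f m] mult_right_mono[of C "max 1 C" "norm f"] by simp
    show "x 0 \<noteq> 0"
      using c(1) c(2)[of 0] by auto
  qed (use K in auto)
  obtain q D where qD: "1 < q" "0 < D" and estimate: "\<forall>a A \<pi>. finite A \<longrightarrow> bij_betw \<pi> {..<card A} A \<longrightarrow>
    (\<forall>i j. i \<le> j \<longrightarrow> j < card A \<longrightarrow> norm (a (\<pi> j)) \<le> norm (a (\<pi> i))) \<longrightarrow>
    norm (lincomb a A) \<le> D * (\<Sum>j<card A. lorentz_term q (\<lambda>j. norm (a (\<pi> j))) j) powr (1 / q)"
    using lorentz_estimate[OF assms(4)] by blast
  have "summable (\<lambda>n. smul (a n) (x n))" if "a \<in> lorentz q (upper_weight smul x)" for a
    by (rule lorentz_summable[OF qD _ that]) (simp add: estimate)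
  then show ?thesis
    using qD(1) unfolding embeds_via_def by blast
qed

end
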